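(* Let $\Sigma$ be a closed surface, let $f=1+u:\Sigma\to(0,\infty)$ be the smooth function constructed in the context, let $\Lambda$ be a compact, connected, oriented surface, and let $\nu$ be a volume form on $\Lambda$. Let $\pi_{\nu,f}$ be the regular Poisson structure on $\Sigma\times\Lambda$ whose symplectic leaves are $\big(\{p\}\times\Lambda,\ f(p)\,\nu\big)$, $p\in\Sigma$. Then $\mathrm{Poiss}(\Sigma\times\Lambda,\pi_{\nu,f})$, endowed with the $C^\infty$-topology, is not locally path-connected; moreover, any neighborhood of the identity in $\mathrm{Poiss}(\Sigma\times\Lambda,\pi_{\nu,f})$ intersects an uncountable number of path-connected components of $\mathrm{Poiss}(\Sigma\times\Lambda,\pi_{\nu,f})$.
   Context: For a Poisson manifold $(M,\pi)$, $\mathrm{Poiss}(M,\pi)=\{\phi\in \mathrm{Diff}(M) : \phi_*(\pi)=\pi\}$, with the $C^\infty$-topology inherited from $\mathrm{Diff}(M)$. Construction of $u$ and $f$. Fix a closed disk $B\subset\Sigma$ contained in a coordinate chart $x=(x_1,x_2)$ which identifies $B$ with the closed disk of radius $1$ around $0$ in $\mathbb{R}^2=\mathbb{C}$. Fix a smooth function $\chi:\mathbb{R}\to[0,1]$ with $\chi(t)=0$ for $|t|\ge 1$, $\chi(t)>0$ for $1/2<|t|<1$, and $\chi(t)=1$ for $|t|\le 1/2$. For integers $n\ge 4$ and $1\le s\le 2^n$ let $$p(n,s):=\frac1n\exp\left(\frac{2\pi s}{2^n}i\right),\qquad \delta_n:=\frac{1}{n2^n}$$ (here $\pi$ is the number and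 $i$ the imaginary unit). Let $u:\Sigma\to[0,\infty)$ be the function given on $B$ by $$u(x)=\sum_{n=4}^\infty\frac{1}{n!}\sum_{s=1}^{2^n}\chi\left(\frac{|x-p(n,s)|}{\delta_n}\right),$$ and by $u=0$ on $\Sigma\setminus B$. The series converges uniformly on $B$ together with all derivatives, and $u$ is smooth. Set $f:=u+1$. *)

theory Defs
  imports "HOL-Analysis.Analysis"
begin

section \<open>Smoothness in Euclidean space\<close>

fun partial_deriv :: "'e list \<Rightarrow> ('e::euclidean_space \<Rightarrow> 'f::real_normed_vector) \<Rightarrow> 'e \<Rightarrow> 'f" where
  "partial_deriv [] f = f"
| "partial_deriv (v # vs) f = (\<lambda>x. frechet_derivative (partial_deriv vs f) (at x) v)"

text \<open>Only used for open sets \<open>S\<close>: all iterated partial derivatives exist and are differentiable,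
  that is, \<open>f\<close> is of class \<open>C\<^sup>\<infinity>\<close> on \<open>S\<close>.\<close>

definition smooth_on :: "'e::euclidean_space set \<Rightarrow> ('e \<Rightarrow> 'f::real_normed_vector) \<Rightarrow> bool" where
  "smooth_on S f \<longleftrightarrow>
     (\<forall>vs. set vs \<subseteq> Basis \<longrightarrow> (\<forall>x\<in>S. partial_deriv vs f differentiable (at x)))"

section \<open>Smooth manifolds\<close>

text \<open>A manifold is a whole (topological) type together with an atlas of charts with values in a
  Euclidean space. A chart is a pair of its domain and its coordinate map; values of the coordinate
  map outside the domain are irrelevant. Manifolds have no boundary, since the images of charts are
  open. The Hausdorff and second countability axioms are imposed as sort constraints in the
  definition of an atlas.\<close>

type_synonym ('a, 'e) chart = "'a set \<times> ('a \<Rightarrow> 'e)"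

definition chart_inv :: "('a, 'e) chart \<Rightarrow> 'e \<Rightarrow> 'a" where
  "chart_inv c = inv_into (fst c) (snd c)"

definition is_chart :: "('a::topological_space, 'e::euclidean_space) chart \<Rightarrow> bool" where
  "is_chart c \<longleftrightarrow> open (fst c) \<and> open (snd c ` fst c) \<and>
     homeomorphism (fst c) (snd c ` fst c) (snd c) (chart_inv c)"

definition compatible ::
  "('a::topological_space, 'e::euclidean_space) chart \<Rightarrow> ('a, 'e) chart \<Rightarrow> bool" where
  "compatible c d \<longleftrightarrow>
     smooth_on (snd c ` (fst c \<inter> fst d)) (snd d \<circ> chart_inv c) \<and>
     smooth_on (snd d ` (fst c \<inter> fst d)) (snd c \<circ> chart_inv d)"

definition smooth_atlas ::
  "('a::{t2_space, second_countable_topology}, 'e::euclidean_space) chart set \<Rightarrow> bool" where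
  "smooth_atlas A \<longleftrightarrow> (\<forall>c\<in>A. is_chart c) \<and> (\<forall>c\<in>A. \<forall>d\<in>A. compatible c d) \<and>
     (\<Union>c\<in>A. fst c) = UNIV"

definition max_atlas ::
  "('a::topological_space, 'e::euclidean_space) chart set \<Rightarrow> ('a, 'e) chart set" where
  "max_atlas A = {c. is_chart c \<and> (\<forall>d\<in>A. compatible c d)}"

definition chart_at ::
  "('a::topological_space, 'e::euclidean_space) chart set \<Rightarrow> 'a \<Rightarrow> ('a, 'e) chart" where
  "chart_at A p = (SOME c. c \<in> max_atlas A \<and> p \<in> fst c)"

definition product_atlas ::
  "('a, 'e) chart set \<Rightarrow> ('b, 'f) chart set \<Rightarrow> ('a \<times> 'b, 'e \<times> 'f) chart set" where
  "product_atlas A B = {(fst c \<times> fst d, map_prod (snd c) (snd d)) | c d. c \<in> A \<and> d \<in> B}"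

definition local_rep ::
  "('a, 'e) chart \<Rightarrow> ('b, 'f) chart \<Rightarrow> ('a \<Rightarrow> 'b) \<Rightarrow> 'e \<Rightarrow> 'f" where
  "local_rep c d g = snd d \<circ> g \<circ> chart_inv c"

definition smooth_map ::
  "('a::topological_space, 'e::euclidean_space) chart set \<Rightarrow>
   ('b::topological_space, 'f::euclidean_space) chart set \<Rightarrow> ('a \<Rightarrow> 'b) \<Rightarrow> bool" where
  "smooth_map A B g \<longleftrightarrow> continuous_on UNIV g \<and>
     (\<forall>c\<in>max_atlas A. \<forall>d\<in>max_atlas B.
        smooth_on (snd c ` (fst c \<inter> g -` fst d)) (local_rep c d g))"

definition smooth_function ::
  "('a::topological_space, 'e::euclidean_space) chart set \<Rightarrow> ('a \<Rightarrow> real) \<Rightarrow> bool" where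
  "smooth_function A g \<longleftrightarrow> smooth_map A {(UNIV, id)} g"

definition Diff ::
  "('a::topological_space, 'e::euclidean_space) chart set \<Rightarrow> ('a \<Rightarrow> 'a) set" where
  "Diff A = {\<phi>. bij \<phi> \<and> smooth_map A A \<phi> \<and> smooth_map A A (inv \<phi>)}"

text \<open>The differential of \<open>g\<close> at \<open>p\<close>, expressed in charts \<open>c\<close> and \<open>d\<close>.\<close>

definition differential ::
  "('a, 'e::euclidean_space) chart \<Rightarrow> ('b, 'f::euclidean_space) chart \<Rightarrow>
   ('a \<Rightarrow> 'b) \<Rightarrow> 'a \<Rightarrow> 'e \<Rightarrow> 'f" where
  "differential c d g p = frechet_derivative (local_rep c d g) (at (snd c p))"

section \<open>The smooth compact-open topology\<close>

definition Cinf_nbhd ::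
  "('a::topological_space, 'e::euclidean_space) chart set \<Rightarrow>
   ('b::topological_space, 'f::euclidean_space) chart set \<Rightarrow>
   nat \<Rightarrow> ('a \<Rightarrow> 'b) \<Rightarrow> ('a, 'e) chart \<Rightarrow> ('b, 'f) chart \<Rightarrow> 'a set \<Rightarrow> real \<Rightarrow> ('a \<Rightarrow> 'b) set" where
  "Cinf_nbhd A B k g c d K \<epsilon> =
     {h. smooth_map A B h \<and> h ` K \<subseteq> fst d \<and>
         (\<forall>vs. set vs \<subseteq> Basis \<and> length vs \<le> k \<longrightarrow>
            (\<forall>x\<in>snd c ` K. norm (partial_deriv vs (local_rep c d h) x
                                - partial_deriv vs (local_rep c d g) x) < \<epsilon>))}"

definition Cinf_topology ::
  "('a::topological_space, 'e::euclidean_space) chart set \<Rightarrow>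
   ('b::topological_space, 'f::euclidean_space) chart set \<Rightarrow> ('a \<Rightarrow> 'b) topology" where
  "Cinf_topology A B = topology_generated_by
     {Cinf_nbhd A B k g c d K \<epsilon> | k g c d K \<epsilon>.
        smooth_map A B g \<and> c \<in> max_atlas A \<and> d \<in> max_atlas B \<and>
        compact K \<and> K \<subseteq> fst c \<and> g ` K \<subseteq> fst d \<and> 0 < \<epsilon>}"

definition Diff_topology ::
  "('a::topological_space, 'e::euclidean_space) chart set \<Rightarrow> ('a \<Rightarrow> 'a) topology" where
  "Diff_topology A = subtopology (Cinf_topology A A) (Diff A)"

section \<open>Orientations, 2-forms and volume forms on surfaces\<close>

text \<open>A tensor field is given by its components in every chart of the maximal atlas.\<close>

type_synonym ('a, 'e) two_form = "('a, 'e) chart \<Rightarrow> 'a \<Rightarrow> 'e \<Rightarrow> 'e \<Rightarrow> real"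

definition is_two_form ::
  "('a::topological_space, 'e::euclidean_space) chart set \<Rightarrow> ('a, 'e) two_form \<Rightarrow> bool" where
  "is_two_form A \<omega> \<longleftrightarrow>
     (\<forall>c\<in>max_atlas A. \<forall>p\<in>fst c. bilinear (\<omega> c p) \<and> (\<forall>v. \<omega> c p v v = 0)) \<and>
     (\<forall>c\<in>max_atlas A. \<forall>v w. smooth_on (snd c ` fst c) (\<lambda>x. \<omega> c (chart_inv c x) v w)) \<and>
     (\<forall>c\<in>max_atlas A. \<forall>d\<in>max_atlas A. \<forall>p\<in>fst c \<inter> fst d. \<forall>v w.
        \<omega> c p v w = \<omega> d p (differential c d id p v) (differential c d id p w))"

text \<open>Surfaces are modelled on \<open>complex\<close>, identified with the real plane.\<close>

definition volume_form ::
  "('a::topological_space, complex) chart set \<Rightarrow> ('a, complex) two_form \<Rightarrow> bool" where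
  "volume_form A \<nu> \<longleftrightarrow> is_two_form A \<nu> \<and>
     (\<forall>c\<in>max_atlas A. \<forall>p\<in>fst c. \<exists>v w. \<nu> c p v w \<noteq> 0)"

text \<open>\<open>Im (cnj (J 1) * J \<i>)\<close> is the determinant of the real-linear map \<open>J\<close> with respect to
  the real basis \<open>1\<close>, \<open>\<i>\<close>.\<close>

definition oriented_atlas ::
  "('a::{t2_space, second_countable_topology}, complex) chart set \<Rightarrow> bool" where
  "oriented_atlas A \<longleftrightarrow> smooth_atlas A \<and>
     (\<forall>c\<in>A. \<forall>d\<in>A. \<forall>p\<in>fst c \<inter> fst d.
        Im (cnj (differential c d id p 1) * differential c d id p \<i>) > 0)"

section \<open>Poisson structures\<close>

text \<open>In a chart, a bivector at a point is an alternating bilinear form on the dual of the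
  coordinate space. Off its natural domain a bivector field is required to vanish, so that
  equality of functions is equality of bivector fields.\<close>

type_synonym ('a, 'e) bivector =
  "('a, 'e) chart \<Rightarrow> 'a \<Rightarrow> ('e \<Rightarrow>\<^sub>L real) \<Rightarrow> ('e \<Rightarrow>\<^sub>L real) \<Rightarrow> real"

definition bivector_field ::
  "('a::topological_space, 'e::euclidean_space) chart set \<Rightarrow> ('a, 'e) bivector \<Rightarrow> bool" where
  "bivector_field A \<pi> \<longleftrightarrow>
     (\<forall>c\<in>max_atlas A. \<forall>p\<in>fst c. bilinear (\<pi> c p) \<and> (\<forall>\<alpha>. \<pi> c p \<alpha> \<alpha> = 0)) \<and>
     (\<forall>c\<in>max_atlas A. \<forall>\<alpha> \<beta>. smooth_on (snd c ` fst c) (\<lambda>x. \<pi> c (chart_inv c x) \<alpha> \<beta>)) \<and>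
     (\<forall>c\<in>max_atlas A. \<forall>d\<in>max_atlas A. \<forall>p\<in>fst c \<inter> fst d. \<forall>\<alpha> \<beta>.
        \<pi> d p \<alpha> \<beta> = \<pi> c p (\<alpha> o\<^sub>L Blinfun (differential c d id p))
                            (\<beta> o\<^sub>L Blinfun (differential c d id p))) \<and>
     (\<forall>c p. \<not> (c \<in> max_atlas A \<and> p \<in> fst c) \<longrightarrow> \<pi> c p = (\<lambda>\<alpha> \<beta>. 0))"

definition pushforward ::
  "('a::topological_space, 'e::euclidean_space) chart set \<Rightarrow> ('a \<Rightarrow> 'a) \<Rightarrow>
   ('a, 'e) bivector \<Rightarrow> ('a, 'e) bivector" where
  "pushforward A \<phi> \<pi> = (\<lambda>d m \<alpha> \<beta>.
     if d \<in> max_atlas A \<and> m \<in> fst d then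
       (let p = inv \<phi> m; c = chart_at A p; J = Blinfun (differential c d \<phi> p)
        in \<pi> c p (\<alpha> o\<^sub>L J) (\<beta> o\<^sub>L J))
     else 0)"

definition covector ::
  "('a, 'e::euclidean_space) chart \<Rightarrow> ('a \<Rightarrow> real) \<Rightarrow> 'a \<Rightarrow> 'e \<Rightarrow>\<^sub>L real" where
  "covector c g p = Blinfun (differential c (UNIV, id) g p)"

definition poisson_bracket ::
  "('a::topological_space, 'e::euclidean_space) chart set \<Rightarrow> ('a, 'e) bivector \<Rightarrow>
   ('a \<Rightarrow> real) \<Rightarrow> ('a \<Rightarrow> real) \<Rightarrow> 'a \<Rightarrow> real" where
  "poisson_bracket A \<pi> g h = (\<lambda>p. let c = chart_at A p in \<pi> c p (covector c g p) (covector c h p))"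

definition poisson_structure ::
  "('a::topological_space, 'e::euclidean_space) chart set \<Rightarrow> ('a, 'e) bivector \<Rightarrow> bool" where
  "poisson_structure A \<pi> \<longleftrightarrow> bivector_field A \<pi> \<and>
     (\<forall>g h k. smooth_function A g \<and> smooth_function A h \<and> smooth_function A k \<longrightarrow>
        (\<forall>p. poisson_bracket A \<pi> g (poisson_bracket A \<pi> h k) p
           + poisson_bracket A \<pi> h (poisson_bracket A \<pi> k g) p
           + poisson_bracket A \<pi> k (poisson_bracket A \<pi> g h) p = 0))"

definition Poiss ::
  "('a::topological_space, 'e::euclidean_space) chart set \<Rightarrow> ('a, 'e) bivector \<Rightarrow> ('a \<Rightarrow> 'a) set" where
  "Poiss A \<pi> = {\<phi> \<in> Diff A. pushforward A \<phi> \<pi> = \<pi>}"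

definition Poiss_topology ::
  "('a::topological_space, 'e::euclidean_space) chart set \<Rightarrow> ('a, 'e) bivector \<Rightarrow>
   ('a \<Rightarrow> 'a) topology" where
  "Poiss_topology A \<pi> = subtopology (Diff_topology A) (Poiss A \<pi>)"

section \<open>Symplectic leaves\<close>

text \<open>The vector \<open>v = \<pi>(\<alpha>, \<cdot>)\<close> in the bidual, here for the components \<open>P\<close> of a bivector.\<close>

definition sharp ::
  "(('e::euclidean_space \<Rightarrow>\<^sub>L real) \<Rightarrow> ('e \<Rightarrow>\<^sub>L real) \<Rightarrow> real) \<Rightarrow> ('e \<Rightarrow>\<^sub>L real) \<Rightarrow> 'e" where
  "sharp P \<alpha> = (THE v. \<forall>\<beta>. blinfun_apply \<beta> v = P \<alpha> \<beta>)"

definition regular_bivector ::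
  "('a::topological_space, 'e::euclidean_space) chart set \<Rightarrow> ('a, 'e) bivector \<Rightarrow> bool" where
  "regular_bivector A \<pi> \<longleftrightarrow>
     (\<exists>r. \<forall>c\<in>max_atlas A. \<forall>p\<in>fst c. dim (range (sharp (\<pi> c p))) = r)"

text \<open>There is an integral curve from \<open>m\<close> to \<open>m'\<close> of the Hamiltonian vector field of some smooth
  function. Rescaling the function, one may take the time to be 1.\<close>

definition hamiltonian_step ::
  "('a::topological_space, 'e::euclidean_space) chart set \<Rightarrow> ('a, 'e) bivector \<Rightarrow>
   'a \<Rightarrow> 'a \<Rightarrow> bool" where
  "hamiltonian_step A \<pi> m m' \<longleftrightarrow>
     (\<exists>g \<gamma>. smooth_function A g \<and> continuous_on {0..1::real} \<gamma> \<and> \<gamma> 0 = m \<and> \<gamma> 1 = m' \<and>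
        (\<forall>t\<in>{0..1}. \<forall>c\<in>max_atlas A. \<gamma> t \<in> fst c \<longrightarrow>
           ((snd c \<circ> \<gamma>) has_vector_derivative
              sharp (\<pi> c (\<gamma> t)) (covector c g (\<gamma> t))) (at t within {0..1})))"

definition leaf_set ::
  "('a::topological_space, 'e::euclidean_space) chart set \<Rightarrow> ('a, 'e) bivector \<Rightarrow> 'a \<Rightarrow> 'a set" where
  "leaf_set A \<pi> m = {m'. (hamiltonian_step A \<pi>)\<^sup>*\<^sup>* m m'}"

text \<open>The injective immersion \<open>i\<close> of the manifold with atlas \<open>N\<close> parametrises a symplectic leaf of
  \<open>\<pi>\<close>, and \<open>\<omega>\<close> is the pull-back along \<open>i\<close> of the symplectic form of the leaf, which is determined
  by \<open>\<omega>(\<pi>(\<alpha>, \<cdot>), \<pi>(\<beta>, \<cdot>)) = \<pi>(\<alpha>, \<beta>)\<close>.\<close>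

definition symplectic_leaf ::
  "('a::topological_space, 'e::euclidean_space) chart set \<Rightarrow> ('a, 'e) bivector \<Rightarrow>
   ('b::topological_space, 'f::euclidean_space) chart set \<Rightarrow> ('b \<Rightarrow> 'a) \<Rightarrow>
   ('b, 'f) two_form \<Rightarrow> bool" where
  "symplectic_leaf A \<pi> N i \<omega> \<longleftrightarrow>
     smooth_map N A i \<and> inj i \<and> is_two_form N \<omega> \<and>
     (\<forall>q. range i = leaf_set A \<pi> (i q)) \<and>
     (\<forall>c\<in>max_atlas N. \<forall>d\<in>max_atlas A. \<forall>q\<in>fst c. i q \<in> fst d \<longrightarrow>
        inj (differential c d i q) \<and>
        range (differential c d i q) = range (sharp (\<pi> d (i q))) \<and>
        (\<forall>v w \<alpha> \<beta>. differential c d i q v = sharp (\<pi> d (i q)) \<alpha> \<longrightarrow>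
                   differential c d i q w = sharp (\<pi> d (i q)) \<beta> \<longrightarrow>
                   \<omega> c q v w = \<pi> d (i q) \<alpha> \<beta>))"

section \<open>The function f\<close>

definition cutoff :: "(real \<Rightarrow> real) \<Rightarrow> bool" where
  "cutoff \<eta> \<longleftrightarrow> smooth_on UNIV \<eta> \<and> range \<eta> \<subseteq> {0..1} \<and>
     (\<forall>t. \<bar>t\<bar> \<ge> 1 \<longrightarrow> \<eta> t = 0) \<and>
     (\<forall>t. 1/2 < \<bar>t\<bar> \<and> \<bar>t\<bar> < 1 \<longrightarrow> \<eta> t > 0) \<and>
     (\<forall>t. \<bar>t\<bar> \<le> 1/2 \<longrightarrow> \<eta> t = 1)"

definition bump_point :: "nat \<Rightarrow> nat \<Rightarrow> complex" where
  "bump_point n s = of_real (1 / real n) * exp (of_real (2 * pi * real s / 2 ^ n) * \<i>)"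

definition bump_radius :: "nat \<Rightarrow> real" where
  "bump_radius n = 1 / (real n * 2 ^ n)"

definition u_local :: "(real \<Rightarrow> real) \<Rightarrow> complex \<Rightarrow> real" where
  "u_local \<eta> z =
     (\<Sum>\<^sub>\<infinity>n\<in>{4..}. 1 / fact n * (\<Sum>s=1..2^n. \<eta> (cmod (z - bump_point n s) / bump_radius n)))"

definition u_fun :: "(real \<Rightarrow> real) \<Rightarrow> 'a set \<Rightarrow> ('a \<Rightarrow> complex) \<Rightarrow> 'a \<Rightarrow> real" where
  "u_fun \<eta> B x p = (if p \<in> B then u_local \<eta> (x p) else 0)"

definition f_fun :: "(real \<Rightarrow> real) \<Rightarrow> 'a set \<Rightarrow> ('a \<Rightarrow> complex) \<Rightarrow> 'a \<Rightarrow> real" where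
  "f_fun \<eta> B x p = 1 + u_fun \<eta> B x p"

end

(* A diffeomorphism preserving the bivector permutes the leaves and preserves their symplectic
   volume, so it cannot decrease f (the Jacobian of the map between two copies of the compact
   surface is the constant quotient of the values of f). Along a path of such diffeomorphisms a
   point of the leaf space at which f > 1 therefore stays in {f > 1}, a disjoint union of small
   disks, and cannot leave its disk. On the other hand, rotating each ring of 2^n disks by a n steps,
   where a n is 0 or 1, preserves f, and these twists depend continuously on a in the C-infinity
   topology because 2^(-n) beats every power of n. Two different sequences a give twists in different
   path components, and uncountably many of these sequences are arbitrarily close to 0. *)

theory Submission
  imports Defs
begin

text \<open>The twists are parametrised by all of \<open>nat => real\<close> with the product
  topology. A neighbourhood of the zero sequence restricts only finitely many coordinates, so it
  contains all 0-1 sequences supported on some cofinite set, which are uncountably many. Joint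
  continuity of all derivatives in parameter and point, with the tube lemma on compact sets, turns
  closeness to zero into closeness to the identity. Two scales keep the rings apart. The bumps of
  ring n lie in the annulus |n r - 1| \<le> 2^-n, whereas the rotation angle is cut off within |n r
  - 1| \<le> 1/(2n). On the thin annulus the angle is constant, namely one step, the wider bands do
  not reach other rings, and each derivative costs only a factor of order n^3 against the angle
  2^-n. The volume comparison is an inequality: a Poisson diffeomorphism maps a leaf injectively
  into another copy of the same compact surface, and the volume of an image is at most the total
  volume.\<close>

section \<open>Differentiability with parameters\<close>

text \<open>All partial derivatives of \<open>F q\<close> up to order \<open>k\<close> exist near \<open>(p, x)\<close> and depend continuously
  on the parameter and the point jointly at \<open>(p, x)\<close>. Constant families give smoothness of a
  single map; continuity in the parameter gives convergence in the \<open>C\<^sup>\<infinity>\<close> topology.\<close>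

primrec Ck_at ::
  "nat \<Rightarrow> ('p::topological_space \<Rightarrow> 'e::euclidean_space \<Rightarrow> 'f::real_normed_vector) \<Rightarrow> 'p \<Rightarrow> 'e \<Rightarrow> bool"
where
  "Ck_at 0 F p x \<longleftrightarrow> ((\<lambda>z. F (fst z) (snd z)) \<longlongrightarrow> F p x) (nhds (p, x))"
| "Ck_at (Suc k) F p x \<longleftrightarrow> ((\<lambda>z. F (fst z) (snd z)) \<longlongrightarrow> F p x) (nhds (p, x)) \<and>
     (\<forall>\<^sub>F z in nhds (p, x). F (fst z) differentiable (at (snd z))) \<and>
     (\<forall>b\<in>Basis. Ck_at k (\<lambda>q y. frechet_derivative (F q) (at y) b) p x)"

text \<open>\<open>partial_deriv\<close> differentiates along the last list entry first, and the
  recursion of \<open>Ck_at\<close> also starts with the first derivative taken. Peeling off the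
  last entry matches the two.\<close>

lemma partial_deriv_snoc:
  "partial_deriv (vs @ [v]) f = partial_deriv vs (\<lambda>x. frechet_derivative f (at x) v)"
  by (induction vs) auto

lemma has_derivative_eventually_eq:
  assumes "\<forall>\<^sub>F y in nhds x. f y = g y"
  shows "(f has_derivative D) (at x) \<longleftrightarrow> (g has_derivative D) (at x)"
proof -
  have "(g has_derivative D) (at x)"
    if der: "(f has_derivative D) (at x)" and ev: "\<forall>\<^sub>F y in nhds x. f y = g y" for f g :: "'a \<Rightarrow> 'b"
  proof -
    obtain S where "open S" "x \<in> S" "\<And>y. y \<in> S \<Longrightarrow> f y = g y"
      using ev by (auto simp: eventually_nhds)
    then show ?thesis using has_derivative_transform_within_open[OF der] by blast
  qed
  from this[of f g] this[of g f] show ?thesis using assms by (auto simp: eq_commute)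
qed

lemma frechet_derivative_eventually_eq:
  assumes "\<forall>\<^sub>F y in nhds x. f y = g y"
  shows "frechet_derivative f (at x) = frechet_derivative g (at x)"
  unfolding frechet_derivative_def using has_derivative_eventually_eq[OF assms] by auto

text \<open>Derivatives are taken in the second variable with the parameter frozen. An open set of
  pairs contains a slice neighbourhood around each of its points, which is what differentiation at
  such a point needs.\<close>

lemma eventually_nhds_section:
  assumes "\<forall>\<^sub>F z in nhds (p, x). Q z"
  shows "\<forall>\<^sub>F z in nhds (p, x). \<forall>\<^sub>F y in nhds (snd z). Q (fst z, y)"
proof -
  have "\<forall>\<^sub>F z in nhds (p, x). \<forall>\<^sub>F w in nhds z. Q w"
    using assms by (simp add: eventually_eventually)
  then show ?thesis
  proof (rule eventually_mono)
    fix z :: "'a \<times> 'b" assume z: "\<forall>\<^sub>F w in nhds z. Q w"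
    have "((\<lambda>y. (fst z, y)) \<longlongrightarrow> (fst z, snd z)) (nhds (snd z))"
      by (intro tendsto_Pair tendsto_const) (simp add: filterlim_ident)
    then show "\<forall>\<^sub>F y in nhds (snd z). Q (fst z, y)"
      using z by (auto simp: filterlim_iff)
  qed
qed

lemma Ck_at_tendsto: "Ck_at k F p x \<Longrightarrow> ((\<lambda>z. F (fst z) (snd z)) \<longlongrightarrow> F p x) (nhds (p, x))"
  by (cases k) auto

lemma Ck_at_cong:
  assumes "\<forall>\<^sub>F z in nhds (p, x). F (fst z) (snd z) = G (fst z) (snd z)" and "Ck_at k F p x"
  shows "Ck_at k G p x"
  using assms
proof (induction k arbitrary: F G)
  case 0
  then show ?case
    using tendsto_cong[OF 0(1)] eventually_nhds_x_imp_x[OF 0(1)] by simp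
next
  case (Suc k)
  have ev: "\<forall>\<^sub>F z in nhds (p, x). \<forall>\<^sub>F y in nhds (snd z). F (fst z) y = G (fst z) y"
    using eventually_nhds_section[OF Suc.prems(1)] by simp
  have "\<forall>\<^sub>F z in nhds (p, x). G (fst z) differentiable (at (snd z))"
    using ev conjunct1[OF conjunct2[OF Suc.prems(2)[unfolded Ck_at.simps]]]
    by eventually_elim (auto simp: differentiable_def has_derivative_eventually_eq)
  moreover have "Ck_at k (\<lambda>q y. frechet_derivative (G q) (at y) b) p x" if "b \<in> Basis" for b
  proof (rule Suc.IH)
    show "\<forall>\<^sub>F z in nhds (p, x). frechet_derivative (F (fst z)) (at (snd z)) b
        = frechet_derivative (G (fst z)) (at (snd z)) b"
      using ev by eventually_elim (simp add: frechet_derivative_eventually_eq)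
    show "Ck_at k (\<lambda>q y. frechet_derivative (F q) (at y) b) p x"
      using Suc.prems that by simp
  qed
  moreover have "((\<lambda>z. G (fst z) (snd z)) \<longlongrightarrow> G p x) (nhds (p, x))"
    using Suc.prems tendsto_cong[OF Suc.prems(1)] eventually_nhds_x_imp_x[OF Suc.prems(1)] by simp
  ultimately show ?case by simp
qed

lemma Ck_at_Suc_imp: "Ck_at (Suc k) F p x \<Longrightarrow> Ck_at k F p x"
  by (induction k arbitrary: F) (auto simp del: Ck_at.simps(2) simp: Ck_at.simps(2)[of "Suc _"], auto)

text \<open>Lets an explicit formula \<open>D\<close> stand in for
  \<open>frechet_derivative\<close>, so that the rules of calculus can be fed into the
  recursion.\<close>

lemma Ck_at_SucI:
  assumes "((\<lambda>z. F (fst z) (snd z)) \<longlongrightarrow> F p x) (nhds (p, x))"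
    and "\<forall>\<^sub>F z in nhds (p, x). (F (fst z) has_derivative D (fst z) (snd z)) (at (snd z))"
    and "\<And>b. b \<in> Basis \<Longrightarrow> Ck_at k (\<lambda>q y. D q y b) p x"
  shows "Ck_at (Suc k) F p x"
proof -
  have "Ck_at k (\<lambda>q y. frechet_derivative (F q) (at y) b) p x" if "b \<in> Basis" for b
    by (rule Ck_at_cong[OF _ assms(3)[OF that]], rule eventually_mono[OF assms(2)])
      (simp flip: frechet_derivative_at)
  then show ?thesis
    using assms(1) eventually_mono[OF assms(2), of "\<lambda>z. F (fst z) differentiable (at (snd z))"]
    by (auto simp: differentiable_def)
qed

lemma Ck_at_SucD:
  assumes "Ck_at (Suc k) F p x"
  shows "\<forall>\<^sub>F z in nhds (p, x).
      (F (fst z) has_derivative frechet_derivative (F (fst z)) (at (snd z))) (at (snd z))"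
    and "b \<in> Basis \<Longrightarrow> Ck_at k (\<lambda>q y. frechet_derivative (F q) (at y) b) p x"
  using assms by (auto simp: frechet_derivative_works)

lemma Ck_at_const: "Ck_at k (\<lambda>q y. c) p x"
proof (induction k arbitrary: c)
  case (Suc k)
  show ?case by (rule Ck_at_SucI[where D = "\<lambda>_ _ _. 0"]) (use Suc in auto)
qed simp

lemma tendsto_snd_nhds: "(snd \<longlongrightarrow> x) (nhds (p, x))" and tendsto_fst_nhds: "(fst \<longlongrightarrow> p) (nhds (p, x))"
  using tendsto_fst[of "\<lambda>z. z" "(p, x)" "nhds (p, x)"] tendsto_snd[of "\<lambda>z. z" "(p, x)" "nhds (p, x)"]
  by (simp_all add: filterlim_ident)

lemma Ck_at_linear:
  assumes "bounded_linear L"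
  shows "Ck_at k (\<lambda>q. L) p x"
proof -
  have *: "((\<lambda>z. L (snd z)) \<longlongrightarrow> L x) (nhds (p, x))" for p :: 'c
    by (rule bounded_linear.tendsto[OF assms tendsto_snd_nhds])
  show ?thesis
  proof (cases k)
    case (Suc j)
    then show ?thesis
      using Ck_at_SucI[where D = "\<lambda>_ _. L" and F = "\<lambda>_. L" and k = j] * assms
      by (auto simp: bounded_linear_imp_has_derivative Ck_at_const)
  qed (use * in simp)
qed

lemma Ck_at_add:
  assumes "Ck_at k F p x" "Ck_at k G p x"
  shows "Ck_at k (\<lambda>q y. F q y + G q y) p x"
  using assms
proof (induction k arbitrary: F G)
  case 0
  then show ?case by (auto intro: tendsto_add)
next
  case (Suc k)
  show ?case
  proof (rule Ck_at_SucI[where D = "\<lambda>q y h. frechet_derivative (F q) (at y) h + frechet_derivative (G q) (at y) h"])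
    show "((\<lambda>z. F (fst z) (snd z) + G (fst z) (snd z)) \<longlongrightarrow> F p x + G p x) (nhds (p, x))"
      using Suc.prems by (auto intro: tendsto_add)
    show "\<forall>\<^sub>F z in nhds (p, x). ((\<lambda>y. F (fst z) y + G (fst z) y) has_derivative
        (\<lambda>h. frechet_derivative (F (fst z)) (at (snd z)) h + frechet_derivative (G (fst z)) (at (snd z)) h)) (at (snd z))"
      using Ck_at_SucD(1)[OF Suc.prems(1)] Ck_at_SucD(1)[OF Suc.prems(2)]
      by eventually_elim (rule has_derivative_add)
  qed (use Suc in auto)
qed

lemma Ck_at_sum:
  assumes "\<And>i. i \<in> I \<Longrightarrow> Ck_at k (F i) p x"
  shows "Ck_at k (\<lambda>q y. \<Sum>i\<in>I. F i q y) p x"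
  using assms by (induction I rule: infinite_finite_induct) (auto intro: Ck_at_add Ck_at_const)

lemma (in bounded_bilinear) Ck_at:
  fixes F :: "'p::topological_space \<Rightarrow> 'e::euclidean_space \<Rightarrow> 'a"
  assumes "Ck_at k F p x" "Ck_at k G p x"
  shows "Ck_at k (\<lambda>q y. prod (F q y) (G q y)) p x"
  using assms
proof (induction k arbitrary: F G)
  case 0
  then show ?case by (auto intro: tendsto)
next
  case (Suc k)
  show ?case
  proof (rule Ck_at_SucI[where D = "\<lambda>q y h. prod (F q y) (frechet_derivative (G q) (at y) h)
      + prod (frechet_derivative (F q) (at y) h) (G q y)"])
    show "((\<lambda>z. prod (F (fst z) (snd z)) (G (fst z) (snd z))) \<longlongrightarrow> prod (F p x) (G p x)) (nhds (p, x))"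
      using Suc.prems by (auto intro: tendsto)
    show "\<forall>\<^sub>F z in nhds (p, x). ((\<lambda>y. prod (F (fst z) y) (G (fst z) y)) has_derivative
        (\<lambda>h. prod (F (fst z) (snd z)) (frechet_derivative (G (fst z)) (at (snd z)) h)
      + prod (frechet_derivative (F (fst z)) (at (snd z)) h) (G (fst z) (snd z)))) (at (snd z))"
      using Ck_at_SucD(1)[OF Suc.prems(1)] Ck_at_SucD(1)[OF Suc.prems(2)]
      by eventually_elim (rule FDERIV)
    fix b :: 'e assume b: "b \<in> Basis"
    show "Ck_at k (\<lambda>q y. prod (F q y) (frechet_derivative (G q) (at y) b)
      + prod (frechet_derivative (F q) (at y) b) (G q y)) p x"
      by (intro Ck_at_add Suc.IH) (use Suc.prems b in \<open>auto intro: Ck_at_Suc_imp\<close>)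
  qed
qed

text \<open>Prepares the chain rule: there the outer map is differentiated in the direction of a
  derivative of the inner map, while \<open>Ck_at\<close> controls only directions in
  \<open>Basis\<close>.\<close>

lemma has_derivative_basis_expansion:
  fixes D :: "'e::euclidean_space \<Rightarrow> 'f::real_normed_vector"
  assumes "linear D"
  shows "D h = (\<Sum>j\<in>Basis. (h \<bullet> j) *\<^sub>R D j)"
proof -
  have "D h = D (\<Sum>j\<in>Basis. (h \<bullet> j) *\<^sub>R j)" by (simp add: euclidean_representation)
  then show ?thesis by (simp add: linear_sum[OF assms] linear_cmul[OF assms])
qed

text \<open>By the chain rule each derivative is a sum of products of a derivative of
  \<open>F\<close> with a derivative of \<open>G\<close> composed with the same \<open>F\<close>.
  Induction with \<open>G\<close> arbitrary handles the composed factor, so no formula for higher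
  derivatives is required.\<close>

lemma Ck_at_compose:
  fixes F :: "'p::topological_space \<Rightarrow> 'e::euclidean_space \<Rightarrow> 'f::euclidean_space"
    and G :: "'p \<Rightarrow> 'f \<Rightarrow> 'g::real_normed_vector"
  assumes "Ck_at k F p x" "Ck_at k G p (F p x)"
  shows "Ck_at k (\<lambda>q y. G q (F q y)) p x"
  using assms
proof (induction k arbitrary: G)
  have lim: "((\<lambda>z. (fst z, F (fst z) (snd z))) \<longlongrightarrow> (p, F p x)) (nhds (p, x))" if "Ck_at k F p x" for k
    by (intro tendsto_Pair tendsto_fst_nhds Ck_at_tendsto[OF that])
  note lim' = filterlim_compose[OF Ck_at_tendsto lim, simplified]
  {
    case 0
    then show ?case using lim'[OF 0(2,1)] by simp
  next
    case (Suc k)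
    show ?case
    proof (rule Ck_at_SucI[where D = "\<lambda>q y h. \<Sum>j\<in>Basis. (frechet_derivative (F q) (at y) h \<bullet> j) *\<^sub>R
        frechet_derivative (G q) (at (F q y)) j"])
      show "((\<lambda>z. G (fst z) (F (fst z) (snd z))) \<longlongrightarrow> G p (F p x)) (nhds (p, x))"
        using lim'[OF Suc.prems(2,1)] .
      have "\<forall>\<^sub>F z in nhds (p, x). (G (fst z) has_derivative
          frechet_derivative (G (fst z)) (at (F (fst z) (snd z)))) (at (F (fst z) (snd z)))"
        using eventually_compose_filterlim[OF Ck_at_SucD(1)[OF Suc.prems(2)] lim[OF Suc.prems(1)]] by simp
      then show "\<forall>\<^sub>F z in nhds (p, x). ((\<lambda>y. G (fst z) (F (fst z) y)) has_derivative
          (\<lambda>h. \<Sum>j\<in>Basis. (frechet_derivative (F (fst z)) (at (snd z)) h \<bullet> j) *\<^sub>R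
            frechet_derivative (G (fst z)) (at (F (fst z) (snd z))) j)) (at (snd z))"
        using Ck_at_SucD(1)[OF Suc.prems(1)]
      proof eventually_elim
        case (elim z)
        show ?case
          using has_derivative_compose[OF elim(2,1)]
          by (simp flip: has_derivative_basis_expansion[OF has_derivative_linear[OF elim(1)]])
      qed
      fix b :: 'e assume b: "b \<in> Basis"
      have "Ck_at k (\<lambda>q y. frechet_derivative (F q) (at y) b \<bullet> j) p x" for j
        by (intro bounded_bilinear.Ck_at[OF bounded_bilinear_inner] Ck_at_const Ck_at_SucD(2)[OF Suc.prems(1) b])
      moreover have "Ck_at k (\<lambda>q y. frechet_derivative (G q) (at (F q y)) j) p x" if "j \<in> Basis" for j
        by (rule Suc.IH[OF Ck_at_Suc_imp[OF Suc.prems(1)] Ck_at_SucD(2)[OF Suc.prems(2) that]])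
      ultimately show "Ck_at k (\<lambda>q y. \<Sum>j\<in>Basis. (frechet_derivative (F q) (at y) b \<bullet> j) *\<^sub>R
            frechet_derivative (G q) (at (F q y)) j) p x"
        by (intro Ck_at_sum bounded_bilinear.Ck_at[OF bounded_bilinear_scaleR]) auto
    qed
  }
qed

lemma Ck_at_linear_compose:
  assumes "bounded_linear L" "Ck_at k F p x"
  shows "Ck_at k (\<lambda>q y. L (F q y)) p x"
  using assms(2)
proof (induction k arbitrary: F)
  case 0
  then show ?case using bounded_linear.tendsto[OF assms(1)] by auto
next
  case (Suc k)
  show ?case
  proof (rule Ck_at_SucI[where D = "\<lambda>q y h. L (frechet_derivative (F q) (at y) h)"])
    show "((\<lambda>z. L (F (fst z) (snd z))) \<longlongrightarrow> L (F p x)) (nhds (p, x))"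
      using Suc.prems bounded_linear.tendsto[OF assms(1)] by auto
    show "\<forall>\<^sub>F z in nhds (p, x). ((\<lambda>y. L (F (fst z) y)) has_derivative
        (\<lambda>h. L (frechet_derivative (F (fst z)) (at (snd z)) h))) (at (snd z))"
      using Ck_at_SucD(1)[OF Suc.prems]
      by eventually_elim (rule bounded_linear.has_derivative[OF assms(1)])
  qed (use Suc in auto)
qed

lemma Ck_at_Pair:
  assumes "Ck_at k F p x" "Ck_at k G p x"
  shows "Ck_at k (\<lambda>q y. (F q y, G q y)) p x"
  using Ck_at_add[OF Ck_at_linear_compose[OF _ assms(1), of "\<lambda>a. (a, 0)"]
      Ck_at_linear_compose[OF _ assms(2), of "\<lambda>b. (0, b)"]]
  by (simp add: bounded_linear_Pair bounded_linear_zero)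

section \<open>Iterated partial derivatives and \<open>Ck_at\<close>\<close>

lemma Ck_at_smooth_on:
  fixes f :: "'e::euclidean_space \<Rightarrow> 'f::real_normed_vector" and p :: "'p::topological_space"
  assumes "smooth_on S f" "open S" "x \<in> S"
  shows "Ck_at k (\<lambda>_. f) p x"
  using assms(1)
proof (induction k arbitrary: f)
  have diff: "f differentiable (at y)" if "smooth_on S f" "y \<in> S" for f :: "'e \<Rightarrow> 'f" and y
    using that by (auto simp: smooth_on_def dest: spec[of _ "[]"])
  have lim: "((\<lambda>z. f (snd z)) \<longlongrightarrow> f x) (nhds (p, x))" if "smooth_on S f" for f :: "'e \<Rightarrow> 'f"
    using filterlim_compose[OF _ tendsto_snd_nhds, of f "nhds (f x)" x]
      differentiable_imp_continuous_within[OF diff[OF _ assms(3), OF that]]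
    by (simp add: isCont_def tendsto_nhds_iff)
  {
    case 0
    then show ?case using lim by simp
  next
    case (Suc k)
    have "\<forall>\<^sub>F z in nhds (p, x). snd z \<in> S"
      by (rule topological_tendstoD[OF tendsto_snd_nhds assms(2,3)])
    then have "\<forall>\<^sub>F z in nhds (p, x). f differentiable (at (snd z))"
      by (rule eventually_mono) (use diff[OF Suc.prems] in auto)
    moreover have "Ck_at k (\<lambda>_ y. frechet_derivative f (at y) b) p x" if "b \<in> Basis" for b
    proof (rule Suc.IH)
      show "smooth_on S (\<lambda>y. frechet_derivative f (at y) b)"
        using Suc.prems that unfolding smooth_on_def
        by (metis partial_deriv_snoc set_append list.set insert_subset Un_subset_iff empty_subsetI)
    qed
    ultimately show ?case using lim[OF Suc.prems] by simp
  }
qed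

lemma Ck_at_partial_deriv:
  assumes "Ck_at (length vs + j) F p x" "set vs \<subseteq> Basis"
  shows "Ck_at j (\<lambda>q. partial_deriv vs (F q)) p x"
  using assms
proof (induction vs arbitrary: F rule: rev_induct)
  case (snoc v vs)
  then show ?case
    unfolding partial_deriv_snoc by (intro snoc.IH) (auto)
qed simp

lemma Ck_at_imp_differentiable:
  assumes "Ck_at (Suc k) F p x"
  shows "F p differentiable (at x)"
  using eventually_nhds_x_imp_x[OF conjunct1[OF conjunct2[OF assms[unfolded Ck_at.simps]]]] by simp

lemma smooth_onI:
  assumes "\<And>k x. x \<in> S \<Longrightarrow> Ck_at k F p x"
  shows "smooth_on S (F p)"
  unfolding smooth_on_def
  using assms Ck_at_partial_deriv Ck_at_imp_differentiable by blast

lemma smooth_on_iff_Ck_at: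
  assumes "open S"
  shows "smooth_on S f \<longleftrightarrow> (\<forall>k. \<forall>x\<in>S. Ck_at k (\<lambda>_. f) p x)"
  using smooth_onI[of S "\<lambda>_. f" p] Ck_at_smooth_on[OF _ assms] by blast

section \<open>Charts\<close>

lemma chart_inv_left: "is_chart c \<Longrightarrow> m \<in> fst c \<Longrightarrow> chart_inv c (snd c m) = m"
  by (auto simp: is_chart_def homeomorphism_def)

lemma chart_inv_right: "is_chart c \<Longrightarrow> y \<in> snd c ` fst c \<Longrightarrow> snd c (chart_inv c y) = y"
  by (auto simp: is_chart_def homeomorphism_def)

lemma chart_inv_in: "is_chart c \<Longrightarrow> y \<in> snd c ` fst c \<Longrightarrow> chart_inv c y \<in> fst c"
  by (auto simp: is_chart_def homeomorphism_def)

lemma inj_on_chart: "is_chart c \<Longrightarrow> inj_on (snd c) (fst c)"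
  by (metis chart_inv_left inj_onI)

text \<open>\<open>chart_inv\<close> is an \<open>inv_into\<close>, arbitrary off the image of the
  chart; an explicit inverse \<open>g\<close> can be identified with it only on that image.\<close>

lemma is_chartI:
  assumes "open D" "open (f ` D)" "continuous_on D f" "continuous_on (f ` D) g"
    and "\<And>m. m \<in> D \<Longrightarrow> g (f m) = m"
  shows "is_chart (D, f)" and "\<And>y. y \<in> f ` D \<Longrightarrow> chart_inv (D, f) y = g y"
proof -
  have inj: "inj_on f D" using assms(5) by (metis inj_onI)
  show eq: "chart_inv (D, f) y = g y" if "y \<in> f ` D" for y
    using that assms(5) inj by (auto simp: chart_inv_def)
  have "continuous_on (f ` D) (chart_inv (D, f))"
    using assms(4) eq by (simp cong: continuous_on_cong)
  then show "is_chart (D, f)"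
    using assms eq by (force simp: is_chart_def homeomorphism_def image_image)
qed

lemma open_chart_domain: "is_chart c \<Longrightarrow> open (fst c)"
  by (simp add: is_chart_def)

lemma open_chart_image:
  assumes "is_chart c" "open W"
  shows "open (snd c ` (fst c \<inter> W))"
proof -
  have "snd c ` (fst c \<inter> W) = chart_inv c -` W \<inter> snd c ` fst c"
    using assms by (auto simp: chart_inv_left)
  moreover have "open (chart_inv c -` W \<inter> snd c ` fst c)"
    using continuous_open_preimage[of "snd c ` fst c" "chart_inv c" W] assms
    by (simp add: is_chart_def homeomorphism_def Int_commute)
  ultimately show ?thesis by simp
qed

lemma tendsto_chart: 
  assumes "is_chart c" "m \<in> fst c"
  shows "(snd c \<longlongrightarrow> snd c m) (nhds m)"
proof -
  have "open (fst c)" "continuous_on (fst c) (snd c)" using assms by (auto simp: is_chart_def homeomorphism_def)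
  then have "(snd c \<longlongrightarrow> snd c m) (at m)"
    using assms(2) unfolding continuous_on_def by (metis at_within_open)
  then show ?thesis by (simp add: tendsto_at_iff_tendsto_nhds)
qed

lemma tendsto_chart_inv: 
  assumes "is_chart c" "m \<in> fst c"
  shows "(chart_inv c \<longlongrightarrow> m) (nhds (snd c m))"
proof -
  have "open (snd c ` fst c)" "continuous_on (snd c ` fst c) (chart_inv c)" "snd c m \<in> snd c ` fst c"
    using assms by (auto simp: is_chart_def homeomorphism_def)
  then have "(chart_inv c \<longlongrightarrow> chart_inv c (snd c m)) (at (snd c m))"
    unfolding continuous_on_def by (metis at_within_open)
  then show ?thesis unfolding tendsto_at_iff_tendsto_nhds using assms by (simp add: chart_inv_left)
qed

lemma compatible_iff_Ck_at:
  assumes "is_chart c" "is_chart d"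
  shows "compatible c d \<longleftrightarrow> (\<forall>k. \<forall>m\<in>fst c \<inter> fst d.
    Ck_at k (\<lambda>_. snd d \<circ> chart_inv c) p (snd c m) \<and> Ck_at k (\<lambda>_. snd c \<circ> chart_inv d) p (snd d m))"
proof -
  have "open (snd c ` (fst c \<inter> fst d))" "open (snd d ` (fst c \<inter> fst d))"
    using open_chart_image[of c "fst d"] open_chart_image[of d "fst c"] assms
    by (auto simp: is_chart_def Int_commute)
  then show ?thesis
    unfolding compatible_def by (simp add: smooth_on_iff_Ck_at[where p = p] ball_conj_distrib) blast
qed

text \<open>The route through \<open>d\<close> makes sense only where the inverse of
  \<open>c\<close> lands in the domain of \<open>d\<close>. This holds near the point, so the two
  transition maps agree eventually and \<open>Ck_at_cong\<close> applies.\<close>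

lemma transition_trans:
  assumes "is_chart c" "is_chart d" "is_chart e" "m \<in> fst c" "m \<in> fst d" "m \<in> fst e"
    and "Ck_at k (\<lambda>_. snd d \<circ> chart_inv c) p (snd c m)"
    and "Ck_at k (\<lambda>_. snd e \<circ> chart_inv d) p (snd d m)"
  shows "Ck_at k (\<lambda>_. snd e \<circ> chart_inv c) p (snd c m)"
proof (rule Ck_at_cong)
  show "Ck_at k (\<lambda>_ y. (snd e \<circ> chart_inv d) ((snd d \<circ> chart_inv c) y)) p (snd c m)"
    using Ck_at_compose[where F = "\<lambda>_. snd d \<circ> chart_inv c" and G = "\<lambda>_. snd e \<circ> chart_inv d", OF assms(7)] assms
    by (simp add: chart_inv_left)
  have "\<forall>\<^sub>F z in nhds (p, snd c m). chart_inv c (snd z) \<in> fst d"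
    by (rule topological_tendstoD[OF filterlim_compose[OF tendsto_chart_inv tendsto_snd_nhds]])
      (use assms open_chart_domain[OF assms(2)] in auto)
  then show "\<forall>\<^sub>F z in nhds (p, snd c m).
      (snd e \<circ> chart_inv d) ((snd d \<circ> chart_inv c) (snd z)) = (snd e \<circ> chart_inv c) (snd z)"
    by eventually_elim (use assms in \<open>simp add: chart_inv_left\<close>)
qed

lemma max_atlas_is_chart: "c \<in> max_atlas A \<Longrightarrow> is_chart c"
  by (simp add: max_atlas_def)

lemma atlas_cover:
  assumes "smooth_atlas A"
  obtains c where "c \<in> A" "m \<in> fst c"
proof -
  have "m \<in> (\<Union>c\<in>A. fst c)" using assms unfolding smooth_atlas_def by (metis UNIV_I)
  then show ?thesis by (rule UN_E) (rule that)
qed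

text \<open>\<open>max_atlas\<close> compares its members only with charts of \<open>A\<close>. Two
  members are therefore compared through a chart of \<open>A\<close> around the point.\<close>

lemma transition_smooth:
  assumes "smooth_atlas A" "c \<in> max_atlas A" "d \<in> max_atlas A" "m \<in> fst c" "m \<in> fst d"
  shows "Ck_at k (\<lambda>_. snd d \<circ> chart_inv c) p (snd c m)"
proof -
  obtain e where e: "e \<in> A" "m \<in> fst e" using atlas_cover[OF assms(1)] by metis
  have ch: "is_chart c" "is_chart d" "is_chart e"
    using assms e by (auto simp: max_atlas_def smooth_atlas_def)
  show ?thesis
  proof (rule transition_trans[of c e d])
    have "compatible c e" "compatible d e" using assms e by (auto simp: max_atlas_def)
    then show "Ck_at k (\<lambda>_. snd e \<circ> chart_inv c) p (snd c m)" "Ck_at k (\<lambda>_. snd d \<circ> chart_inv e) p (snd e m)"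
      using ch assms e by (auto simp: compatible_iff_Ck_at[where p = p])
  qed (use assms e ch in auto)
qed

text \<open>A local criterion: near each point, comparison with a single chart of the maximal atlas
  suffices, because transitions compose. It serves for restricted charts and for products of
  charts.\<close>

lemma max_atlasI:
  assumes "smooth_atlas A" "is_chart c"
    and "\<And>m. m \<in> fst c \<Longrightarrow> \<exists>d\<in>max_atlas A. m \<in> fst d \<and> (\<forall>k. Ck_at k (\<lambda>_. snd d \<circ> chart_inv c) (0::real) (snd c m)
      \<and> Ck_at k (\<lambda>_. snd c \<circ> chart_inv d) (0::real) (snd d m))"
  shows "c \<in> max_atlas A"
proof -
  have sub: "e \<in> max_atlas A" if "e \<in> A" for e
    using that assms(1) by (auto simp: max_atlas_def smooth_atlas_def)
  have "compatible c e" if e: "e \<in> A" for e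
  proof -
    have "Ck_at k (\<lambda>_. snd e \<circ> chart_inv c) (0::real) (snd c m) \<and>
        Ck_at k (\<lambda>_. snd c \<circ> chart_inv e) (0::real) (snd e m)" if m: "m \<in> fst c" "m \<in> fst e" for k m
    proof -
      obtain d where d: "d \<in> max_atlas A" "m \<in> fst d" and k: "Ck_at k (\<lambda>_. snd d \<circ> chart_inv c) (0::real) (snd c m)"
        "Ck_at k (\<lambda>_. snd c \<circ> chart_inv d) (0::real) (snd d m)"
        using assms(3)[OF m(1)] by blast
      have ch: "is_chart d" "is_chart e" using d sub[OF e] by (auto dest: max_atlas_is_chart)
      show ?thesis
        using transition_trans[OF assms(2) ch m(1) d(2) m(2) k(1) transition_smooth[OF assms(1) d(1) sub[OF e] d(2) m(2)]]
          transition_trans[OF ch(2,1) assms(2) m(2) d(2) m(1) transition_smooth[OF assms(1) sub[OF e] d(1) m(2) d(2)] k(2)]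
        by simp
    qed
    then show ?thesis
      using assms e by (subst compatible_iff_Ck_at[where p = "0::real"]) (auto simp: smooth_atlas_def)
  qed
  then show ?thesis using assms(2) by (simp add: max_atlas_def)
qed

lemma subset_max_atlas: "smooth_atlas A \<Longrightarrow> A \<subseteq> max_atlas A"
  by (auto simp: max_atlas_def smooth_atlas_def)

lemma max_atlas_chart_exists:
  assumes "smooth_atlas A"
  obtains c where "c \<in> max_atlas A" "m \<in> fst c"
  using atlas_cover[OF assms] subset_max_atlas[OF assms] by (metis subsetD)

lemma chart_at: 
  assumes "smooth_atlas A"
  shows "chart_at A m \<in> max_atlas A" "m \<in> fst (chart_at A m)"
  unfolding chart_at_def
  using someI[of "\<lambda>c. c \<in> max_atlas A \<and> m \<in> fst c"] max_atlas_chart_exists[OF assms, of m] by metis+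

text \<open>With a restricted target chart, the demand that a compact set is mapped into the chart
  domain becomes the demand that it is mapped into a given open set. Evaluation is continuous for
  this reason.\<close>

lemma chart_restrict:
  assumes "smooth_atlas A" "c \<in> max_atlas A" "open W"
  shows "(fst c \<inter> W, snd c) \<in> max_atlas A"
proof (rule max_atlasI[OF assms(1)])
  note ch = max_atlas_is_chart[OF assms(2)]
  have *: "continuous_on (fst c) (snd c)" "continuous_on (snd c ` fst c) (chart_inv c)"
    using ch by (auto simp: is_chart_def homeomorphism_def)
  note r = is_chartI[of "fst c \<inter> W" "snd c" "chart_inv c"]
  have prem: "open (fst c \<inter> W)" "open (snd c ` (fst c \<inter> W))" "continuous_on (fst c \<inter> W) (snd c)"
    "continuous_on (snd c ` (fst c \<inter> W)) (chart_inv c)"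
    using ch assms(3) * open_chart_image[OF ch assms(3)] open_chart_domain[OF ch]
    by (auto intro: continuous_on_subset)
  show r1: "is_chart (fst c \<inter> W, snd c)" using r(1) prem ch by (auto simp: chart_inv_left)
  have inv: "chart_inv (fst c \<inter> W, snd c) y = chart_inv c y" if "y \<in> snd c ` (fst c \<inter> W)" for y
    using r(2) prem ch that by (auto simp: chart_inv_left)
  fix m assume m: "m \<in> fst (fst c \<inter> W, snd c)"
  have ev: "\<forall>\<^sub>F y in nhds (snd c m). y \<in> snd c ` (fst c \<inter> W)"
    using prem(2) m by (intro eventually_nhds_in_open) auto
  have "Ck_at k (\<lambda>_. snd c \<circ> chart_inv (fst c \<inter> W, snd c)) (0::real) (snd c m)" for k
  proof (rule Ck_at_cong[OF _ transition_smooth[OF assms(1,2,2)]])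
    show "\<forall>\<^sub>F z in nhds (0::real, snd c m). (snd c \<circ> chart_inv c) (snd z) =
        (snd c \<circ> chart_inv (fst c \<inter> W, snd c)) (snd z)"
      using eventually_compose_filterlim[OF ev tendsto_snd_nhds]
      by eventually_elim (simp add: inv)
  qed (use m in auto)
  then show "\<exists>d\<in>max_atlas A. m \<in> fst d \<and> (\<forall>k. Ck_at k (\<lambda>_. snd d \<circ> chart_inv (fst c \<inter> W, snd c)) (0::real)
      (snd (fst c \<inter> W, snd c) m) \<and> Ck_at k (\<lambda>_. snd (fst c \<inter> W, snd c) \<circ> chart_inv d) (0::real) (snd d m))"
    using m transition_smooth[OF assms(1,2,2)] assms(2) by (intro bexI[of _ c]) auto
qed

section \<open>Families of smooth maps\<close>

text \<open>Joint continuity is a separate clause because coordinate maps are arbitrary off their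
  domains: the local representation describes \<open>H\<close> only as long as nearby values stay in
  the domain of \<open>d\<close>. One pair of charts serves all orders, and
  \<open>smooth_family_at_Ck_at\<close> passes to any other pair.\<close>

definition smooth_family_at ::
  "('a::topological_space, 'e::euclidean_space) chart set \<Rightarrow>
   ('b::topological_space, 'f::euclidean_space) chart set \<Rightarrow>
   ('p::topological_space \<Rightarrow> 'a \<Rightarrow> 'b) \<Rightarrow> 'p \<Rightarrow> 'a \<Rightarrow> bool" where
  "smooth_family_at A B H p m \<longleftrightarrow> ((\<lambda>z. H (fst z) (snd z)) \<longlongrightarrow> H p m) (nhds (p, m)) \<and>
     (\<exists>c\<in>max_atlas A. \<exists>d\<in>max_atlas B. m \<in> fst c \<and> H p m \<in> fst d \<and>
        (\<forall>k. Ck_at k (\<lambda>q. local_rep c d (H q)) p (snd c m)))"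

lemma smooth_family_at_Ck_at:
  assumes "smooth_atlas A" "smooth_atlas B" "smooth_family_at A B H p m"
    and "c \<in> max_atlas A" "d \<in> max_atlas B" "m \<in> fst c" "H p m \<in> fst d"
  shows "Ck_at k (\<lambda>q. local_rep c d (H q)) p (snd c m)"
proof -
  obtain c0 d0 where cd: "c0 \<in> max_atlas A" "d0 \<in> max_atlas B" "m \<in> fst c0" "H p m \<in> fst d0"
    and k: "\<And>k. Ck_at k (\<lambda>q. local_rep c0 d0 (H q)) p (snd c0 m)"
    and lim: "((\<lambda>z. H (fst z) (snd z)) \<longlongrightarrow> H p m) (nhds (p, m))"
    using assms(3) by (auto simp: smooth_family_at_def)
  note ch = max_atlas_is_chart[OF assms(4)] max_atlas_is_chart[OF assms(5)]
    max_atlas_is_chart[OF cd(1)] max_atlas_is_chart[OF cd(2)]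
  show ?thesis
  proof (rule Ck_at_cong)
    have 1: "Ck_at k (\<lambda>q. snd c0 \<circ> chart_inv c) p (snd c m)"
      using transition_smooth[OF assms(1) assms(4) cd(1) assms(6) cd(3)] .
    have 2: "Ck_at k (\<lambda>q. local_rep c0 d0 (H q)) p ((snd c0 \<circ> chart_inv c) (snd c m))"
      using k ch assms by (simp add: chart_inv_left)
    have 3: "Ck_at k (\<lambda>q. snd d \<circ> chart_inv d0) p (local_rep c0 d0 (H p) ((snd c0 \<circ> chart_inv c) (snd c m)))"
      using transition_smooth[OF assms(2) cd(2) assms(5) cd(4) assms(7)] ch cd assms
      by (simp add: chart_inv_left local_rep_def)
    show "Ck_at k (\<lambda>q y. (snd d \<circ> chart_inv d0) (local_rep c0 d0 (H q) ((snd c0 \<circ> chart_inv c) y))) p (snd c m)"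
      by (rule Ck_at_compose[where F = "\<lambda>q y. local_rep c0 d0 (H q) ((snd c0 \<circ> chart_inv c) y)" and G = "\<lambda>q. snd d \<circ> chart_inv d0",
            OF Ck_at_compose[where F = "\<lambda>q. snd c0 \<circ> chart_inv c" and G = "\<lambda>q. local_rep c0 d0 (H q)", OF 1 2] 3])
    have 1: "((\<lambda>z. (fst z, chart_inv c (snd z))) \<longlongrightarrow> (p, m)) (nhds (p, snd c m))"
      by (intro tendsto_Pair tendsto_fst_nhds filterlim_compose[OF tendsto_chart_inv tendsto_snd_nhds] ch assms)
    have "\<forall>\<^sub>F z in nhds (p, snd c m). chart_inv c (snd z) \<in> fst c0"
      by (rule topological_tendstoD[OF filterlim_compose[OF tendsto_chart_inv tendsto_snd_nhds]])
        (use ch assms cd open_chart_domain[OF ch(3)] in auto)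
    moreover have "\<forall>\<^sub>F z in nhds (p, snd c m). H (fst z) (chart_inv c (snd z)) \<in> fst d0"
      using topological_tendstoD[OF filterlim_compose[OF lim 1] open_chart_domain[OF ch(4)] cd(4)] by simp
    ultimately show "\<forall>\<^sub>F z in nhds (p, snd c m). (snd d \<circ> chart_inv d0) (local_rep c0 d0 (H (fst z))
        ((snd c0 \<circ> chart_inv c) (snd z))) = local_rep c d (H (fst z)) (snd z)"
      by eventually_elim (simp add: local_rep_def chart_inv_left ch)
  qed
qed

lemma smooth_family_imp_smooth_map:
  assumes "smooth_atlas A" "smooth_atlas B" "\<And>m. smooth_family_at A B H p m"
  shows "smooth_map A B (H p)"
  unfolding smooth_map_def
proof (intro conjI ballI)
  have "(H p \<longlongrightarrow> H p m) (nhds m)" for m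
  proof -
    have "((\<lambda>y. (p, y)) \<longlongrightarrow> (p, m)) (nhds m)"
      by (intro tendsto_Pair tendsto_const) (simp add: filterlim_ident)
    from filterlim_compose[OF _ this] show ?thesis
      using assms(3)[of m] unfolding smooth_family_at_def by fastforce
  qed
  then show "continuous_on UNIV (H p)"
    by (simp add: continuous_on_eq_continuous_at continuous_at tendsto_at_iff_tendsto_nhds)
  fix c d assume "c \<in> max_atlas A" "d \<in> max_atlas B"
  then show "smooth_on (snd c ` (fst c \<inter> H p -` fst d)) (local_rep c d (H p))"
    by (intro smooth_onI[where F = "\<lambda>q. local_rep c d (H q)"])
      (auto intro: smooth_family_at_Ck_at[OF assms])
qed

lemma smooth_map_imp_family:
  assumes "smooth_atlas A" "smooth_atlas B" "smooth_map A B g"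
  shows "smooth_family_at A B (\<lambda>_. g) p m"
  unfolding smooth_family_at_def
proof
  have "(g \<longlongrightarrow> g m) (nhds m)"
    using assms(3) by (simp add: smooth_map_def continuous_on_eq_continuous_at continuous_at tendsto_at_iff_tendsto_nhds)
  from filterlim_compose[OF this tendsto_snd_nhds]
  show "((\<lambda>z. g (snd z)) \<longlongrightarrow> g m) (nhds (p, m))" .
  obtain c d where cd: "c \<in> max_atlas A" "m \<in> fst c" "d \<in> max_atlas B" "g m \<in> fst d"
    using max_atlas_chart_exists[OF assms(1)] max_atlas_chart_exists[OF assms(2)] by metis
  have "open (snd c ` (fst c \<inter> g -` fst d))"
    using assms(3) cd
    by (intro open_chart_image open_vimage) (auto simp: smooth_map_def max_atlas_is_chart open_chart_domain)
  then have "Ck_at k (\<lambda>_. local_rep c d g) p (snd c m)" for k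
    using assms(3) cd by (intro Ck_at_smooth_on) (auto simp: smooth_map_def)
  then show "\<exists>c\<in>max_atlas A. \<exists>d\<in>max_atlas B. m \<in> fst c \<and> g m \<in> fst d \<and>
        (\<forall>k. Ck_at k (\<lambda>q. local_rep c d g) p (snd c m))"
    using cd by blast
qed

section \<open>Differentials of smooth maps and the chain rule\<close>

lemma smooth_map_id:
  assumes "smooth_atlas A"
  shows "smooth_map A A id"
proof -
  have "smooth_family_at A A (\<lambda>_. id) (0::real) m" for m
  proof -
    obtain c where c: "c \<in> max_atlas A" "m \<in> fst c" using max_atlas_chart_exists[OF assms] by metis
    show ?thesis
      unfolding smooth_family_at_def
      using tendsto_snd_nhds[of m "0::real"] c transition_smooth[OF assms c(1) c(1) c(2) c(2)]
      by (auto simp: local_rep_def)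
  qed
  from smooth_family_imp_smooth_map[OF assms assms this] show ?thesis .
qed

lemma has_derivative_differential:
  assumes "smooth_atlas A" "smooth_atlas B" "smooth_map A B g"
    and "c \<in> max_atlas A" "d \<in> max_atlas B" "m \<in> fst c" "g m \<in> fst d"
  shows "(local_rep c d g has_derivative differential c d g m) (at (snd c m))"
proof -
  have "Ck_at (Suc 0) (\<lambda>_::real. local_rep c d g) 0 (snd c m)"
    using smooth_family_at_Ck_at[OF assms(1,2) smooth_map_imp_family[OF assms(1-3)] assms(4-7)] .
  from Ck_at_imp_differentiable[OF this] show ?thesis
    by (simp add: differential_def frechet_derivative_works)
qed

lemma differential_unique:
  assumes "(local_rep c d g has_derivative D) (at (snd c m))"
  shows "differential c d g m = D"
  using frechet_derivative_at[OF assms] by (simp add: differential_def)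

lemma differential_compose:
  assumes "smooth_atlas A" "smooth_atlas B" "smooth_atlas C" "smooth_map A B g" "smooth_map B C h"
    and "c \<in> max_atlas A" "d \<in> max_atlas B" "e \<in> max_atlas C"
    and "m \<in> fst c" "g m \<in> fst d" "h (g m) \<in> fst e"
  shows "differential c e (h \<circ> g) m = differential d e h (g m) \<circ> differential c d g m"
proof (rule differential_unique)
  note ch = max_atlas_is_chart[OF assms(6)] max_atlas_is_chart[OF assms(7)]
  have eq: "local_rep c d g (snd c m) = snd d (g m)" using ch assms by (simp add: local_rep_def chart_inv_left)
  have "((local_rep d e h \<circ> local_rep c d g) has_derivative (differential d e h (g m) \<circ> differential c d g m)) (at (snd c m))"
    using has_derivative_differential[OF assms(1,2,4)] has_derivative_differential[OF assms(2,3,5)] assms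
    by (intro diff_chain_at) (auto simp: eq)
  moreover have "\<forall>\<^sub>F y in nhds (snd c m). (local_rep d e h \<circ> local_rep c d g) y = local_rep c e (h \<circ> g) y"
  proof -
    have "(g \<longlongrightarrow> g m) (nhds m)"
      using assms(4) by (simp add: smooth_map_def continuous_on_eq_continuous_at continuous_at tendsto_at_iff_tendsto_nhds)
    from topological_tendstoD[OF filterlim_compose[OF this tendsto_chart_inv]]
    have "\<forall>\<^sub>F y in nhds (snd c m). g (chart_inv c y) \<in> fst d" using ch assms open_chart_domain by blast
    then show ?thesis by eventually_elim (simp add: local_rep_def chart_inv_left ch)
  qed
  ultimately show "(local_rep c e (h \<circ> g) has_derivative differential d e h (g m) \<circ> differential c d g m) (at (snd c m))"
    using has_derivative_eventually_eq by blast
qed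

lemma differential_id:
  assumes "is_chart c" "m \<in> fst c"
  shows "differential c c id m = id"
proof (rule differential_unique)
  have "\<forall>\<^sub>F y in nhds (snd c m). y \<in> snd c ` fst c"
    using assms open_chart_image[of c UNIV] by (intro eventually_nhds_in_open) auto
  then have "\<forall>\<^sub>F y in nhds (snd c m). id y = local_rep c c id y"
    by eventually_elim (use assms in \<open>simp add: local_rep_def chart_inv_right\<close>)
  from has_derivative_eventually_eq[OF this]
  show "(local_rep c c id has_derivative id) (at (snd c m))" using has_derivative_id by (metis id_def)
qed

section \<open>Product charts\<close>

abbreviation prod_chart :: "('a, 'e) chart \<Rightarrow> ('b, 'f) chart \<Rightarrow> ('a \<times> 'b, 'e \<times> 'f) chart" where
  "prod_chart c d \<equiv> (fst c \<times> fst d, map_prod (snd c) (snd d))"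

lemma is_chart_prod:
  assumes "is_chart c" "is_chart d"
  shows "is_chart (prod_chart c d)"
    and "y \<in> snd c ` fst c \<Longrightarrow> z \<in> snd d ` fst d \<Longrightarrow> chart_inv (prod_chart c d) (y, z) = (chart_inv c y, chart_inv d z)"
proof -
  have im: "map_prod (snd c) (snd d) ` (fst c \<times> fst d) = (snd c ` fst c) \<times> (snd d ` fst d)"
    by (rule map_prod_surj_on) auto
  have *: "continuous_on (fst c) (snd c)" "continuous_on (snd c ` fst c) (chart_inv c)"
    "continuous_on (fst d) (snd d)" "continuous_on (snd d ` fst d) (chart_inv d)"
    using assms by (auto simp: is_chart_def homeomorphism_def)
  have prem: "open (fst c \<times> fst d)" "open (map_prod (snd c) (snd d) ` (fst c \<times> fst d))"
    "continuous_on (fst c \<times> fst d) (map_prod (snd c) (snd d))"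
    "continuous_on (map_prod (snd c) (snd d) ` (fst c \<times> fst d)) (map_prod (chart_inv c) (chart_inv d))"
    unfolding im using assms *
    by (auto intro!: open_Times continuous_intros continuous_on_compose2[OF *(1)] continuous_on_compose2[OF *(2)]
      continuous_on_compose2[OF *(3)] continuous_on_compose2[OF *(4)] simp: is_chart_def map_prod_def case_prod_unfold)
  note r = is_chartI[of "fst c \<times> fst d" "map_prod (snd c) (snd d)" "map_prod (chart_inv c) (chart_inv d)", OF prem]
  show "is_chart (prod_chart c d)" using r(1) assms by (auto simp: chart_inv_left)
  show "chart_inv (prod_chart c d) (y, z) = (chart_inv c y, chart_inv d z)"
    if "y \<in> snd c ` fst c" "z \<in> snd d ` fst d"
  proof -
    have "(y, z) \<in> map_prod (snd c) (snd d) ` (fst c \<times> fst d)" using that unfolding im by simp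
    from r(2)[OF _ this] show ?thesis using assms by (auto simp: chart_inv_left)
  qed
qed

lemma eventually_chart_inv_prod:
  assumes "is_chart c" "is_chart d" "m \<in> fst c" "n \<in> fst d"
  shows "\<forall>\<^sub>F y in nhds (snd c m, snd d n). chart_inv (prod_chart c d) y = (chart_inv c (fst y), chart_inv d (snd y))"
proof -
  have "\<forall>\<^sub>F y in nhds (snd c m, snd d n). y \<in> (snd c ` fst c) \<times> (snd d ` fst d)"
    using assms open_chart_image[of c UNIV] open_chart_image[of d UNIV]
    by (intro eventually_nhds_in_open open_Times) auto
  then show ?thesis
  proof eventually_elim
    case (elim y)
    then show ?case using is_chart_prod(2)[OF assms(1,2), of "fst y" "snd y"] by (simp add: mem_Times_iff)
  qed
qed

lemma Ck_at_prod_transition: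
  assumes "is_chart c" "is_chart d" "m \<in> fst c" "n \<in> fst d"
    and "Ck_at k (\<lambda>_. snd c' \<circ> chart_inv c) p (snd c m)" "Ck_at k (\<lambda>_. snd d' \<circ> chart_inv d) p (snd d n)"
  shows "Ck_at k (\<lambda>_. snd (prod_chart c' d') \<circ> chart_inv (prod_chart c d)) p (snd (prod_chart c d) (m, n))"
proof (rule Ck_at_cong)
  show "Ck_at k (\<lambda>_ y. ((snd c' \<circ> chart_inv c) (fst y), (snd d' \<circ> chart_inv d) (snd y))) p (snd (prod_chart c d) (m, n))"
    using Ck_at_compose[OF Ck_at_linear[OF bounded_linear_fst], of k "\<lambda>_. snd c' \<circ> chart_inv c" p "(snd c m, snd d n)"]
      Ck_at_compose[OF Ck_at_linear[OF bounded_linear_snd], of k "\<lambda>_. snd d' \<circ> chart_inv d" p "(snd c m, snd d n)"]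
      assms by (intro Ck_at_Pair) auto
  show "\<forall>\<^sub>F z in nhds (p, snd (prod_chart c d) (m, n)).
      ((snd c' \<circ> chart_inv c) (fst (snd z)), (snd d' \<circ> chart_inv d) (snd (snd z))) =
      (snd (prod_chart c' d') \<circ> chart_inv (prod_chart c d)) (snd z)"
    using eventually_compose_filterlim[OF eventually_chart_inv_prod[OF assms(1-4)] tendsto_snd_nhds[of "(snd c m, snd d n)" p]]
    by (auto elim: eventually_mono)
qed

lemma smooth_atlas_product:
  assumes "smooth_atlas A" "smooth_atlas B"
  shows "smooth_atlas (product_atlas A B)"
  unfolding smooth_atlas_def
proof (intro conjI ballI)
  fix c assume "c \<in> product_atlas A B"
  then obtain a b where "a \<in> A" "b \<in> B" "c = prod_chart a b" by (auto simp: product_atlas_def)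
  then show "is_chart c" using assms is_chart_prod(1)[of a b] by (simp add: smooth_atlas_def)
next
  show "(\<Union>c\<in>product_atlas A B. fst c) = UNIV"
  proof -
    have "(m, n) \<in> (\<Union>c\<in>product_atlas A B. fst c)" for m n
    proof -
      obtain c d where "c \<in> A" "m \<in> fst c" "d \<in> B" "n \<in> fst d"
        using atlas_cover[OF assms(1)] atlas_cover[OF assms(2)] by metis
      then have "prod_chart c d \<in> product_atlas A B" "(m, n) \<in> fst (prod_chart c d)"
        unfolding product_atlas_def by (blast, simp)
      then show ?thesis by (rule UN_I)
    qed
    then show ?thesis by auto
  qed
next
  fix c1 c2 assume "c1 \<in> product_atlas A B" "c2 \<in> product_atlas A B"
  then obtain a b a' b' where c: "a \<in> A" "b \<in> B" "a' \<in> A" "b' \<in> B"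
    "c1 = prod_chart a b" "c2 = prod_chart a' b'"
    by (auto simp: product_atlas_def)
  then have ch: "is_chart a" "is_chart b" "is_chart a'" "is_chart b'" using assms by (auto simp: smooth_atlas_def)
  have m: "a \<in> max_atlas A" "b \<in> max_atlas B" "a' \<in> max_atlas A" "b' \<in> max_atlas B"
    using c subset_max_atlas assms by blast+
  show "compatible c1 c2"
    unfolding compatible_iff_Ck_at[OF is_chart_prod(1)[OF ch(1,2)] is_chart_prod(1)[OF ch(3,4)], where p = "0::real", folded c(5,6)]
  proof (intro ballI allI conjI)
    fix k mn assume "mn \<in> fst c1 \<inter> fst c2"
    then obtain m n where mn: "mn = (m, n)" "m \<in> fst a" "m \<in> fst a'" "n \<in> fst b" "n \<in> fst b'" using c by auto
    show "Ck_at k (\<lambda>_. snd c2 \<circ> chart_inv c1) (0::real) (snd c1 mn)"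
      unfolding c mn using m mn ch
      by (intro Ck_at_prod_transition transition_smooth[OF assms(1)] transition_smooth[OF assms(2)])
    show "Ck_at k (\<lambda>_. snd c1 \<circ> chart_inv c2) (0::real) (snd c2 mn)"
      unfolding c mn using m mn ch
      by (intro Ck_at_prod_transition transition_smooth[OF assms(1)] transition_smooth[OF assms(2)])
  qed
qed

text \<open>\<open>product_atlas\<close> multiplies charts of the given atlases only. Later
  arguments take their factors from the maximal atlases, in particular the chart carrying the bumps
  may lie outside the given atlas.\<close>

lemma prod_chart_max_atlas:
  assumes "smooth_atlas A" "smooth_atlas B" "c \<in> max_atlas A" "d \<in> max_atlas B"
  shows "prod_chart c d \<in> max_atlas (product_atlas A B)"
proof (rule max_atlasI[OF smooth_atlas_product[OF assms(1,2)]])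
  note ch = max_atlas_is_chart[OF assms(3)] max_atlas_is_chart[OF assms(4)]
  show "is_chart (prod_chart c d)" using is_chart_prod(1) ch by blast
  fix mn assume "mn \<in> fst (prod_chart c d)"
  then obtain m n where mn: "mn = (m, n)" "m \<in> fst c" "n \<in> fst d" by auto
  obtain a b where ab: "a \<in> A" "m \<in> fst a" "b \<in> B" "n \<in> fst b"
    using atlas_cover[OF assms(1)] atlas_cover[OF assms(2)] by metis
  then have m: "a \<in> max_atlas A" "b \<in> max_atlas B" using subset_max_atlas assms by blast+
  then have ch': "is_chart a" "is_chart b" by (auto dest: max_atlas_is_chart)
  have "prod_chart a b \<in> max_atlas (product_atlas A B)"
  proof (rule subsetD[OF subset_max_atlas[OF smooth_atlas_product[OF assms(1,2)]]])
    show "prod_chart a b \<in> product_atlas A B" using ab unfolding product_atlas_def by blast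
  qed
  moreover have "Ck_at k (\<lambda>_. snd (prod_chart a b) \<circ> chart_inv (prod_chart c d)) (0::real) (snd (prod_chart c d) mn)" for k
    unfolding mn using m mn ch ab assms
    by (intro Ck_at_prod_transition transition_smooth[OF assms(1)] transition_smooth[OF assms(2)])
  moreover have "Ck_at k (\<lambda>_. snd (prod_chart c d) \<circ> chart_inv (prod_chart a b)) (0::real) (snd (prod_chart a b) mn)" for k
    unfolding mn using m mn ch' ab assms
    by (intro Ck_at_prod_transition transition_smooth[OF assms(1)] transition_smooth[OF assms(2)])
  ultimately show "\<exists>e\<in>max_atlas (product_atlas A B). mn \<in> fst e \<and>
      (\<forall>k. Ck_at k (\<lambda>_. snd e \<circ> chart_inv (prod_chart c d)) (0::real) (snd (prod_chart c d) mn) \<and>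
           Ck_at k (\<lambda>_. snd (prod_chart c d) \<circ> chart_inv e) (0::real) (snd e mn))"
    using ab mn by (intro bexI[of _ "prod_chart a b"]) auto
qed

section \<open>The smooth topology\<close>

text \<open>The tube lemma in the language of filters.\<close>

lemma eventually_nhds_compact:
  assumes "compact K" "\<And>y. y \<in> K \<Longrightarrow> \<forall>\<^sub>F z in nhds (p, y). Q z"
  shows "\<forall>\<^sub>F q in nhds p. \<forall>y\<in>K. Q (q, y)"
proof -
  have "\<exists>V W. open V \<and> p \<in> V \<and> open W \<and> y \<in> W \<and> (\<forall>q\<in>V. \<forall>w\<in>W. Q (q, w))" if "y \<in> K" for y
  proof -
    obtain S where S: "open S" "(p, y) \<in> S" "\<And>z. z \<in> S \<Longrightarrow> Q z"
      using assms(2)[OF \<open>y \<in> K\<close>] unfolding eventually_nhds by auto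
    obtain V W where "open V" "open W" "(p, y) \<in> V \<times> W" "V \<times> W \<subseteq> S"
      using open_prod_elim[OF S(1,2)] .
    then show ?thesis using S(3) by (intro exI[of _ V] exI[of _ W]) auto
  qed
  then obtain V W where VW: "\<And>y. y \<in> K \<Longrightarrow> open (V y) \<and> p \<in> V y \<and> open (W y) \<and> y \<in> W y \<and> (\<forall>q\<in>V y. \<forall>w\<in>W y. Q (q, w))"
    by metis
  obtain C where C: "C \<subseteq> K" "finite C" "K \<subseteq> (\<Union>y\<in>C. W y)"
    by (rule compactE_image[OF assms(1), of K W]) (use VW in auto)
  have "\<forall>\<^sub>F q in nhds p. \<forall>y\<in>C. q \<in> V y"
    using C VW by (intro eventually_ball_finite ballI eventually_nhds_in_open) auto
  then show ?thesis by eventually_elim (use C VW in blast)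
qed

text \<open>A generating set imposes finitely many conditions: one for each list of at most
  \<open>k\<close> basis vectors, and the containment of the image of \<open>K\<close>. Each is an
  open condition on pairs of parameter and point, to which the tube lemma applies.\<close>

lemma smooth_family_Cinf_nbhd:
  assumes "smooth_atlas A" "smooth_atlas B" "\<And>q m. smooth_family_at A B H q m"
    and g: "smooth_map A B g" "c \<in> max_atlas A" "d \<in> max_atlas B" "compact K" "K \<subseteq> fst c" "g ` K \<subseteq> fst d"
    and p: "H p \<in> Cinf_nbhd A B k g c d K \<epsilon>"
  shows "\<forall>\<^sub>F q in nhds p. H q \<in> Cinf_nbhd A B k g c d K \<epsilon>"
proof -
  note ch = max_atlas_is_chart[OF g(2)] max_atlas_is_chart[OF g(3)]
  have "continuous_on (fst c) (snd c)" using ch(1) by (simp add: is_chart_def homeomorphism_def)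
  then have "compact (snd c ` K)"
    using g by (intro compact_continuous_image) (auto intro: continuous_on_subset)
  have "\<forall>\<^sub>F q in nhds p. \<forall>m\<in>K. (\<lambda>z. H (fst z) (snd z) \<in> fst d) (q, m)"
  proof (rule eventually_nhds_compact[OF g(4)])
    fix m assume "m \<in> K"
    then show "\<forall>\<^sub>F z in nhds (p, m). H (fst z) (snd z) \<in> fst d"
      using assms(3)[of p m] p open_chart_domain[OF ch(2)]
      by (auto simp: smooth_family_at_def Cinf_nbhd_def intro: topological_tendstoD)
  qed
  moreover have "\<forall>\<^sub>F q in nhds p. \<forall>vs\<in>{vs. set vs \<subseteq> Basis \<and> length vs \<le> k}. \<forall>y\<in>snd c ` K.
      norm (partial_deriv vs (local_rep c d (H q)) y - partial_deriv vs (local_rep c d g) y) < \<epsilon>"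
  proof (rule eventually_ball_finite[OF finite_lists_length_le[OF finite_Basis]], rule ballI)
    fix vs :: "'b list" assume vs: "vs \<in> {vs. set vs \<subseteq> Basis \<and> length vs \<le> k}"
    have "\<forall>\<^sub>F q in nhds p. \<forall>y\<in>snd c ` K. (\<lambda>z. norm (partial_deriv vs (local_rep c d (H (fst z))) (snd z)
        - partial_deriv vs (local_rep c d g) (snd z)) < \<epsilon>) (q, y)"
    proof (rule eventually_nhds_compact[OF \<open>compact (snd c ` K)\<close>])
      fix y assume y: "y \<in> snd c ` K"
      then obtain m where m: "m \<in> K" "y = snd c m" by auto
      have "Ck_at 0 (\<lambda>q. partial_deriv vs (local_rep c d (H q))) p y"
        unfolding m(2) using vs m p g
        by (intro Ck_at_partial_deriv smooth_family_at_Ck_at[OF assms(1-3)]) (auto simp: Cinf_nbhd_def)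
      moreover have "Ck_at 0 (\<lambda>_. partial_deriv vs (local_rep c d g)) p y"
        unfolding m(2) using vs m g
        by (intro Ck_at_partial_deriv smooth_family_at_Ck_at[OF assms(1,2) smooth_map_imp_family[OF assms(1,2)]]) auto
      ultimately have "((\<lambda>z. norm (partial_deriv vs (local_rep c d (H (fst z))) (snd z) - partial_deriv vs (local_rep c d g) (snd z)))
          \<longlongrightarrow> norm (partial_deriv vs (local_rep c d (H p)) y - partial_deriv vs (local_rep c d g) y)) (nhds (p, y))"
        by (auto intro: tendsto_norm tendsto_diff)
      moreover have "norm (partial_deriv vs (local_rep c d (H p)) y - partial_deriv vs (local_rep c d g) y) < \<epsilon>"
        using p vs y by (auto simp: Cinf_nbhd_def)
      ultimately show "\<forall>\<^sub>F z in nhds (p, y). norm (partial_deriv vs (local_rep c d (H (fst z))) (snd z)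
          - partial_deriv vs (local_rep c d g) (snd z)) < \<epsilon>"
        by (rule order_tendstoD)
    qed
    then show "\<forall>\<^sub>F q in nhds p. \<forall>y\<in>snd c ` K. norm (partial_deriv vs (local_rep c d (H q)) y
        - partial_deriv vs (local_rep c d g) y) < \<epsilon>" by simp
  qed
  ultimately show ?thesis
    by eventually_elim (auto simp: Cinf_nbhd_def smooth_family_imp_smooth_map[OF assms(1-3)])
qed

text \<open>Continuity of the family as a map into the smooth topology. The induction follows the
  generation of the open set, so only the generating sets carry content.\<close>

lemma smooth_family_Cinf_open:
  assumes "smooth_atlas A" "smooth_atlas B" "\<And>q m. smooth_family_at A B H q m"
    and "openin (Cinf_topology A B) W" "H p \<in> W"
  shows "\<forall>\<^sub>F q in nhds p. H q \<in> W"
proof -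
  have "generate_topology_on {Cinf_nbhd A B k g c d K \<epsilon> | k g c d K \<epsilon>.
        smooth_map A B g \<and> c \<in> max_atlas A \<and> d \<in> max_atlas B \<and>
        compact K \<and> K \<subseteq> fst c \<and> g ` K \<subseteq> fst d \<and> 0 < \<epsilon>} W"
    using assms(4) unfolding Cinf_topology_def by (rule openin_topology_generated_by)
  from this assms(5) show ?thesis
  proof induction
    case (Int a b)
    then show ?case by (simp add: eventually_conj_iff)
  next
    case (UN K)
    then obtain k where "k \<in> K" "H p \<in> k" by blast
    from UN.IH[OF this] show ?case by (rule eventually_mono) (use \<open>k \<in> K\<close> in auto)
  next
    case (Basis s)
    then show ?case using smooth_family_Cinf_nbhd[OF assms(1-3)] by auto
  qed simp
qed

lemma Cinf_nbhd_open:
  assumes "smooth_map A B g" "c \<in> max_atlas A" "d \<in> max_atlas B" "compact K" "K \<subseteq> fst c" "g ` K \<subseteq> fst d" "0 < \<epsilon>"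
  shows "openin (Cinf_topology A B) (Cinf_nbhd A B k g c d K \<epsilon>)"
  unfolding Cinf_topology_def by (rule topology_generated_by_Basis) (use assms in blast)

lemma Cinf_nbhd_self: "smooth_map A B g \<Longrightarrow> g ` K \<subseteq> fst d \<Longrightarrow> 0 < \<epsilon> \<Longrightarrow> g \<in> Cinf_nbhd A B k g c d K \<epsilon>"
  by (simp add: Cinf_nbhd_def)

lemma topspace_Cinf: 
  assumes "smooth_atlas A" "smooth_atlas B"
  shows "topspace (Cinf_topology A B) = {g. smooth_map A B g}"
proof
  show "topspace (Cinf_topology A B) \<subseteq> {g. smooth_map A B g}"
    unfolding Cinf_topology_def topology_generated_by_topspace by (auto simp: Cinf_nbhd_def)
  show "{g. smooth_map A B g} \<subseteq> topspace (Cinf_topology A B)"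
  proof
    fix g assume "g \<in> {g. smooth_map A B g}"
    then have g: "smooth_map A B g" by simp
    obtain c d where "c \<in> max_atlas A" "d \<in> max_atlas B"
      using max_atlas_chart_exists[OF assms(1)] max_atlas_chart_exists[OF assms(2)] by metis
    \<comment> \<open>With the empty compact set the closeness conditions are vacuous, so
      \<open>g\<close> lies in a generating set.\<close>
    from openin_subset[OF Cinf_nbhd_open[OF g this, of "{}" 1 0]]
    show "g \<in> topspace (Cinf_topology A B)" using Cinf_nbhd_self[OF g, of "{}" d 1 0 c] by auto
  qed
qed

lemma continuous_map_eval:
  fixes A :: "('a::{t2_space, second_countable_topology}, 'e::euclidean_space) chart set"
    and B :: "('b::{t2_space, second_countable_topology}, 'f::euclidean_space) chart set"
  assumes "smooth_atlas A" "smooth_atlas B"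
  shows "continuous_map (Cinf_topology A B) euclidean (\<lambda>h. h m)"
  unfolding continuous_map_def
proof (intro conjI allI impI)
  fix W :: "'b set" assume W: "openin euclidean W"
  show "openin (Cinf_topology A B) {h \<in> topspace (Cinf_topology A B). h m \<in> W}"
  proof (subst openin_subopen, rule ballI)
    fix g assume g: "g \<in> {h \<in> topspace (Cinf_topology A B). h m \<in> W}"
    then have sg: "smooth_map A B g" using topspace_Cinf[OF assms] by simp
    obtain c d where cd: "c \<in> max_atlas A" "m \<in> fst c" "d \<in> max_atlas B" "g m \<in> fst d"
      using max_atlas_chart_exists[OF assms(1)] max_atlas_chart_exists[OF assms(2)] by metis
    \<comment> \<open>Once the target chart is cut down to \<open>W\<close>, membership in the
      neighbourhood with compact set \<open>{m}\<close> already forces the value at \<open>m\<close>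
      into \<open>W\<close>; order 0 and radius 1 are enough.\<close>
    let ?d = "(fst d \<inter> W, snd d)"
    have "?d \<in> max_atlas B" using chart_restrict[OF assms(2)] cd W by auto
    then have o: "openin (Cinf_topology A B) (Cinf_nbhd A B 0 g c ?d {m} 1)"
      using sg cd g by (intro Cinf_nbhd_open) auto
    have "g \<in> Cinf_nbhd A B 0 g c ?d {m} 1" using sg cd g by (intro Cinf_nbhd_self) auto
    moreover have "Cinf_nbhd A B 0 g c ?d {m} 1 \<subseteq> {h \<in> topspace (Cinf_topology A B). h m \<in> W}"
      using openin_subset[OF o] by (auto simp: Cinf_nbhd_def)
    ultimately show "\<exists>T. openin (Cinf_topology A B) T \<and> g \<in> T \<and> T \<subseteq> {h \<in> topspace (Cinf_topology A B). h m \<in> W}"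
      using o by blast
  qed
qed simp

section \<open>Poisson structures with product leaves\<close>

lemmas bounded_linear_differential = has_derivative_bounded_linear[OF has_derivative_differential]

section \<open>Covectors, bivectors and alternating forms in coordinates\<close>

lemma blinfun_basis_expansion:
  fixes \<beta> :: "'e::euclidean_space \<Rightarrow>\<^sub>L real"
  shows "\<beta> = (\<Sum>b\<in>Basis. \<beta> b *\<^sub>R blinfun_inner_right b)"
proof (rule blinfun_eqI)
  fix v
  have "\<beta> v = (\<Sum>b\<in>Basis. (v \<bullet> b) *\<^sub>R \<beta> b)"
    using has_derivative_basis_expansion[of "blinfun_apply \<beta>" v]
    by (simp add: blinfun.bounded_linear_right bounded_linear.linear)
  then show "\<beta> v = (\<Sum>b\<in>Basis. \<beta> b *\<^sub>R blinfun_inner_right b) v"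
    by (simp add: blinfun.sum_left blinfun.scaleR_left inner_commute mult.commute)
qed

text \<open>The vector is built from the values of \<open>P \<alpha>\<close> on the coordinate
  functionals. These functionals separate vectors, so the description in \<open>sharp\<close> has
  exactly one solution.\<close>

lemma sharp_apply:
  fixes P :: "('e::euclidean_space \<Rightarrow>\<^sub>L real) \<Rightarrow> ('e \<Rightarrow>\<^sub>L real) \<Rightarrow> real"
  assumes "bilinear P"
  shows "blinfun_apply \<beta> (sharp P \<alpha>) = P \<alpha> \<beta>"
proof -
  let ?v = "\<Sum>b\<in>Basis. P \<alpha> (blinfun_inner_right b) *\<^sub>R b"
  have lin: "linear (P \<alpha>)" using assms by (simp add: bilinear_def)
  have ex: "blinfun_apply \<beta> ?v = P \<alpha> \<beta>" for \<beta>
    by (subst (2) blinfun_basis_expansion[of \<beta>])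
      (simp add: linear_sum[OF lin] linear_cmul[OF lin] blinfun.sum_right blinfun.scaleR_right mult.commute)
  have uniq: "w = ?v" if "\<forall>\<beta>. blinfun_apply \<beta> w = P \<alpha> \<beta>" for w
  proof (rule euclidean_eqI)
    fix b :: 'e
    show "w \<bullet> b = ?v \<bullet> b" 
      using that ex[of "blinfun_inner_right b"] by (metis blinfun_inner_right.rep_eq inner_commute)
  qed
  have "sharp P \<alpha> = ?v" unfolding sharp_def by (rule the_equality) (use ex uniq in auto)
  then show ?thesis using ex by simp
qed

text \<open>Alternating forms on the plane form a line, spanned by the determinant
  \<open>Im (cnj v * w)\<close>.\<close>

lemma bilinear_alternating_complex:
  fixes \<omega> :: "complex \<Rightarrow> complex \<Rightarrow> real"
  assumes "bilinear \<omega>" "\<And>v. \<omega> v v = 0"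
  shows "\<omega> v w = \<omega> 1 \<i> * Im (cnj v * w)"
proof -
  have l: "linear (\<lambda>a. \<omega> a b)" "linear (\<omega> b)" for b using assms(1) by (auto simp: bilinear_def)
  have e: "z = Re z *\<^sub>R 1 + Im z *\<^sub>R \<i>" for z by (simp add: complex_eq_iff)
  have x: "\<omega> z y = Re z * \<omega> 1 y + Im z * \<omega> \<i> y" for z y
    by (subst e[of z]) (simp add: linear_add[OF l(1)] linear_cmul[OF l(1)])
  have y: "\<omega> y z = Re z * \<omega> y 1 + Im z * \<omega> y \<i>" for z y
    by (subst e[of z]) (simp add: linear_add[OF l(2)] linear_cmul[OF l(2)])
  have "\<omega> \<i> 1 = - \<omega> 1 \<i>"
    using x[of "1 + \<i>" "1 + \<i>"] y[of 1 "1 + \<i>"] y[of \<i> "1 + \<i>"] by (simp add: assms(2))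
  then show ?thesis by (subst x, subst (1 2) y) (simp add: assms(2) algebra_simps)
qed

section \<open>Poisson diffeomorphisms in product charts\<close>

locale product_leaves =
  fixes \<Sigma> :: "('s::{t2_space, second_countable_topology}, complex) chart set"
    and \<Lambda> :: "('l::{t2_space, second_countable_topology}, complex) chart set"
    and \<nu> :: "('l, complex) two_form"
    and f :: "'s \<Rightarrow> real"
    and \<pi> :: "('s \<times> 'l, complex \<times> complex) bivector"
  assumes \<Sigma>: "smooth_atlas \<Sigma>" and \<Lambda>: "smooth_atlas \<Lambda>"
    and \<nu>: "volume_form \<Lambda> \<nu>" and f_pos: "\<And>p. f p > 0"
    and bivector: "bivector_field (product_atlas \<Sigma> \<Lambda>) \<pi>"
    and leaf: "\<And>p. symplectic_leaf (product_atlas \<Sigma> \<Lambda>) \<pi> \<Lambda> (\<lambda>q. (p, q)) (\<lambda>c q v w. f p * \<nu> c q v w)"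
begin

abbreviation "M \<equiv> product_atlas \<Sigma> \<Lambda>"

lemmas smooth_M = smooth_atlas_product[OF \<Sigma> \<Lambda>]
lemmas prod_chart_M = prod_chart_max_atlas[OF \<Sigma> \<Lambda>]

lemma volume_form_apply:
  assumes "c \<in> max_atlas \<Lambda>" "q \<in> fst c"
  shows "\<nu> c q v w = \<nu> c q 1 \<i> * Im (cnj v * w)" "\<nu> c q 1 \<i> \<noteq> 0"
proof -
  show *: "\<nu> c q v w = \<nu> c q 1 \<i> * Im (cnj v * w)" for v w
  proof (rule bilinear_alternating_complex)
    show "bilinear (\<nu> c q)" "\<nu> c q v v = 0" for v
      using \<nu> assms unfolding volume_form_def is_two_form_def by blast+
  qed
  show "\<nu> c q 1 \<i> \<noteq> 0"
  proof -
    obtain v w where "\<nu> c q v w \<noteq> 0" using \<nu> assms unfolding volume_form_def by blast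
    then show ?thesis using *[of v w] by auto
  qed
qed

lemma bilinear_bivector: "c \<in> max_atlas M \<Longrightarrow> m \<in> fst c \<Longrightarrow> bilinear (\<pi> c m)"
  using bivector unfolding bivector_field_def by blast

lemma bivector_transform:
  "c \<in> max_atlas M \<Longrightarrow> d \<in> max_atlas M \<Longrightarrow> m \<in> fst c \<Longrightarrow> m \<in> fst d \<Longrightarrow>
    \<pi> d m \<alpha> \<beta> = \<pi> c m (\<alpha> o\<^sub>L Blinfun (differential c d id m)) (\<beta> o\<^sub>L Blinfun (differential c d id m))"
  using bivector unfolding bivector_field_def by blast

lemma differential_leaf_inclusion:
  assumes "c \<in> max_atlas \<Sigma>" "d \<in> max_atlas \<Lambda>" "p \<in> fst c" "q \<in> fst d"
  shows "differential d (prod_chart c d) (\<lambda>q. (p, q)) q = (\<lambda>v. (0, v))"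
proof (rule differential_unique)
  have ch: "is_chart d" using assms max_atlas_is_chart by blast
  have "\<forall>\<^sub>F y in nhds (snd d q). y \<in> snd d ` fst d"
    using assms ch open_chart_image[of d UNIV] by (intro eventually_nhds_in_open) auto
  then have ev: "\<forall>\<^sub>F y in nhds (snd d q). (snd c p, y) = local_rep d (prod_chart c d) (\<lambda>q. (p, q)) y"
    by eventually_elim (use ch in \<open>simp add: local_rep_def chart_inv_right\<close>)
  have "((\<lambda>y. (snd c p, y)) has_derivative (\<lambda>v. (0, v))) (at (snd d q))"
    by (auto intro!: derivative_eq_intros)
  then show "(local_rep d (prod_chart c d) (\<lambda>q. (p, q)) has_derivative Pair 0) (at (snd d q))"
    using has_derivative_eventually_eq[OF ev] by simp
qed

text \<open>In a product chart the bivector is the inverse of the leaf form, acting on the vertical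
  parts of the two covectors. The density stands on the left so that no division appears.\<close>

lemma bivector_product_chart:
  assumes "c \<in> max_atlas \<Sigma>" "d \<in> max_atlas \<Lambda>" "p \<in> fst c" "q \<in> fst d"
  shows "f p * \<nu> d q 1 \<i> * \<pi> (prod_chart c d) (p, q) \<alpha> \<beta> =
    \<alpha> (0, 1) * \<beta> (0, \<i>) - \<alpha> (0, \<i>) * \<beta> (0, 1)"
proof -
  let ?C = "prod_chart c d" and ?P = "\<pi> (prod_chart c d) (p, q)" and ?n = "f p * \<nu> d q 1 \<i>"
  have C: "?C \<in> max_atlas M" "(p, q) \<in> fst ?C" using prod_chart_M assms by auto
  note sharp = sharp_apply[OF bilinear_bivector[OF C]]
  have r: "range (\<lambda>v. (0::complex, v)) = range (sharp ?P)"
    and w: "\<And>v w \<alpha> \<beta>. (0, v) = sharp ?P \<alpha> \<Longrightarrow> (0, w) = sharp ?P \<beta> \<Longrightarrow> f p * \<nu> d q v w = ?P \<alpha> \<beta>"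
  proof -
    have "range (differential d ?C (\<lambda>q. (p, q)) q) = range (sharp ?P) \<and>
        (\<forall>v w \<alpha> \<beta>. differential d ?C (\<lambda>q. (p, q)) q v = sharp ?P \<alpha> \<longrightarrow>
          differential d ?C (\<lambda>q. (p, q)) q w = sharp ?P \<beta> \<longrightarrow> f p * \<nu> d q v w = ?P \<alpha> \<beta>)"
      using leaf[of p] assms(2,4) C unfolding symplectic_leaf_def by blast
    then show "range (\<lambda>v. (0::complex, v)) = range (sharp ?P)"
      and "\<And>v w \<alpha> \<beta>. (0, v) = sharp ?P \<alpha> \<Longrightarrow> (0, w) = sharp ?P \<beta> \<Longrightarrow> f p * \<nu> d q v w = ?P \<alpha> \<beta>"
      unfolding differential_leaf_inclusion[OF assms] by blast+
  qed
  define V where "V \<alpha> = snd (sharp ?P \<alpha>)" for \<alpha>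
  have V: "sharp ?P \<alpha> = (0, V \<alpha>)" for \<alpha>
  proof -
    have "sharp ?P \<alpha> \<in> range (\<lambda>v. (0, v))" unfolding r by simp
    then show ?thesis by (auto simp: V_def)
  qed
  \<comment> \<open>A vertical vector \<open>(0, x)\<close> is tangent to the leaf, hence equal to
    \<open>sharp ?P \<alpha>\<close> for some \<alpha>. Pairing it with \<beta> gives
    \<open>?P \<alpha> \<beta>\<close>, which is the leaf form on \<open>x\<close> and
    \<open>V \<beta>\<close>. So \<open>V \<beta>\<close> represents the vertical part of
    \<beta>.\<close>
  have n: "\<beta> (0, x) = ?n * Im (cnj x * V \<beta>)" for \<beta> :: "(complex \<times> complex) \<Rightarrow>\<^sub>L real" and x
  proof -
    have "(0, x) \<in> range (sharp ?P)" unfolding r[symmetric] by simp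
    then obtain \<alpha> where \<alpha>: "sharp ?P \<alpha> = (0, x)" by (metis rangeE)
    have "\<beta> (0, x) = ?P \<alpha> \<beta>" using sharp[of \<beta> \<alpha>] \<alpha> by simp
    also have "\<dots> = f p * \<nu> d q x (V \<beta>)" using w[of x \<alpha> "V \<beta>" \<beta>] \<alpha> V by simp
    finally show ?thesis using volume_form_apply(1)[OF assms(2,4), of x "V \<beta>"] by simp
  qed
  have P: "?P \<alpha> \<beta> = ?n * Im (cnj (V \<alpha>) * V \<beta>)" using sharp[of \<beta> \<alpha>] n[of \<beta> "V \<alpha>"] V by simp
  show ?thesis
    unfolding P n[of \<alpha> 1] n[of \<alpha> \<i>] n[of \<beta> 1] n[of \<beta> \<i>] by (simp add: algebra_simps)
qed

text \<open>\<open>pushforward\<close> uses one chosen chart at the source point; the chain rule and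
  the transformation law of the bivector allow any other.\<close>

lemma pushforward_chart:
  assumes "\<Phi> \<in> Diff M" "c \<in> max_atlas M" "d \<in> max_atlas M" "m \<in> fst c" "\<Phi> m \<in> fst d"
  shows "pushforward M \<Phi> \<pi> d (\<Phi> m) \<alpha> \<beta> =
    \<pi> c m (\<alpha> o\<^sub>L Blinfun (differential c d \<Phi> m)) (\<beta> o\<^sub>L Blinfun (differential c d \<Phi> m))"
proof -
  let ?a = "chart_at M m"
  have \<Phi>: "bij \<Phi>" "smooth_map M M \<Phi>" using assms(1) by (auto simp: Diff_def)
  have inv: "inv \<Phi> (\<Phi> m) = m" using \<Phi> by (simp add: bij_is_inj)
  note a = chart_at[OF smooth_M, of m]
  have id: "smooth_map M M id" using smooth_map_id[OF smooth_M] .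
  have bl: "bounded_linear (differential ?a d \<Phi> m)" "bounded_linear (differential c d \<Phi> m)"
    "bounded_linear (differential c ?a id m)"
    using bounded_linear_differential[OF smooth_M smooth_M \<Phi>(2) a(1) assms(3) a(2) assms(5)]
      bounded_linear_differential[OF smooth_M smooth_M \<Phi>(2) assms(2,3,4,5)]
      bounded_linear_differential[OF smooth_M smooth_M id assms(2) a(1) assms(4)] a(2) by simp_all
  have comp: "differential c d \<Phi> m = differential ?a d \<Phi> m \<circ> differential c ?a id m"
    using differential_compose[OF smooth_M smooth_M smooth_M id \<Phi>(2) assms(2) a(1) assms(3,4)] a(2) assms(5) by simp
  have e: "Blinfun (differential ?a d \<Phi> m) o\<^sub>L Blinfun (differential c ?a id m) = Blinfun (differential c d \<Phi> m)"
    by (intro blinfun_eqI) (simp only: blinfun_apply_blinfun_compose bounded_linear_Blinfun_apply[OF bl(1)]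
      bounded_linear_Blinfun_apply[OF bl(2)] bounded_linear_Blinfun_apply[OF bl(3)] fun_cong[OF comp] o_apply)
  have *: "(\<gamma> o\<^sub>L Blinfun (differential ?a d \<Phi> m)) o\<^sub>L Blinfun (differential c ?a id m)
      = \<gamma> o\<^sub>L Blinfun (differential c d \<Phi> m)" for \<gamma> :: "(complex \<times> complex) \<Rightarrow>\<^sub>L real"
    unfolding e[symmetric] by (intro blinfun_eqI) simp
  show ?thesis
    unfolding pushforward_def inv Let_def bivector_transform[OF assms(2) a(1) assms(4) a(2)] *
    using assms by simp
qed

text \<open>Let e1, e2 be the vertical basis and a, b its image under \<open>J\<close>. Invariance
  says that n times e1 \<and> e2 equals n' times a \<and> b, with n and n' the two leaf densities. A
  nonzero decomposable bivector determines its plane and its area, so a and b are vertical and their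
  determinant is n / n'.\<close>

lemma Poisson_vertical:
  assumes "\<Phi> \<in> Poiss M \<pi>"
    and "c \<in> max_atlas \<Sigma>" "d \<in> max_atlas \<Lambda>" "p \<in> fst c" "q \<in> fst d"
    and "c' \<in> max_atlas \<Sigma>" "d' \<in> max_atlas \<Lambda>" "p' \<in> fst c'" "q' \<in> fst d'" "\<Phi> (p, q) = (p', q')"
  defines "J \<equiv> differential (prod_chart c d) (prod_chart c' d') \<Phi> (p, q)"
  shows "fst (J (0, v)) = 0"
    and "f p' * \<nu> d' q' 1 \<i> * Im (cnj (snd (J (0, 1))) * snd (J (0, \<i>))) = f p * \<nu> d q 1 \<i>"
proof -
  let ?C = "prod_chart c d" and ?D = "prod_chart c' d'"
  define n where "n = f p * \<nu> d q 1 \<i>"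
  define n' where "n' = f p' * \<nu> d' q' 1 \<i>"
  have n: "n \<noteq> 0" "n' \<noteq> 0"
    using volume_form_apply(2) assms f_pos[of p] f_pos[of p'] by (auto simp: n_def n'_def)
  have CD: "?C \<in> max_atlas M" "(p, q) \<in> fst ?C" "?D \<in> max_atlas M" "\<Phi> (p, q) \<in> fst ?D"
    using prod_chart_M assms by auto
  have \<Phi>: "\<Phi> \<in> Diff M" "smooth_map M M \<Phi>" "pushforward M \<Phi> \<pi> = \<pi>"
    using assms(1) by (auto simp: Poiss_def Diff_def)
  have J: "bounded_linear J"
    unfolding J_def using bounded_linear_differential[OF smooth_M smooth_M \<Phi>(2) CD(1,3,2,4)] .
  define a b where "a = J (0, 1)" and "b = J (0, \<i>)"
  have eq: "n * (blinfun_apply \<alpha> (0, 1) * blinfun_apply \<beta> (0, \<i>) - blinfun_apply \<alpha> (0, \<i>) * blinfun_apply \<beta> (0, 1))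
      = n' * (blinfun_apply \<alpha> a * blinfun_apply \<beta> b - blinfun_apply \<alpha> b * blinfun_apply \<beta> a)"
    for \<alpha> \<beta> :: "(complex \<times> complex) \<Rightarrow>\<^sub>L real"
  proof -
    let ?P = "\<pi> ?D (\<Phi> (p, q)) \<alpha> \<beta>"
    have 1: "n' * ?P = blinfun_apply \<alpha> (0, 1) * blinfun_apply \<beta> (0, \<i>) - blinfun_apply \<alpha> (0, \<i>) * blinfun_apply \<beta> (0, 1)"
      using bivector_product_chart[OF assms(6-9)] by (simp add: assms(10) n'_def)
    have "?P = \<pi> ?C (p, q) (\<alpha> o\<^sub>L Blinfun J) (\<beta> o\<^sub>L Blinfun J)"
      using pushforward_chart[OF \<Phi>(1) CD(1,3,2,4)] \<Phi>(3) by (simp add: J_def)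
    then have 2: "n * ?P = blinfun_apply \<alpha> a * blinfun_apply \<beta> b - blinfun_apply \<alpha> b * blinfun_apply \<beta> a"
      using bivector_product_chart[OF assms(2-5), of "\<alpha> o\<^sub>L Blinfun J" "\<beta> o\<^sub>L Blinfun J"]
      by (simp add: n_def bounded_linear_Blinfun_apply J a_def b_def)
    show ?thesis unfolding 1[symmetric] 2[symmetric] by simp
  qed
  have bl: "bounded_linear (\<lambda>z. u (fst z))" "bounded_linear (\<lambda>z. u (snd z))"
    if "bounded_linear u" for u :: "complex \<Rightarrow> real"
    using bounded_linear_compose[OF that bounded_linear_fst] bounded_linear_compose[OF that bounded_linear_snd] by auto
  \<comment> \<open>Testing on the two vertical coordinates gives the determinant; as
    \<open>n\<close> is nonzero, the vertical parts of \<open>a\<close> and \<open>b\<close> are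
    linearly independent.\<close>
  have det: "n = n' * Im (cnj (snd a) * snd b)"
    using eq[of "Blinfun (\<lambda>z. Re (snd z))" "Blinfun (\<lambda>z. Im (snd z))"]
    by (simp add: bounded_linear_Blinfun_apply bl bounded_linear_Re bounded_linear_Im algebra_simps)
  then show "f p' * \<nu> d' q' 1 \<i> * Im (cnj (snd (J (0, 1))) * snd (J (0, \<i>))) = f p * \<nu> d q 1 \<i>"
    by (simp add: n_def n'_def a_def b_def)
  \<comment> \<open>A functional of the horizontal part kills the vertical basis, so the invariance
    equation becomes a linear relation between \<open>a\<close> and \<open>b\<close> with
    coefficients \<open>u (fst a)\<close> and \<open>u (fst b)\<close>. Independence makes both
    vanish.\<close>
  have zero: "u (fst a) = 0 \<and> u (fst b) = 0" if u: "bounded_linear u" for u :: "complex \<Rightarrow> real"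
  proof -
    have 0: "u 0 = 0" using u by (simp add: bounded_linear.linear linear_0)
    have *: "u (fst a) * \<beta> b = u (fst b) * \<beta> a" for \<beta> :: "(complex \<times> complex) \<Rightarrow>\<^sub>L real"
      using eq[of "Blinfun (\<lambda>z. u (fst z))" \<beta>] n by (simp add: bounded_linear_Blinfun_apply bl u 0)
    have R: "u (fst a) * Re (snd b) = u (fst b) * Re (snd a)" and I: "u (fst a) * Im (snd b) = u (fst b) * Im (snd a)"
      using *[of "Blinfun (\<lambda>z. Re (snd z))"] *[of "Blinfun (\<lambda>z. Im (snd z))"]
      by (simp_all add: bounded_linear_Blinfun_apply bl bounded_linear_Re bounded_linear_Im)
    have "u (fst a) * Im (cnj (snd a) * snd b) = Re (snd a) * (u (fst a) * Im (snd b)) - Im (snd a) * (u (fst a) * Re (snd b))"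
      by (simp add: algebra_simps)
    also have "\<dots> = 0" unfolding R I by simp
    finally have 1: "u (fst a) = 0" using det n by auto
    have "u (fst b) * Im (cnj (snd a) * snd b) = Im (snd b) * (u (fst b) * Re (snd a)) - Re (snd b) * (u (fst b) * Im (snd a))"
      by (simp add: algebra_simps)
    also have "\<dots> = 0" unfolding R[symmetric] I[symmetric] 1 by simp
    finally show ?thesis using 1 det n by auto
  qed
  have ab: "fst a = 0" "fst b = 0"
    using zero[OF bounded_linear_Re] zero[OF bounded_linear_Im] by (auto simp: complex_eq_iff)
  have "(0, v) = Re v *\<^sub>R (0::complex, 1) + Im v *\<^sub>R (0, \<i>)" by (simp add: complex_eq_iff)
  then have "J (0, v) = J (Re v *\<^sub>R (0::complex, 1) + Im v *\<^sub>R (0, \<i>))" by simp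
  also have "\<dots> = Re v *\<^sub>R a + Im v *\<^sub>R b"
    unfolding a_def b_def linear_add[OF bounded_linear.linear[OF J]] linear_cmul[OF bounded_linear.linear[OF J]] ..
  finally have "J (0, v) = Re v *\<^sub>R a + Im v *\<^sub>R b" .
  then show "fst (J (0, v)) = 0" using ab by simp
qed

lemma local_rep_vertical_derivative:
  assumes "smooth_map M M \<Phi>"
    and "c \<in> max_atlas \<Sigma>" "d \<in> max_atlas \<Lambda>" "p \<in> fst c" "q \<in> fst d"
    and "c' \<in> max_atlas \<Sigma>" "d' \<in> max_atlas \<Lambda>" "\<Phi> (p, q) \<in> fst c' \<times> fst d'"
  shows "((\<lambda>y. map_prod (snd c') (snd d') (\<Phi> (p, chart_inv d y))) has_derivative
    (\<lambda>v. differential (prod_chart c d) (prod_chart c' d') \<Phi> (p, q) (0, v))) (at (snd d q))"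
proof -
  let ?C = "prod_chart c d" and ?D = "prod_chart c' d'"
  have ch: "is_chart c" "is_chart d" using assms max_atlas_is_chart by blast+
  have "(local_rep ?C ?D \<Phi> has_derivative differential ?C ?D \<Phi> (p, q)) (at (snd c p, snd d q))"
    using has_derivative_differential[OF smooth_M smooth_M assms(1), of ?C ?D "(p, q)"] prod_chart_M assms
    by simp
  moreover have "((\<lambda>y. (snd c p, y)) has_derivative (\<lambda>v. (0, v))) (at (snd d q))"
    by (auto intro!: derivative_eq_intros)
  ultimately have *: "((\<lambda>y. local_rep ?C ?D \<Phi> (snd c p, y)) has_derivative
      (\<lambda>v. differential ?C ?D \<Phi> (p, q) (0, v))) (at (snd d q))"
    using has_derivative_compose[of "\<lambda>y. (snd c p, y)" _ "snd d q" UNIV "local_rep ?C ?D \<Phi>"] by simp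
  have "\<forall>\<^sub>F y in nhds (snd d q). y \<in> snd d ` fst d"
    using assms ch open_chart_image[of d UNIV] by (intro eventually_nhds_in_open) auto
  then have "\<forall>\<^sub>F y in nhds (snd d q). local_rep ?C ?D \<Phi> (snd c p, y) =
      map_prod (snd c') (snd d') (\<Phi> (p, chart_inv d y))"
    by eventually_elim (use ch assms in \<open>simp add: local_rep_def is_chart_prod(2) chart_inv_left\<close>)
  from has_derivative_eventually_eq[OF this] * show ?thesis by simp
qed

text \<open>The \<Sigma>-component has zero derivative along a leaf, by
  \<open>Poisson_vertical\<close>; on a connected leaf it is therefore constant. No Hamiltonian
  curves have to be followed.\<close>

lemma Poisson_preserves_leaves:
  assumes "\<Phi> \<in> Poiss M \<pi>" "connected (UNIV :: 'l set)"
  shows "fst (\<Phi> (p, q)) = fst (\<Phi> (p, q'))"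
proof -
  have \<Phi>: "smooth_map M M \<Phi>" using assms(1) by (auto simp: Poiss_def Diff_def)
  have "(\<lambda>q. fst (\<Phi> (p, q))) constant_on UNIV"
  proof (rule locally_constant_imp_constant[OF assms(2)])
    fix q :: 'l
    obtain c d where c: "c \<in> max_atlas \<Sigma>" "p \<in> fst c" and d: "d \<in> max_atlas \<Lambda>" "q \<in> fst d"
      using max_atlas_chart_exists[OF \<Sigma>] max_atlas_chart_exists[OF \<Lambda>] by metis
    obtain c' d' where c': "c' \<in> max_atlas \<Sigma>" "fst (\<Phi> (p, q)) \<in> fst c'"
      and d': "d' \<in> max_atlas \<Lambda>" "snd (\<Phi> (p, q)) \<in> fst d'"
      using max_atlas_chart_exists[OF \<Sigma>] max_atlas_chart_exists[OF \<Lambda>] by metis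
    note ch = c(1)[THEN max_atlas_is_chart] d(1)[THEN max_atlas_is_chart] c'(1)[THEN max_atlas_is_chart]
      d'(1)[THEN max_atlas_is_chart]
    have cont: "continuous_on UNIV (\<lambda>q. \<Phi> (p, q))"
      using \<Phi> by (auto simp: smooth_map_def intro!: continuous_intros continuous_on_compose2[of UNIV \<Phi>])
    let ?W = "fst d \<inter> (\<lambda>q. \<Phi> (p, q)) -` (fst c' \<times> fst d')"
    have W: "open ?W" "q \<in> ?W"
      using open_vimage[OF open_Times cont, OF open_chart_domain[OF ch(3)] open_chart_domain[OF ch(4)]]
        open_chart_domain[OF ch(2)] d c' d' by (auto simp: mem_Times_iff)
    have o: "open (snd d ` ?W)" using open_chart_image[OF ch(2)] W ch(2)
        open_vimage[OF open_Times cont, OF open_chart_domain[OF ch(3)] open_chart_domain[OF ch(4)]] by blast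
    then obtain e where e: "e > 0" "ball (snd d q) e \<subseteq> snd d ` ?W"
      using W by (meson imageI open_contains_ball)
    let ?h = "\<lambda>y. snd c' (fst (\<Phi> (p, chart_inv d y)))"
    have der: "(?h has_derivative (\<lambda>v. 0)) (at y within ball (snd d q) e)" if y: "y \<in> ball (snd d q) e" for y
    proof -
      obtain q1 where q1: "q1 \<in> ?W" "y = snd d q1" using subsetD[OF e(2) y] by (rule imageE) blast
      have 1: "\<Phi> (p, q1) \<in> fst c' \<times> fst d'" using q1 by auto
      have "(?h has_derivative (\<lambda>v. fst (differential (prod_chart c d) (prod_chart c' d') \<Phi> (p, q1) (0, v)))) (at y)"
        using has_derivative_fst[OF local_rep_vertical_derivative[OF \<Phi> c(1) d(1) c(2) _ c'(1) d'(1) 1]] q1 by simp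
      then have "(?h has_derivative (\<lambda>v. 0)) (at y)"
        using Poisson_vertical(1)[OF assms(1) c(1) d(1) c(2) _ c'(1) d'(1), of q1 "fst (\<Phi> (p, q1))" "snd (\<Phi> (p, q1))"] q1
        by (simp add: mem_Times_iff)
      then show ?thesis by (rule has_derivative_at_withinI)
    qed
    \<comment> \<open>A zero derivative yields constancy on a convex set, hence the coordinate ball;
      its preimage \<open>?T\<close> is the required neighbourhood of \<open>q\<close>.\<close>
    have const: "?h y = ?h (snd d q)" if "y \<in> ball (snd d q) e" for y
      using has_derivative_zero_unique[OF convex_ball der that, of "snd d q"] e by auto
    let ?T = "fst d \<inter> snd d -` ball (snd d q) e"
    have oT: "open ?T" using ch(2) by (intro continuous_open_preimage) (auto simp: is_chart_def homeomorphism_def)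
    have eqT: "fst (\<Phi> (p, x)) = fst (\<Phi> (p, q))" if x: "x \<in> ?T" for x
    proof -
      have "snd d x \<in> snd d ` ?W" using x e(2) by blast
      then have "x \<in> ?W" using inj_on_image_mem_iff[OF inj_on_chart[OF ch(2)]] x by blast
      then have "fst (\<Phi> (p, x)) \<in> fst c'" by (auto simp: mem_Times_iff)
      moreover have "snd c' (fst (\<Phi> (p, x))) = snd c' (fst (\<Phi> (p, q)))"
        using const[of "snd d x"] x d ch(2) by (simp add: chart_inv_left)
      ultimately show ?thesis using inj_onD[OF inj_on_chart[OF ch(3)]] c'(2) by blast
    qed
    show "\<exists>T. openin (top_of_set UNIV) T \<and> q \<in> T \<and> (\<forall>x\<in>T. fst (\<Phi> (p, x)) = fst (\<Phi> (p, q)))"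
    proof (intro exI conjI ballI)
      show "openin (top_of_set UNIV) ?T" using oT by (simp add: subtopology_UNIV)
      show "q \<in> ?T" using d(2) e(1) by simp
    qed (rule eqT)
  qed
  then show ?thesis unfolding constant_on_def by (metis UNIV_I)
qed

text \<open>The bivector sees only vertical directions and the leaf density. The map fixes vertical
  vectors and \<phi> preserves the density, so the derivative of \<phi> drops out of the
  computation.\<close>

lemma product_with_id_Poisson:
  assumes "map_prod \<phi> id \<in> Diff M" "\<And>p. f (\<phi> p) = f p"
  shows "map_prod \<phi> id \<in> Poiss M \<pi>"
proof -
  let ?\<Phi> = "map_prod \<phi> (id :: 'l \<Rightarrow> 'l)"
  have \<Phi>: "bij ?\<Phi>" "smooth_map M M ?\<Phi>" using assms(1) by (auto simp: Diff_def)
  have id: "smooth_map M M id" using smooth_map_id[OF smooth_M] .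
  have "pushforward M ?\<Phi> \<pi> d m \<alpha> \<beta> = \<pi> d m \<alpha> \<beta>" for d m \<alpha> \<beta>
  proof (cases "d \<in> max_atlas M \<and> m \<in> fst d")
    case False
    then have "\<pi> d m = (\<lambda>\<alpha> \<beta>. 0)" using bivector unfolding bivector_field_def by blast
    then show ?thesis using False by (auto simp: pushforward_def)
  next
    case True
    obtain p q where m: "m = ?\<Phi> (p, q)" using \<Phi>(1) by (metis bij_pointE surj_pair)
    obtain c1 c2 d1 where c: "c1 \<in> max_atlas \<Sigma>" "p \<in> fst c1" "c2 \<in> max_atlas \<Lambda>" "q \<in> fst c2"
      "d1 \<in> max_atlas \<Sigma>" "\<phi> p \<in> fst d1"
      using max_atlas_chart_exists[OF \<Sigma>] max_atlas_chart_exists[OF \<Lambda>] by metis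
    let ?C = "prod_chart c1 c2" and ?D = "prod_chart d1 c2"
    have CD: "?C \<in> max_atlas M" "(p, q) \<in> fst ?C" "?D \<in> max_atlas M" "?\<Phi> (p, q) \<in> fst ?D"
      using prod_chart_M c by auto
    have d: "d \<in> max_atlas M" "?\<Phi> (p, q) \<in> fst d" using True m by auto
    \<comment> \<open>The chart \<open>d\<close> may mix the factors. Its differential is factored
      through the product chart \<open>?D\<close>, where the bivector is explicit; \<open>T\<close>
      is the change of coordinates.\<close>
    define J where "J = differential ?C ?D ?\<Phi> (p, q)"
    define T where "T = differential ?D d id (?\<Phi> (p, q))"
    have TJ: "differential ?C d ?\<Phi> (p, q) = T \<circ> J"
    proof -
      have "differential ?C d (id \<circ> ?\<Phi>) (p, q) = T \<circ> J"
        unfolding T_def J_def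
        by (rule differential_compose[OF smooth_M smooth_M smooth_M \<Phi>(2) id CD(1,3) d(1) CD(2,4)]) (use d(2) in simp)
      then show ?thesis by (simp only: id_comp)
    qed
    have bl: "bounded_linear J" "bounded_linear T" "bounded_linear (T \<circ> J)"
    proof -
      show 1: "bounded_linear J"
        unfolding J_def by (rule bounded_linear_differential[OF smooth_M smooth_M \<Phi>(2) CD(1,3,2,4)])
      show 2: "bounded_linear T"
        unfolding T_def using bounded_linear_differential[OF smooth_M smooth_M id CD(3) d(1) CD(4)] d(2) by simp
      show "bounded_linear (T \<circ> J)" using bounded_linear_compose[OF 2 1] by (simp add: o_def)
    qed
    have J: "J (0, v) = (0, v)" for v
    proof -
      have "((\<lambda>y. map_prod (snd d1) (snd c2) (?\<Phi> (p, chart_inv c2 y))) has_derivative (\<lambda>v. J (0, v))) (at (snd c2 q))"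
        unfolding J_def using local_rep_vertical_derivative[OF \<Phi>(2) c(1,3,2,4,5,3)] c by simp
      moreover have "((\<lambda>y. map_prod (snd d1) (snd c2) (?\<Phi> (p, chart_inv c2 y))) has_derivative (\<lambda>v. (0, v))) (at (snd c2 q))"
        using has_derivative_differential[OF \<Lambda> \<Lambda> smooth_map_id[OF \<Lambda>] c(3,3,4)] c(4)
          differential_id[OF max_atlas_is_chart[OF c(3)] c(4)]
        by (auto simp: local_rep_def o_def intro!: derivative_eq_intros)
      ultimately show ?thesis using has_derivative_unique by (metis (mono_tags, lifting))
    qed
    let ?n = "f p * \<nu> c2 q 1 \<i>"
    have "?n * pushforward M ?\<Phi> \<pi> d m \<alpha> \<beta> = ?n * \<pi> ?C (p, q) (\<alpha> o\<^sub>L Blinfun (T \<circ> J)) (\<beta> o\<^sub>L Blinfun (T \<circ> J))"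
      unfolding m pushforward_chart[OF assms(1) CD(1) d(1) CD(2) d(2)] TJ ..
    also have "\<dots> = \<alpha> (T (0, 1)) * \<beta> (T (0, \<i>)) - \<alpha> (T (0, \<i>)) * \<beta> (T (0, 1))"
      using bivector_product_chart[OF c(1,3,2,4)] by (simp add: bounded_linear_Blinfun_apply bl J)
    also have "\<dots> = ?n * \<pi> ?D (\<phi> p, q) (\<alpha> o\<^sub>L Blinfun T) (\<beta> o\<^sub>L Blinfun T)"
      using bivector_product_chart[OF c(5,3,6,4)] assms(2) by (simp add: bounded_linear_Blinfun_apply bl)
    also have "\<dots> = ?n * \<pi> d m \<alpha> \<beta>"
      unfolding m using bivector_transform[OF CD(3) d(1) CD(4) d(2)] by (simp add: T_def)
    finally show ?thesis using volume_form_apply(2)[OF c(3,4)] f_pos[of p] by simp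
  qed
  then show ?thesis using assms(1) by (auto simp: Poiss_def fun_eq_iff)
qed

end

section \<open>Volumes on compact surfaces\<close>

text \<open>The change of variables theorem \<open>has_absolute_integral_change_of_variables\<close> is about \<open>real^'n\<close>,
  not about arbitrary Euclidean spaces.\<close>

definition complex_of_vec :: "real^2 \<Rightarrow> complex" where
  "complex_of_vec v = Complex (v $ 1) (v $ 2)"

definition vec_of_complex :: "complex \<Rightarrow> real^2" where
  "vec_of_complex z = vector [Re z, Im z]"

lemma vec_of_complex_inverse [simp]: "complex_of_vec (vec_of_complex z) = z"
  by (simp add: complex_of_vec_def vec_of_complex_def)

lemma complex_of_vec_inverse [simp]: "vec_of_complex (complex_of_vec v) = v"
  by (simp add: complex_of_vec_def vec_of_complex_def vec_eq_iff forall_2)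

lemma bounded_linear_vec_of_complex: "bounded_linear vec_of_complex"
  by (intro linear_linear[THEN iffD2] linearI)
    (simp_all add: vec_of_complex_def vec_eq_iff forall_2)

lemma bounded_linear_complex_of_vec: "bounded_linear complex_of_vec"
  by (intro linear_linear[THEN iffD2] linearI)
    (simp_all add: complex_of_vec_def complex_eq_iff)

lemma det_matrix_complex:
  "det (matrix (\<lambda>v. vec_of_complex (L (complex_of_vec v)))) = Im (cnj (L 1) * L \<i>)"
proof -
  have "complex_of_vec (axis 1 1) = 1" "complex_of_vec (axis 2 1) = \<i>"
    by (simp_all add: complex_of_vec_def axis_def complex_eq_iff)
  then show ?thesis
    by (simp add: det_2 matrix_def vec_of_complex_def algebra_simps)
qed

lemma change_of_variables_complex:
  fixes g :: "complex \<Rightarrow> complex" and r :: "complex \<Rightarrow> real"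
  assumes S: "S \<in> sets borel"
    and der: "\<And>z. z \<in> S \<Longrightarrow> (g has_derivative g' z) (at z)"
    and inj: "inj_on g S"
    and int: "(\<lambda>v. \<bar>Im (cnj (g' (complex_of_vec v) 1) * g' (complex_of_vec v) \<i>)\<bar> * r (g (complex_of_vec v)))
      absolutely_integrable_on complex_of_vec -` S"
  shows "(\<lambda>v. r (complex_of_vec v)) absolutely_integrable_on complex_of_vec -` (g ` S)"
    and "integral (complex_of_vec -` (g ` S)) (\<lambda>v. r (complex_of_vec v)) = integral (complex_of_vec -` S)
      (\<lambda>v. \<bar>Im (cnj (g' (complex_of_vec v) 1) * g' (complex_of_vec v) \<i>)\<bar> * r (g (complex_of_vec v)))"
proof -
  let ?S = "complex_of_vec -` S"
  let ?h = "\<lambda>v. \<bar>Im (cnj (g' (complex_of_vec v) 1) * g' (complex_of_vec v) \<i>)\<bar> * r (g (complex_of_vec v))"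
  let ?g = "\<lambda>v. vec_of_complex (g (complex_of_vec v))"
  let ?g' = "\<lambda>v w. vec_of_complex (g' (complex_of_vec v) (complex_of_vec w))"
  have im: "?g ` ?S = complex_of_vec -` (g ` S)"
  proof (intro equalityI subsetI)
    fix v assume "v \<in> complex_of_vec -` (g ` S)"
    then obtain z where "z \<in> S" "complex_of_vec v = g z" by auto
    then have "v = ?g (vec_of_complex z)" by (metis complex_of_vec_inverse vec_of_complex_inverse)
    moreover have "vec_of_complex z \<in> ?S" using \<open>z \<in> S\<close> by simp
    ultimately show "v \<in> ?g ` ?S" by (rule image_eqI)
  qed auto
  have "complex_of_vec \<in> borel_measurable borel"
    by (intro borel_measurable_continuous_onI linear_continuous_on bounded_linear_complex_of_vec)
  then have "?S \<in> sets borel" using S by (rule measurable_sets_borel)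
  then have S': "?S \<in> sets lebesgue" by auto
  have der': "(?g has_derivative ?g' v) (at v within ?S)" if "v \<in> ?S" for v
  proof -
    have "(g \<circ> complex_of_vec has_derivative g' (complex_of_vec v) \<circ> complex_of_vec) (at v)"
      using that by (intro diff_chain_at bounded_linear_imp_has_derivative bounded_linear_complex_of_vec der) auto
    from bounded_linear.has_derivative[OF bounded_linear_vec_of_complex this]
    show ?thesis by (auto simp: o_def intro: has_derivative_at_withinI)
  qed
  have inj': "inj_on ?g ?S"
  proof (rule inj_onI)
    fix v w assume "v \<in> ?S" "w \<in> ?S" "?g v = ?g w"
    then have "g (complex_of_vec v) = g (complex_of_vec w)" by (metis vec_of_complex_inverse)
    then show "v = w" using \<open>v \<in> ?S\<close> \<open>w \<in> ?S\<close> inj by (metis complex_of_vec_inverse inj_onD vimageE)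
  qed
  \<comment> \<open>The theorem is about vector-valued integrands, so the real function is wrapped
    as a vector of length 1 and unwrapped afterwards.\<close>
  note cov = has_absolute_integral_change_of_variables[OF S' der' inj', where f = "\<lambda>v. vec (r (complex_of_vec v)) :: real^1"]
  have eq: "(\<lambda>v. \<bar>det (matrix (?g' v))\<bar> *\<^sub>R (vec (r (complex_of_vec (?g v))) :: real^1)) = (\<lambda>v. vec (?h v))"
    by (simp add: det_matrix_complex vec_eq_iff fun_eq_iff)
  have "(\<lambda>v. vec (?h v) :: real^1) absolutely_integrable_on ?S"
    using int by (simp add: absolutely_integrable_on_1_iff)
  then have *: "(\<lambda>v. vec (r (complex_of_vec v)) :: real^1) absolutely_integrable_on ?g ` ?S \<and>
      integral (?g ` ?S) (\<lambda>v. vec (r (complex_of_vec v)) :: real^1) = integral ?S (\<lambda>v. vec (?h v))"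
    using cov unfolding eq by blast
  then show "(\<lambda>v. r (complex_of_vec v)) absolutely_integrable_on complex_of_vec -` (g ` S)"
    unfolding im by (simp add: absolutely_integrable_on_1_iff)
  show "integral (complex_of_vec -` (g ` S)) (\<lambda>v. r (complex_of_vec v)) = integral ?S ?h"
    using * unfolding im using int
    by (simp add: integral_on_1_eq vec_eq_iff absolutely_integrable_on_def)
qed

text \<open>The derivative condition says that \<psi> multiplies \<rho>-volume by s / t. As \<psi>
  is injective, s / t times the total volume is at most the total volume, which is finite by
  compactness and positive. Volumes are computed on a finite Borel partition \<open>E\<close> of the
  surface, each piece lying in one coordinate ball.\<close>

lemma density_expansion:
  fixes A :: "('a::{t2_space, second_countable_topology}, complex) chart set"
    and \<rho> :: "('a, complex) chart \<Rightarrow> 'a \<Rightarrow> real"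
  assumes A: "smooth_atlas A" and cpt: "compact (UNIV :: 'a set)"
    and pos: "\<And>c q. c \<in> max_atlas A \<Longrightarrow> q \<in> fst c \<Longrightarrow> \<rho> c q > 0"
    and cont: "\<And>c. c \<in> max_atlas A \<Longrightarrow> continuous_on (snd c ` fst c) (\<lambda>y. \<rho> c (chart_inv c y))"
    and \<psi>: "continuous_on UNIV \<psi>" "inj \<psi>" and t: "t > 0"
    and der: "\<And>c d q. c \<in> max_atlas A \<Longrightarrow> d \<in> max_atlas A \<Longrightarrow> q \<in> fst c \<Longrightarrow> \<psi> q \<in> fst d \<Longrightarrow>
      \<exists>L. (local_rep c d \<psi> has_derivative L) (at (snd c q)) \<and> t * \<rho> d (\<psi> q) * \<bar>Im (cnj (L 1) * L \<i>)\<bar> = s * \<rho> c q"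
  shows "s \<le> t"
proof -
  \<comment> \<open>Closed balls inside the chart image make the density continuous on a compact
    set, hence integrable.\<close>
  have "\<exists>c e. c \<in> max_atlas A \<and> q \<in> fst c \<and> e > 0 \<and> cball (snd c q) e \<subseteq> snd c ` fst c" for q
  proof -
    obtain c where c: "c \<in> max_atlas A" "q \<in> fst c" using max_atlas_chart_exists[OF A] by metis
    then have "open (snd c ` fst c)" "snd c q \<in> snd c ` fst c"
      using open_chart_image[OF max_atlas_is_chart[OF c(1)], of UNIV] by auto
    then obtain e where "e > 0" "cball (snd c q) e \<subseteq> snd c ` fst c" by (meson open_contains_cball)
    then show ?thesis using c by blast
  qed
  then obtain c e where ce: "\<And>q. c q \<in> max_atlas A \<and> q \<in> fst (c q) \<and> e q > 0 \<and> cball (snd (c q) q) (e q) \<subseteq> snd (c q) ` fst (c q)"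
    by metis
  define W where "W q = fst (c q) \<inter> snd (c q) -` ball (snd (c q) q) (e q)" for q
  have ic: "is_chart (c q)" for q using ce max_atlas_is_chart by blast
  have oW: "open (W q)" for q
    unfolding W_def using ic[of q] by (intro continuous_open_preimage) (auto simp: is_chart_def homeomorphism_def)
  have qW: "q \<in> W q" for q using ce[of q] by (simp add: W_def)
  obtain C where C: "finite C" "UNIV \<subseteq> (\<Union>q\<in>C. W q)"
    by (rule compactE_image[OF cpt, of UNIV W]) (use oW qW in auto)
  obtain xs where xs: "set xs = C" using finite_list[OF C(1)] by blast
  define n where "n = length xs"
  have n: "n > 0" using C(2) xs by (cases xs) (auto simp: n_def)
  define k where "k i = c (xs ! i)" for i
  define E where "E = disjointed (\<lambda>i. W (xs ! i))"
  \<comment> \<open>Every index names a genuine chart, even one beyond the list, since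
    \<open>c\<close> chooses a chart at every point. The facts below can thus be stated for all
    \<open>i\<close>.\<close>
  have k: "k i \<in> max_atlas A" "is_chart (k i)" for i using ce ic by (auto simp: k_def)
  have EW: "E i \<subseteq> W (xs ! i)" for i unfolding E_def by (rule disjointed_subset)
  have Efst: "E i \<subseteq> fst (k i)" for i using EW[of i] by (auto simp: W_def k_def)
  have Ecov: "(\<Union>i\<in>{0..<n}. E i) = UNIV"
  proof -
    have "(\<Union>i\<in>{0..<n}. W (xs ! i)) = (\<Union>q\<in>set xs. W q)"
      by (force simp: n_def in_set_conv_nth)
    then show ?thesis using C(2) xs unfolding E_def finite_UN_disjointed_eq by (metis top.extremum_uniqueI)
  qed
  have Edisj: "E i \<inter> E j = {}" if "i \<noteq> j" for i j
    using disjoint_family_disjointed[of "\<lambda>i. W (xs ! i)"] that unfolding E_def disjoint_family_on_def by simp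
  have Eborel: "E i \<in> sets borel" for i
    unfolding E_def disjointed_def using oW by (intro sets.Diff sets.finite_UN borel_open) auto
  \<comment> \<open>The coordinate picture of piece \<open>i\<close>: density \<open>R\<close>, and
    \<open>P i T\<close> for the part of \<open>T\<close> inside the piece. \<open>Rv\<close> and
    \<open>Q\<close> are the same in \<open>real^2\<close>. Intersecting with \<open>E i\<close>
    prevents double counting on chart overlaps.\<close>
  define R where "R i z = \<rho> (k i) (chart_inv (k i) z)" for i z
  define P where "P i T = snd (k i) ` (T \<inter> E i)" for i T
  define Q where "Q i T = complex_of_vec -` P i T" for i T
  define Rv where "Rv i v = R i (complex_of_vec v)" for i v
  have P_eq: "P i T = {y \<in> snd (k i) ` fst (k i). chart_inv (k i) y \<in> T \<inter> E i}" for i T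
    using Efst[of i] chart_inv_left[OF k(2)] by (force simp: P_def)
  have P_ball: "P i T \<subseteq> cball (snd (k i) (xs ! i)) (e (xs ! i))" for i T
    using EW[of i] by (auto simp: P_def W_def k_def)
  have cball_sub: "cball (snd (k i) (xs ! i)) (e (xs ! i)) \<subseteq> snd (k i) ` fst (k i)" for i
    using ce by (simp add: k_def)
  have P_borel: "P i T \<in> sets borel" if T: "T \<in> sets borel" for i T
  proof -
    have X: "open (snd (k i) ` fst (k i))" "continuous_on (snd (k i) ` fst (k i)) (chart_inv (k i))"
      using k(2)[of i] by (auto simp: is_chart_def homeomorphism_def)
    let ?X = "snd (k i) ` fst (k i)"
    have "chart_inv (k i) -` (T \<inter> E i) \<inter> space (restrict_space borel ?X) \<in> sets (restrict_space borel ?X)"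
      using borel_measurable_continuous_on_restrict[OF X(2)] sets.Int[OF T Eborel[of i]] by (rule measurable_sets)
    then have "chart_inv (k i) -` (T \<inter> E i) \<inter> space (restrict_space borel ?X) \<in> sets borel"
      using sets_restrict_space_iff[of ?X borel] borel_open[OF X(1)] by simp
    moreover have "chart_inv (k i) -` (T \<inter> E i) \<inter> space (restrict_space borel ?X) = P i T"
      unfolding P_eq space_restrict_space by (simp add: Int_def vimage_def conj_commute)
    ultimately show ?thesis by simp
  qed
  have Q_leb: "Q i T \<in> sets lebesgue" if "T \<in> sets borel" for i T
  proof -
    have "complex_of_vec \<in> borel_measurable borel"
      by (intro borel_measurable_continuous_onI linear_continuous_on bounded_linear_complex_of_vec)
    then have "Q i T \<in> sets borel" unfolding Q_def using P_borel[OF that] by (rule measurable_sets_borel)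
    then show ?thesis by auto
  qed
  have Rv_int: "Rv i absolutely_integrable_on Q i T" if T: "T \<in> sets borel" for i T
  proof -
    let ?B = "cball (snd (k i) (xs ! i)) (e (xs ! i))"
    have eq: "complex_of_vec -` ?B = vec_of_complex ` ?B"
      by (auto simp: image_iff) (metis complex_of_vec_inverse mem_cball)
    have cB: "compact (complex_of_vec -` ?B)"
      unfolding eq by (intro compact_continuous_image linear_continuous_on bounded_linear_vec_of_complex compact_cball)
    have "continuous_on ?B (R i)"
      unfolding R_def using continuous_on_subset[OF cont[OF k(1)] cball_sub] .
    then have "continuous_on (complex_of_vec -` ?B) (Rv i)"
      unfolding Rv_def
      by (rule continuous_on_compose2[OF _ linear_continuous_on[OF bounded_linear_complex_of_vec]]) auto
    then have 1: "integrable lborel (\<lambda>x. indicator (complex_of_vec -` ?B) x *\<^sub>R Rv i x)"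
      by (rule borel_integrable_compact[OF cB])
    then have "set_integrable lebesgue (complex_of_vec -` ?B) (Rv i)"
      unfolding set_integrable_def by (subst integrable_completion) auto
    then show ?thesis
      by (rule set_integrable_subset) (use Q_leb[OF T] P_ball[of i T] in \<open>auto simp: Q_def\<close>)
  qed
  have Rv_integrable: "Rv i integrable_on Q i T" if "T \<in> sets borel" for i T
    using Rv_int[OF that, of i] by (simp add: absolutely_integrable_on_def)
  have Q_disj: "Q i T \<inter> Q i T' = {}" if "T \<inter> T' \<inter> E i = {}" for i T T'
    using that by (auto simp: Q_def P_eq)
  have R_pos: "Rv i v > 0" if "v \<in> Q i UNIV" for i v
    using that pos[OF k(1), of _ i] chart_inv_in[OF k(2)] by (auto simp: Q_def P_eq Rv_def R_def)
  have Q_mono: "Q i T \<subseteq> Q i UNIV" for i T by (auto simp: Q_def P_def)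
  define V where "V i = integral (Q i UNIV) (Rv i)" for i
  have \<psi>E: "\<psi> -` E j \<in> sets borel" for j
    using borel_measurable_continuous_onI[OF \<psi>(1)] Eborel[of j] by (rule measurable_sets_borel)
  \<comment> \<open>The source piece is cut according to the target piece into which \<psi> sends
    its points.\<close>
  have V_split: "V i = (\<Sum>j\<in>{0..<n}. integral (Q i (\<psi> -` E j)) (Rv i))" for i
  proof -
    have "(Rv i has_integral (\<Sum>j\<in>{0..<n}. integral (Q i (\<psi> -` E j)) (Rv i))) (\<Union>j\<in>{0..<n}. Q i (\<psi> -` E j))"
    proof (rule has_integral_UN)
      have "Q i (\<psi> -` E j) \<inter> Q i (\<psi> -` E j') = {}" if "j \<noteq> j'" for j j'
        by (rule Q_disj) (use Edisj[OF that] in blast)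
      then show "pairwise (\<lambda>j j'. negligible (Q i (\<psi> -` E j) \<inter> Q i (\<psi> -` E j'))) {0..<n}"
        by (simp add: pairwise_def)
    qed (simp, rule integrable_integral[OF Rv_integrable[OF \<psi>E]])
    moreover have "(\<Union>j\<in>{0..<n}. Q i (\<psi> -` E j)) = Q i UNIV"
    proof -
      have "(\<Union>j\<in>{0..<n}. \<psi> -` E j) = UNIV" using Ecov by (metis vimage_UN vimage_UNIV)
      moreover have "(\<Union>j\<in>{0..<n}. P i (\<psi> -` E j)) = snd (k i) ` ((\<Union>j\<in>{0..<n}. \<psi> -` E j) \<inter> E i)"
        unfolding P_def by blast
      ultimately have "(\<Union>j\<in>{0..<n}. P i (\<psi> -` E j)) = P i UNIV" by (simp add: P_def)
      then show ?thesis unfolding Q_def by (simp flip: vimage_UN)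
    qed
    ultimately show ?thesis unfolding V_def by (simp add: integral_unique)
  qed
  \<comment> \<open>In the charts of pieces \<open>i\<close> and \<open>j\<close>, \<psi> carries
    the points of \<open>E i\<close> landing in \<open>E j\<close> bijectively onto the part of the
    image of \<open>E i\<close> inside \<open>E j\<close>. The Jacobian identity supplies the factor
    s / t.\<close>
  have cov: "Rv j absolutely_integrable_on Q j (\<psi> ` E i) \<and>
      integral (Q j (\<psi> ` E i)) (Rv j) = s / t * integral (Q i (\<psi> -` E j)) (Rv i)" for i j
  proof -
    let ?g = "local_rep (k i) (k j) \<psi>" and ?S = "P i (\<psi> -` E j)"
    have S: "\<exists>q. q \<in> E i \<and> \<psi> q \<in> E j \<and> z = snd (k i) q \<and> q \<in> fst (k i) \<and> \<psi> q \<in> fst (k j) \<and> ?g z = snd (k j) (\<psi> q)"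
      if "z \<in> ?S" for z
      using that Efst[of i] Efst[of j] chart_inv_left[OF k(2)] by (fastforce simp: P_def local_rep_def)
    have im: "?g ` ?S = P j (\<psi> ` E i)"
    proof (intro equalityI subsetI)
      fix y assume "y \<in> ?g ` ?S"
      then obtain z where z: "z \<in> ?S" "y = ?g z" by auto
      from S[OF z(1)] obtain q where "q \<in> E i" "\<psi> q \<in> E j" "?g z = snd (k j) (\<psi> q)" by blast
      then show "y \<in> P j (\<psi> ` E i)" unfolding z P_def by auto
    next
      fix y assume "y \<in> P j (\<psi> ` E i)"
      then obtain q where q: "q \<in> E i" "\<psi> q \<in> E j" "y = snd (k j) (\<psi> q)" by (auto simp: P_def)
      then have "y = ?g (snd (k i) q)" using Efst[of i] chart_inv_left[OF k(2)] by (auto simp: local_rep_def)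
      then show "y \<in> ?g ` ?S" using q by (auto simp: P_def)
    qed
    have inj: "inj_on ?g ?S"
    proof (rule inj_onI)
      fix z w assume "z \<in> ?S" "w \<in> ?S" and eq: "?g z = ?g w"
      then obtain q q' where q: "z = snd (k i) q" "\<psi> q \<in> fst (k j)" "?g z = snd (k j) (\<psi> q)"
        "w = snd (k i) q'" "\<psi> q' \<in> fst (k j)" "?g w = snd (k j) (\<psi> q')"
        using S[of z] S[of w] by blast
      then have "\<psi> q = \<psi> q'" using inj_onD[OF inj_on_chart[OF k(2)[of j]]] eq by metis
      then show "z = w" using q \<psi>(2) by (simp add: inj_eq)
    qed
    have "\<exists>L. (?g has_derivative L) (at z) \<and> \<bar>Im (cnj (L 1) * L \<i>)\<bar> * R j (?g z) = s / t * R i z" if z: "z \<in> ?S" for z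
    proof -
      obtain q where q: "z = snd (k i) q" "q \<in> fst (k i)" "\<psi> q \<in> fst (k j)" "?g z = snd (k j) (\<psi> q)"
        using S[OF z] by blast
      from der[OF k(1) k(1) q(2,3)] obtain L where
        "(?g has_derivative L) (at (snd (k i) q))" "t * \<rho> (k j) (\<psi> q) * \<bar>Im (cnj (L 1) * L \<i>)\<bar> = s * \<rho> (k i) q" by blast
      then show ?thesis
        using q t chart_inv_left[OF k(2)] by (intro exI[of _ L]) (auto simp: R_def field_simps)
    qed
    then obtain L where L: "\<And>z. z \<in> ?S \<Longrightarrow> (?g has_derivative L z) (at z)"
      "\<And>z. z \<in> ?S \<Longrightarrow> \<bar>Im (cnj (L z 1) * L z \<i>)\<bar> * R j (?g z) = s / t * R i z" by metis
    let ?h = "\<lambda>v. \<bar>Im (cnj (L (complex_of_vec v) 1) * L (complex_of_vec v) \<i>)\<bar> * R j (?g (complex_of_vec v))"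
    have h: "?h v = s / t * Rv i v" if "v \<in> complex_of_vec -` ?S" for v
      using L(2)[of "complex_of_vec v"] that by (simp add: Rv_def)
    have "(\<lambda>v. s / t * Rv i v) absolutely_integrable_on complex_of_vec -` ?S"
      using Rv_int[OF \<psi>E, of i j] by (intro set_integrable_mult_right) (simp add: Q_def)
    then have "?h absolutely_integrable_on complex_of_vec -` ?S"
      by (rule iffD2[OF set_integrable_cong[OF refl refl h], rotated])
    from change_of_variables_complex[OF P_borel[OF \<psi>E] L(1) inj this]
    have "Rv j absolutely_integrable_on Q j (\<psi> ` E i)"
      "integral (Q j (\<psi> ` E i)) (Rv j) = integral (Q i (\<psi> -` E j)) ?h"
      unfolding im Q_def[symmetric] Rv_def[symmetric] by auto
    moreover have "integral (Q i (\<psi> -` E j)) ?h = s / t * integral (Q i (\<psi> -` E j)) (Rv i)"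
      using integral_cong[of "Q i (\<psi> -` E j)" ?h "\<lambda>v. s / t * Rv i v"] h
      by (simp add: Q_def)
    ultimately show ?thesis by simp
  qed
  \<comment> \<open>By injectivity the images of different source pieces are disjoint inside
    \<open>E j\<close>, so their volumes add up to at most that of \<open>E j\<close>.\<close>
  have le: "(\<Sum>i\<in>{0..<n}. integral (Q j (\<psi> ` E i)) (Rv j)) \<le> V j" for j
  proof -
    have "(Rv j has_integral (\<Sum>i\<in>{0..<n}. integral (Q j (\<psi> ` E i)) (Rv j))) (\<Union>i\<in>{0..<n}. Q j (\<psi> ` E i))"
    proof (rule has_integral_UN)
      have "Q j (\<psi> ` E i) \<inter> Q j (\<psi> ` E i') = {}" if "i \<noteq> i'" for i i'
        by (rule Q_disj) (use Edisj[OF that] injD[OF \<psi>(2)] in blast)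
      then show "pairwise (\<lambda>i i'. negligible (Q j (\<psi> ` E i) \<inter> Q j (\<psi> ` E i'))) {0..<n}"
        by (simp add: pairwise_def)
      show "(Rv j has_integral integral (Q j (\<psi> ` E i)) (Rv j)) (Q j (\<psi> ` E i))" for i
        using cov[of j i] unfolding absolutely_integrable_on_def by (blast intro: integrable_integral)
    qed simp
    then have i: "Rv j integrable_on (\<Union>i\<in>{0..<n}. Q j (\<psi> ` E i))"
      and e: "integral (\<Union>i\<in>{0..<n}. Q j (\<psi> ` E i)) (Rv j) = (\<Sum>i\<in>{0..<n}. integral (Q j (\<psi> ` E i)) (Rv j))"
      by (auto simp: has_integral_iff)
    have "integral (\<Union>i\<in>{0..<n}. Q j (\<psi> ` E i)) (Rv j) \<le> integral (Q j UNIV) (Rv j)"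
      by (rule integral_subset_le[OF _ i Rv_integrable]) (use Q_mono R_pos in \<open>auto intro: less_imp_le\<close>)
    then show ?thesis unfolding e V_def .
  qed
  have "s / t * (\<Sum>i\<in>{0..<n}. V i) = (\<Sum>i\<in>{0..<n}. \<Sum>j\<in>{0..<n}. integral (Q j (\<psi> ` E i)) (Rv j))"
    unfolding V_split sum_distrib_left using cov by simp
  also have "\<dots> = (\<Sum>j\<in>{0..<n}. \<Sum>i\<in>{0..<n}. integral (Q j (\<psi> ` E i)) (Rv j))" by (rule sum.swap)
  also have "\<dots> \<le> (\<Sum>j\<in>{0..<n}. V j)" by (intro sum_mono le)
  finally have main: "s / t * (\<Sum>i\<in>{0..<n}. V i) \<le> (\<Sum>i\<in>{0..<n}. V i)" .
  have V_nonneg: "V i \<ge> 0" for i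
    unfolding V_def by (rule integral_nonneg[OF Rv_integrable]) (use R_pos less_imp_le in auto)
  \<comment> \<open>The first set of a disjointed sequence is left uncut, so piece 0 is a whole open
    coordinate ball. A continuous positive density cannot have integral zero on a box inside
    it.\<close>
  have "V 0 \<noteq> 0"
  proof
    assume V0: "V 0 = 0"
    have P0: "P 0 UNIV = ball (snd (k 0) (xs ! 0)) (e (xs ! 0))"
    proof (intro equalityI subsetI)
      fix y assume y: "y \<in> ball (snd (k 0) (xs ! 0)) (e (xs ! 0))"
      then obtain m where "m \<in> fst (k 0)" "y = snd (k 0) m"
        using subsetD[OF cball_sub[of 0]] ball_subset_cball by blast
      then show "y \<in> P 0 UNIV" using y by (auto simp: P_def E_def W_def k_def)
    qed (auto simp: P_def E_def W_def k_def)
    have "open (Q 0 UNIV)"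
      unfolding Q_def P0 by (intro open_vimage linear_continuous_on bounded_linear_complex_of_vec) auto
    moreover have x: "vec_of_complex (snd (k 0) (xs ! 0)) \<in> Q 0 UNIV"
      unfolding Q_def P0 using ce by (simp add: k_def)
    ultimately obtain a b where ab: "vec_of_complex (snd (k 0) (xs ! 0)) \<in> box a b" "cbox a b \<subseteq> Q 0 UNIV"
      by (rule open_contains_cbox)
    have ci: "Rv 0 integrable_on cbox a b" 
    proof -
      have "Rv 0 absolutely_integrable_on cbox a b"
        by (rule set_integrable_subset[OF Rv_int[of UNIV]]) (use ab in auto)
      then show ?thesis by (simp add: absolutely_integrable_on_def)
    qed
    have "integral (cbox a b) (Rv 0) \<le> V 0"
      unfolding V_def by (rule integral_subset_le[OF ab(2) ci Rv_integrable]) (use R_pos less_imp_le in auto)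
    moreover have "integral (cbox a b) (Rv 0) \<ge> 0"
      by (rule integral_nonneg[OF ci]) (use ab R_pos less_imp_le in blast)
    ultimately have hi: "(Rv 0 has_integral 0) (cbox a b)" using ci V0 by (simp add: has_integral_iff)
    have co: "continuous_on (cbox a b) (Rv 0)"
    proof -
      have "continuous_on (cball (snd (k 0) (xs ! 0)) (e (xs ! 0))) (R 0)"
        unfolding R_def using continuous_on_subset[OF cont[OF k(1)] cball_sub] .
      then show ?thesis
        unfolding Rv_def
        by (rule continuous_on_compose2[OF _ linear_continuous_on[OF bounded_linear_complex_of_vec]])
          (use ab(2) P_ball[of 0 UNIV] in \<open>auto simp: Q_def\<close>)
    qed
    have nonneg: "0 \<le> Rv 0 v" if "v \<in> box a b" for v
      using R_pos[OF subsetD[OF ab(2) subsetD[OF box_subset_cbox that]]] by simp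
    have "Rv 0 (vec_of_complex (snd (k 0) (xs ! 0))) = 0"
      by (rule has_integral_0_cbox_imp_0[OF co nonneg hi _ subsetD[OF box_subset_cbox ab(1)]]) (use ab(1) in auto)
    then show False using R_pos[OF x] by simp
  qed
  then have "V 0 > 0" using V_nonneg[of 0] by linarith
  then have "(\<Sum>i\<in>{0..<n}. V i) > 0"
    using sum_pos2[of "{0..<n}" 0 V] V_nonneg n by simp
  then have "s / t \<le> 1" using main by (intro mult_right_le_imp_le[of "s / t" "\<Sum>i\<in>{0..<n}. V i" 1]) auto
  then show ?thesis using t by simp
qed

section \<open>Comparison of leaf volumes\<close>

context product_leaves
begin

text \<open>\<open>Poisson_vertical\<close> gives the Jacobian of the induced map
  \<open>\<psi>\<close> of \<Lambda>, so \<open>density_expansion\<close> applies with s =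
  \<open>f p\<close> and t = \<open>f p'\<close>. The density is the absolute value of \<nu>,
  because the diffeomorphism may reverse orientation.\<close>

lemma Poisson_leaf_volume:
  assumes "\<Phi> \<in> Poiss M \<pi>" "compact (UNIV :: 'l set)" "connected (UNIV :: 'l set)"
  shows "f p \<le> f (fst (\<Phi> (p, q)))"
proof -
  define p' where "p' = fst (\<Phi> (p, q))"
  define \<psi> where "\<psi> q = snd (\<Phi> (p, q))" for q
  have \<Phi>: "\<Phi> (p, q) = (p', \<psi> q)" for q
    using Poisson_preserves_leaves[OF assms(1,3)] unfolding p'_def \<psi>_def by (metis prod.collapse)
  have sm: "smooth_map M M \<Phi>" and bij: "bij \<Phi>" using assms(1) by (auto simp: Poiss_def Diff_def)
  have "f p \<le> f p'"
  proof (rule density_expansion[OF \<Lambda> assms(2), where \<rho> = "\<lambda>c q. \<bar>\<nu> c q 1 \<i>\<bar>" and \<psi> = \<psi>])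
    show "\<bar>\<nu> c q 1 \<i>\<bar> > 0" if "c \<in> max_atlas \<Lambda>" "q \<in> fst c" for c q
      using volume_form_apply(2)[OF that] by simp
    show "continuous_on (snd c ` fst c) (\<lambda>y. \<bar>\<nu> c (chart_inv c y) 1 \<i>\<bar>)" if c: "c \<in> max_atlas \<Lambda>" for c
    proof -
      have "smooth_on (snd c ` fst c) (\<lambda>y. \<nu> c (chart_inv c y) 1 \<i>)"
        using \<nu> c unfolding volume_form_def is_two_form_def by blast
      then have "(\<lambda>y. \<nu> c (chart_inv c y) 1 \<i>) differentiable (at y)" if "y \<in> snd c ` fst c" for y
        using that unfolding smooth_on_def by (metis empty_subsetI list.set(1) partial_deriv.simps(1))
      then have "continuous_on (snd c ` fst c) (\<lambda>y. \<nu> c (chart_inv c y) 1 \<i>)"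
        by (intro continuous_at_imp_continuous_on ballI differentiable_imp_continuous_within) blast
      then show ?thesis by (rule continuous_on_rabs)
    qed
    show "continuous_on UNIV \<psi>"
      unfolding \<psi>_def using sm
      by (auto simp: smooth_map_def intro!: continuous_intros continuous_on_compose2[of UNIV \<Phi>])
    show "inj \<psi>" using bij \<Phi> by (metis bij_is_inj injD injI prod.inject)
    show "0 < f p'" by (rule f_pos)
    fix d d' q assume d: "d \<in> max_atlas \<Lambda>" "d' \<in> max_atlas \<Lambda>" "q \<in> fst d" "\<psi> q \<in> fst d'"
    obtain c c' where c: "c \<in> max_atlas \<Sigma>" "p \<in> fst c" "c' \<in> max_atlas \<Sigma>" "p' \<in> fst c'"
      using max_atlas_chart_exists[OF \<Sigma>] by metis
    let ?J = "differential (prod_chart c d) (prod_chart c' d') \<Phi> (p, q)"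
    have "\<Phi> (p, q) \<in> fst c' \<times> fst d'" using c d \<Phi> by simp
    from has_derivative_snd[OF local_rep_vertical_derivative[OF sm c(1) d(1) c(2) d(3) c(3) d(2) this]]
    have "(local_rep d d' \<psi> has_derivative (\<lambda>v. snd (?J (0, v)))) (at (snd d q))"
      by (simp add: local_rep_def \<psi>_def o_def)
    moreover have "f p' * \<bar>\<nu> d' (\<psi> q) 1 \<i>\<bar> * \<bar>Im (cnj (snd (?J (0, 1))) * snd (?J (0, \<i>)))\<bar> = f p * \<bar>\<nu> d q 1 \<i>\<bar>"
    proof -
      have "\<bar>f p' * \<nu> d' (\<psi> q) 1 \<i> * Im (cnj (snd (?J (0, 1))) * snd (?J (0, \<i>)))\<bar> = \<bar>f p * \<nu> d q 1 \<i>\<bar>"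
        using Poisson_vertical(2)[OF assms(1) c(1) d(1) c(2) d(3) c(3) d(2) c(4) d(4) \<Phi>] by simp
      then show ?thesis unfolding abs_mult using f_pos[of p] f_pos[of p'] by simp
    qed
    ultimately show "\<exists>L. (local_rep d d' \<psi> has_derivative L) (at (snd d q)) \<and>
        f p' * \<bar>\<nu> d' (\<psi> q) 1 \<i>\<bar> * \<bar>Im (cnj (L 1) * L \<i>)\<bar> = f p * \<bar>\<nu> d q 1 \<i>\<bar>"
      by blast
  qed
  then show ?thesis by (simp add: p'_def)
qed

end

section \<open>Rotating the bumps\<close>

lemma frechet_derivative_real:
  fixes f :: "real \<Rightarrow> real"
  assumes "f differentiable (at x)"
  shows "(f has_field_derivative frechet_derivative f (at x) 1) (at x)"
proof -
  have D: "(f has_derivative frechet_derivative f (at x)) (at x)"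
    using assms by (simp add: frechet_derivative_works)
  have "frechet_derivative f (at x) h = frechet_derivative f (at x) 1 * h" for h
    using linear_cmul[OF has_derivative_linear[OF D], of h 1] by simp
  then have "frechet_derivative f (at x) = (*) (frechet_derivative f (at x) 1)" by (rule ext)
  then show ?thesis using D unfolding has_field_derivative_def by metis
qed

text \<open>Root test: the n-th root of a fixed power of n tends to 1, which leaves the limit
  1/2.\<close>

lemma summable_power_geometric:
  "summable (\<lambda>n. (2 * real n ^ 3) ^ i * (1/2) ^ n)"
proof (rule root_test_convergence)
  have "(\<lambda>n. (root n 2 * root n (real n) ^ 3) ^ i * (1/2)) \<longlonglongrightarrow> (1 * 1 ^ 3) ^ i * (1/2)"
    by (intro tendsto_intros LIMSEQ_root LIMSEQ_root_const) auto
  moreover have "\<forall>\<^sub>F n in sequentially. (root n 2 * root n (real n) ^ 3) ^ i * (1/2) =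
      root n (norm ((2 * real n ^ 3) ^ i * (1/2) ^ n))"
    using eventually_gt_at_top[of 0]
    by eventually_elim (simp add: real_root_mult real_root_power real_root_power_cancel abs_mult power_abs power_mult_distrib)
  ultimately show "(\<lambda>n. root n (norm ((2 * real n ^ 3) ^ i * (1/2) ^ n))) \<longlonglongrightarrow> 1/2"
    using tendsto_cong by fastforce
qed simp

text \<open>Makes the bounds on the angle series uniform over all parameter sequences. It is
  continuous, fixes 0 and 1, and is odd, so that negating the parameters inverts the
  rotation.\<close>

definition clamp_unit :: "real \<Rightarrow> real" where
  "clamp_unit t = max (-1) (min 1 t)"

section \<open>The rotation angle as a function of parameters and squared radius\<close>

locale bump_rotation =
  fixes \<eta> :: "real \<Rightarrow> real"
  assumes cutoff: "cutoff \<eta>"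
begin

definition \<eta>_deriv :: "nat \<Rightarrow> real \<Rightarrow> real" where
  "\<eta>_deriv i = partial_deriv (replicate i 1) \<eta>"

lemma \<eta>_deriv_0 [simp]: "\<eta>_deriv 0 = \<eta>"
  by (simp add: \<eta>_deriv_def)

lemma has_derivative_\<eta>_deriv: "(\<eta>_deriv i has_field_derivative \<eta>_deriv (Suc i) x) (at x)"
proof -
  have "smooth_on UNIV \<eta>" using cutoff by (simp add: cutoff_def)
  then have "\<eta>_deriv i differentiable (at x)" 
    unfolding smooth_on_def \<eta>_deriv_def by (metis Basis_real_def UNIV_I set_replicate_conv_if empty_subsetI order_refl)
  from frechet_derivative_real[OF this] show ?thesis by (simp add: \<eta>_deriv_def)
qed

lemma \<eta>_deriv_outside: "1 < \<bar>x\<bar> \<Longrightarrow> \<eta>_deriv i x = 0"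
proof (induction i arbitrary: x)
  case 0
  then show ?case using cutoff by (simp add: cutoff_def)
next
  case (Suc i)
  have "open {y :: real. 1 < \<bar>y\<bar>}" by (intro open_Collect_less continuous_intros)
  then have "\<forall>\<^sub>F y in nhds x. \<eta>_deriv i y = 0"
    using Suc.prems Suc.IH by (auto simp: eventually_nhds)
  then have "(\<eta>_deriv i has_field_derivative 0) (at x)"
    using DERIV_cong_ev[of x x "\<eta>_deriv i" "\<lambda>_. 0" 0 0] by simp
  then show ?case using has_derivative_\<eta>_deriv DERIV_unique by blast
qed

lemma \<eta>_deriv_bounded: obtains C where "\<And>x. \<bar>\<eta>_deriv i x\<bar> \<le> C"
proof -
  have "continuous_on {-1..1} (\<eta>_deriv i)"
    using has_derivative_\<eta>_deriv by (intro DERIV_continuous_on) (auto intro: has_field_derivative_at_within)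
  then have "bounded (\<eta>_deriv i ` {-1..1})" by (intro compact_imp_bounded compact_continuous_image) auto
  then obtain C where C: "\<And>x. x \<in> {-1..1} \<Longrightarrow> \<bar>\<eta>_deriv i x\<bar> \<le> C" by (force simp: bounded_iff)
  have "C \<ge> 0" using C[of 0] by simp
  then have "\<bar>\<eta>_deriv i x\<bar> \<le> C" for x
    using C[of x] \<eta>_deriv_outside[of x i] by (cases "\<bar>x\<bar> \<le> 1") (auto simp: abs_le_iff)
  then show thesis by (rule that)
qed

text \<open>The parameter \<open>a n\<close> is the number of steps by which the ring of \<open>2 ^ n\<close> bumps around the circle
  of radius \<open>1 / n\<close> is rotated; \<open>t\<close> stands for the square of the distance to the origin, and \<open>i\<close> is
  the order of differentiation.\<close>

definition angle_term :: "nat \<Rightarrow> nat \<Rightarrow> (nat \<Rightarrow> real) \<Rightarrow> real \<Rightarrow> real" where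
  "angle_term i n a t = (if n < 8 then 0 else clamp_unit (a n) * (1/2) ^ n * (2 * real n ^ 3) ^ i
     * \<eta>_deriv i (2 * real n ^ 3 * t - 2 * real n))"

definition angle :: "nat \<Rightarrow> (nat \<Rightarrow> real) \<Rightarrow> real \<Rightarrow> real" where
  "angle i a t = (\<Sum>n. angle_term i n a t)"

text \<open>Each derivative in \<open>t\<close> brings out the inner factor 2 n^3. The remaining
  factor is a derivative of \<eta>, which has compact support and so is bounded by a constant
  depending on \<open>i\<close> alone.\<close>

lemma angle_term_bound:
  obtains C where "\<And>n a t. \<bar>angle_term i n a t\<bar> \<le> (2 * real n ^ 3) ^ i * (1/2) ^ n * C"
proof -
  obtain C where C: "\<And>x. \<bar>\<eta>_deriv i x\<bar> \<le> C" using \<eta>_deriv_bounded[of i] by blast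
  have "C \<ge> 0" using C[of 0] by simp
  have "\<bar>angle_term i n a t\<bar> \<le> (2 * real n ^ 3) ^ i * (1/2) ^ n * C" for n a t
  proof -
    have "\<bar>clamp_unit (a n)\<bar> \<le> 1" by (simp add: clamp_unit_def)
    then have "\<bar>clamp_unit (a n)\<bar> * ((1/2) ^ n * (2 * real n ^ 3) ^ i * \<bar>\<eta>_deriv i (2 * real n ^ 3 * t - 2 * real n)\<bar>)
        \<le> 1 * ((1/2) ^ n * (2 * real n ^ 3) ^ i * C)"
      using C \<open>C \<ge> 0\<close> by (intro mult_mono) auto
    then show ?thesis using \<open>C \<ge> 0\<close> by (simp add: angle_term_def abs_mult power_abs mult_ac)
  qed
  then show thesis by (rule that)
qed

lemma summable_angle_term: "summable (\<lambda>n. angle_term i n a t)"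
proof -
  obtain C where "\<And>n a t. \<bar>angle_term i n a t\<bar> \<le> (2 * real n ^ 3) ^ i * (1/2) ^ n * C"
    using angle_term_bound[of i] by blast
  then show ?thesis
    by (intro summable_comparison_test'[OF summable_mult2[OF summable_power_geometric[of i], of C]]) auto
qed

text \<open>The majorant is independent of both \<open>a\<close> and \<open>t\<close>, so the M-test
  works on the whole product space. Each term reads only one coordinate of \<open>a\<close>, hence
  is continuous in the product topology.\<close>

lemma continuous_angle: "continuous_on UNIV (\<lambda>z. angle i (fst z) (snd z))"
proof -
  obtain C where C: "\<And>n a t. \<bar>angle_term i n a t\<bar> \<le> (2 * real n ^ 3) ^ i * (1/2) ^ n * C"
    using angle_term_bound[of i] by blast
  have "uniform_limit UNIV (\<lambda>N z. \<Sum>n<N. angle_term i n (fst z) (snd z)) (\<lambda>z. \<Sum>n. angle_term i n (fst z) (snd z)) sequentially"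
    by (rule Weierstrass_m_test[OF _ summable_mult2[OF summable_power_geometric[of i], of C]]) (use C in auto)
  moreover have "continuous_on UNIV (\<lambda>z. angle_term i n (fst z) (snd z))" for n
  proof -
    have "continuous_on UNIV (\<eta>_deriv i)"
      using has_derivative_\<eta>_deriv by (intro DERIV_continuous_on) (auto intro: has_field_derivative_at_within)
    then have 1: "continuous_on UNIV (\<lambda>z. \<eta>_deriv i (2 * real n ^ 3 * snd z - 2 * real n))" for z :: "(nat \<Rightarrow> real) \<times> real"
      by (rule continuous_on_compose2) (auto intro!: continuous_intros)
    have 2: "continuous_on UNIV (\<lambda>z. fst z n)" for z :: "(nat \<Rightarrow> real) \<times> real"
      by (rule continuous_on_compose2[OF continuous_on_product_coordinates continuous_on_fst[OF continuous_on_id]]) simp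
    show ?thesis
      unfolding angle_term_def clamp_unit_def by (cases "n < 8") (auto intro!: continuous_intros 1 2)
  qed
  ultimately show ?thesis
    unfolding angle_def by (intro uniform_limit_theorem[where F = sequentially]) (auto intro!: always_eventually continuous_on_sum)
qed

lemma has_derivative_angle: "(angle i a has_field_derivative angle (Suc i) a t) (at t)"
proof -
  obtain C where C: "\<And>n a t. \<bar>angle_term (Suc i) n a t\<bar> \<le> (2 * real n ^ 3) ^ Suc i * (1/2) ^ n * C"
    using angle_term_bound[of "Suc i"] by blast
  show ?thesis
    unfolding angle_def
  proof (rule has_field_derivative_series'(2)[of UNIV "\<lambda>n. angle_term i n a" "\<lambda>n. angle_term (Suc i) n a" t])
    show "(angle_term i n a has_field_derivative angle_term (Suc i) n a x) (at x)" for n x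
      by (cases "n < 8") (auto simp: angle_term_def[abs_def] intro!: derivative_eq_intros
          DERIV_chain2[OF has_derivative_\<eta>_deriv])
    show "uniformly_convergent_on UNIV (\<lambda>N t. \<Sum>n<N. angle_term (Suc i) n a t)"
      by (rule Weierstrass_m_test'[OF _ summable_mult2[OF summable_power_geometric[of "Suc i"], of C]])
        (use C in auto)
  qed (auto intro: summable_angle_term)
qed

lemma tendsto_angle: "((\<lambda>z. angle i (fst z) (snd z)) \<longlongrightarrow> angle i a t) (nhds (a, t))"
proof -
  have "((\<lambda>z. angle i (fst z) (snd z)) \<longlongrightarrow> angle i (fst (a, t)) (snd (a, t))) (at (a, t))"
    using continuous_angle[of i] unfolding continuous_on_def by blast
  then have "((\<lambda>z. angle i (fst z) (snd z)) \<longlongrightarrow> angle i (fst (a, t)) (snd (a, t))) (nhds (a, t))"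
    by (rule iffD1[OF tendsto_at_iff_tendsto_nhds])
  then show ?thesis by simp
qed

text \<open>Differentiating the series of order \<open>i\<close> gives the series of order
  \<open>i + 1\<close>, so the induction treats all \<open>i\<close> at once.\<close>

lemma Ck_at_angle: "Ck_at k (angle i) a t"
proof (induction k arbitrary: i)
  case 0
  then show ?case using tendsto_angle by simp
next
  case (Suc k)
  show ?case
  proof (rule Ck_at_SucI[where D = "\<lambda>a t h. angle (Suc i) a t * h"])
    show "\<forall>\<^sub>F z in nhds (a, t). (angle i (fst z) has_derivative (*) (angle (Suc i) (fst z) (snd z))) (at (snd z))"
      using has_derivative_angle by (simp add: has_field_derivative_def)
  qed (use tendsto_angle Suc in auto)
qed

text \<open>The angle counts full turns. Taking it at the squared modulus avoids the singularity of
  the modulus at the origin.\<close>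

definition rotate :: "(nat \<Rightarrow> real) \<Rightarrow> complex \<Rightarrow> complex" where
  "rotate a z = z * cis (2 * pi * angle 0 a ((cmod z)\<^sup>2))"

lemma Ck_at_cis: "Ck_at k (\<lambda>_ t. c * cis t) p x"
proof (induction k arbitrary: c)
  case 0
  have "(cis \<longlongrightarrow> cis x) (nhds x)"
    unfolding cis.code by (intro tendsto_intros) (auto simp: filterlim_ident)
  then show ?case by (auto intro!: tendsto_mult_left filterlim_compose[OF _ tendsto_snd_nhds])
next
  case (Suc k)
  show ?case
  proof (rule Ck_at_SucI[where D = "\<lambda>_ t h. h *\<^sub>R (c * \<i> * cis t)"])
    show "((\<lambda>z. c * cis (snd z)) \<longlongrightarrow> c * cis x) (nhds (p, x))"
      using Ck_at_tendsto[OF Suc, of c] by simp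
    show "\<forall>\<^sub>F z in nhds (p, x). ((\<lambda>t. c * cis t) has_derivative (\<lambda>h. h *\<^sub>R (c * \<i> * cis (snd z)))) (at (snd z))"
      by (rule always_eventually) (auto intro!: derivative_eq_intros simp: algebra_simps)
  qed (use Suc[of "c * \<i>"] in auto)
qed

lemma Ck_at_rotate: "Ck_at k rotate a z"
proof -
  have 1: "Ck_at k (\<lambda>_ z. z \<bullet> z) a z"
    by (intro bounded_bilinear.Ck_at[OF bounded_bilinear_inner] Ck_at_linear bounded_linear_ident)
  have "Ck_at k (\<lambda>a z. 2 * pi * angle 0 a (z \<bullet> z)) a z"
    by (intro bounded_bilinear.Ck_at[OF bounded_bilinear_mult] Ck_at_const
      Ck_at_compose[where F = "\<lambda>_ z. z \<bullet> z" and G = "angle 0", OF 1 Ck_at_angle])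
  from Ck_at_compose[where F = "\<lambda>a z. 2 * pi * angle 0 a (z \<bullet> z)" and G = "\<lambda>_ t. 1 * cis t", OF this Ck_at_cis]
  have 2: "Ck_at k (\<lambda>a z. cis (2 * pi * angle 0 a (z \<bullet> z))) a z" by simp
  have "Ck_at k (\<lambda>a z. z * cis (2 * pi * angle 0 a (z \<bullet> z))) a z"
    by (intro bounded_bilinear.Ck_at[OF bounded_bilinear_mult] 2 Ck_at_linear bounded_linear_ident)
  then show ?thesis by (simp add: rotate_def[abs_def] dot_square_norm)
qed

lemma norm_rotate [simp]: "cmod (rotate a z) = cmod z"
  by (simp add: rotate_def norm_mult)

lemma angle_uminus: "angle i (\<lambda>n. - a n) t = - angle i a t"
proof -
  have "angle_term i n (\<lambda>n. - a n) t = - angle_term i n a t" for n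
  proof -
    have "clamp_unit (- a n) = - clamp_unit (a n)" by (simp add: clamp_unit_def max_def min_def)
    then show ?thesis by (simp add: angle_term_def)
  qed
  then show ?thesis unfolding angle_def by (simp add: suminf_minus summable_angle_term)
qed

text \<open>Rotation preserves the modulus, so both rotations use the angle at the same radius, with
  opposite signs.\<close>

lemma rotate_inverse [simp]: "rotate (\<lambda>n. - a n) (rotate a z) = z" "rotate a (rotate (\<lambda>n. - a n) z) = z"
  by (simp_all add: rotate_def norm_mult angle_uminus mult.assoc cis_mult)

lemma \<eta>_eq_0: "1 \<le> \<bar>t\<bar> \<Longrightarrow> \<eta> t = 0"
  and \<eta>_pos: "\<bar>t\<bar> < 1 \<Longrightarrow> \<eta> t > 0"
  and \<eta>_eq_1: "\<bar>t\<bar> \<le> 1/2 \<Longrightarrow> \<eta> t = 1"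
  using cutoff by (auto simp: cutoff_def) (metis not_less zero_less_one)

text \<open>For |z| \<ge> 1/2 and n \<ge> 8 the argument of the cutoff is at least n^3/2 - 2n \<ge>
  1. The rotation thus happens well inside the unit disk and can be glued to the identity.\<close>

lemma rotate_outside:
  assumes "cmod z \<ge> 1/2"
  shows "rotate a z = z"
proof -
  have "angle_term 0 n a ((cmod z)\<^sup>2) = 0" for n
  proof (cases "n < 8")
    case False
    have "(1/2)\<^sup>2 \<le> (cmod z)\<^sup>2" using assms by (intro power_mono) auto
    then have "2 * real n ^ 3 * (1/4) \<le> 2 * real n ^ 3 * (cmod z)\<^sup>2"
      by (intro mult_left_mono) (auto simp: power2_eq_square)
    moreover have "1 + 2 * real n \<le> 2 * real n ^ 3 * (1/4)"
    proof -
      have n: "real n \<ge> 8" using False by simp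
      then have "real n * real n \<ge> 8 * 8" by (intro mult_mono) auto
      then have "real n * 64 \<le> real n * (real n * real n)" using n by (intro mult_left_mono) auto
      then have "real n * 64 \<le> real n ^ 3" by (simp add: power3_eq_cube mult.assoc)
      then show ?thesis using n by linarith
    qed
    ultimately have "\<eta> (2 * real n ^ 3 * (cmod z)\<^sup>2 - 2 * real n) = 0" by (intro \<eta>_eq_0) auto
    then show ?thesis by (simp add: angle_term_def)
  qed (simp add: angle_term_def)
  then show ?thesis by (simp add: rotate_def angle_def)
qed

lemma rotate_zero [simp]: "rotate (\<lambda>_. 0) z = z"
proof -
  have "angle_term 0 n (\<lambda>_. 0) t = 0" for n t by (simp add: angle_term_def clamp_unit_def)
  then show ?thesis by (simp add: rotate_def angle_def)
qed

end

section \<open>The bumps\<close>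

text \<open>Distinct integers differ by at least 1, so r is at most |n r - m r|, which the two
  tolerances bound by 3/4 of the inverse of the smaller integer. Then the smaller integer times r is
  at most 3/4, too far from 1. The tolerance for \<open>n\<close> is the width of the cutoff in the
  angle, the tighter one for \<open>m\<close> covers the annulus of a ring of bumps.\<close>

lemma circles_separated:
  assumes "4 \<le> n" "4 \<le> m" and n: "\<bar>real n * r - 1\<bar> \<le> 1 / (2 * real n)" and m: "\<bar>real m * r - 1\<bar> \<le> 1 / (4 * real m)"
  shows "n = m"
proof (rule ccontr)
  assume "n \<noteq> m"
  have pos: "real n \<ge> 4" "real m \<ge> 4" using assms by auto
  have bd: "1 / (2 * real n) \<le> 1/8" "1 / (4 * real m) \<le> 1/16" using pos by (auto simp: field_simps)
  have ge: "real n * r \<ge> 7/8" "real m * r \<ge> 15/16" using n m bd by (auto simp: abs_le_iff)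
  have r: "r > 0"
  proof (rule ccontr)
    assume "\<not> r > 0"
    then have "real n * r \<le> 0" by (intro mult_nonneg_nonpos) auto
    then show False using ge by simp
  qed
  show False
  proof (cases "n < m")
    case True
    then have "1 * r \<le> (real m - real n) * r" using r by (intro mult_right_mono) auto
    also have "\<dots> = real m * r - real n * r" by (simp add: algebra_simps)
    also have "\<dots> \<le> 1 / (4 * real m) + 1 / (2 * real n)" using n m by linarith
    also have "1 / (4 * real m) \<le> 1 / (4 * real n)" using True pos by (intro divide_left_mono) auto
    finally have "r \<le> 3 / (4 * real n)" by (simp add: field_simps)
    then have "real n * r \<le> 3/4" using pos by (simp add: field_simps)
    then show False using ge by simp
  next
    case False
    then have "1 * r \<le> (real n - real m) * r" using r \<open>n \<noteq> m\<close> by (intro mult_right_mono) auto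
    also have "\<dots> = real n * r - real m * r" by (simp add: algebra_simps)
    also have "\<dots> \<le> 1 / (4 * real m) + 1 / (2 * real n)" using n m by linarith
    also have "1 / (2 * real n) \<le> 1 / (2 * real m)" using False pos by (intro divide_left_mono) auto
    finally have "r \<le> 3 / (4 * real m)" by (simp add: field_simps)
    then have "real m * r \<le> 3/4" using pos by (simp add: field_simps)
    then show False using ge by simp
  qed
qed

lemma four_times_le_power: "4 \<le> n \<Longrightarrow> 4 * n \<le> 2 ^ n"
  by (induction n rule: dec_induct) auto

lemma sixteen_times_le_power: "8 \<le> n \<Longrightarrow> 16 * n \<le> 2 ^ n"
  by (induction n rule: dec_induct) auto

lemma half_power_le_inverse: "4 \<le> n \<Longrightarrow> (1/2) ^ n \<le> 1 / (4 * real n)"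
  using of_nat_mono[OF four_times_le_power[of n], where 'a = real] by (simp add: field_simps)

lemma half_power_le_inverse': "8 \<le> n \<Longrightarrow> (1/2) ^ n \<le> 1 / (16 * real n)"
  using of_nat_mono[OF sixteen_times_le_power[of n], where 'a = real] by (simp add: field_simps)

text \<open>The derivative cos is at least 1/2 up to 1, because 1 \<le> \<pi>/3.\<close>

lemma sin_ge_half:
  fixes x :: real
  assumes "0 \<le> x" "x \<le> 1"
  shows "x / 2 \<le> sin x"
proof -
  have "(\<lambda>x. sin x - x / 2) 0 \<le> (\<lambda>x. sin x - x / 2) x"
  proof (rule DERIV_nonneg_imp_nondecreasing[where f = "\<lambda>x. sin x - x / 2", OF assms(1)])
    fix y assume y: "0 \<le> y" "y \<le> x"
    have "cos (pi / 3) \<le> cos y" using y assms pi_gt3 by (intro cos_monotone_0_pi_le) auto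
    then have "0 \<le> cos y - 1/2" by (simp add: cos_60)
    moreover have "((\<lambda>x. sin x - x / 2) has_real_derivative cos y - 1/2) (at y)"
      by (auto intro!: derivative_eq_intros)
    ultimately show "\<exists>D. ((\<lambda>x. sin x - x / 2) has_real_derivative D) (at y) \<and> 0 \<le> D" by blast
  qed
  then show ?thesis by simp
qed

text \<open>By the symmetry of sin about \<pi>/2 only 2k \<le> N matters. There either the angle is
  at most 1 and half of it, being at least \<pi>/(2N), already exceeds 1/N, or sin is at least sin 1
  \<ge> 1/2.\<close>

lemma sin_multiple_ge:
  assumes "1 \<le> k" "k < N"
  shows "1 / real N \<le> sin (pi * real k / real N)"
proof -
  have *: "1 / real N \<le> sin (pi * real j / real N)" if "1 \<le> j" "2 * j \<le> N" for j
  proof -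
    let ?x = "pi * real j / real N"
    have x: "0 \<le> ?x" "?x \<le> pi / 2" using that by (auto simp: field_simps)
    show ?thesis
    proof (cases "?x \<le> 1")
      case True
      have "2 * 1 \<le> pi * real j" using that pi_gt3 by (intro mult_mono) auto
      then have "1 / real N \<le> ?x / 2" using that by (simp add: field_simps)
      then show ?thesis using sin_ge_half[OF x(1) True] by linarith
    next
      case False
      have "1/2 \<le> sin (1 :: real)" using sin_ge_half[of 1] by simp
      also have "\<dots> \<le> sin ?x" using False x pi_gt3 by (intro sin_monotone_2pi_le) linarith+
      finally have "1/2 \<le> sin ?x" .
      moreover have "1 / real N \<le> 1/2" using that by (simp add: field_simps)
      ultimately show ?thesis by linarith
    qed
  qed
  show ?thesis
  proof (cases "2 * k \<le> N")
    case False
    have "sin (pi * real (N - k) / real N) = sin (pi - pi * real k / real N)"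
      using assms by (simp add: of_nat_diff field_simps)
    then show ?thesis using *[of "N - k"] False assms by simp
  qed (use * assms in auto)
qed

section \<open>Positions of the bumps\<close>

lemma bump_point_cis: "bump_point n s = of_real (1 / real n) * cis (2 * pi * real s / 2 ^ n)"
  by (simp add: bump_point_def cis_conv_exp mult.commute)

lemma bump_point_Suc: "bump_point n (Suc s) = bump_point n s * cis (2 * pi / 2 ^ n)"
  by (simp add: bump_point_cis cis_mult mult.assoc add_divide_distrib algebra_simps)

lemma bump_point_periodic: "bump_point n (2 ^ n) = bump_point n 0"
  by (simp add: bump_point_cis)

lemma norm_bump_point: "cmod (bump_point n s) = 1 / real n"
  by (simp add: bump_point_cis norm_mult norm_divide)

lemma bump_radius_pos: "n > 0 \<Longrightarrow> bump_radius n > 0"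
  by (simp add: bump_radius_def)

text \<open>The chord between points k steps apart is (2/n) |sin(\<pi> k / 2^n)|. The bound is twice
  the radius, so the open disks of one ring are disjoint.\<close>

lemma dist_bump_point:
  assumes "s < s'" "s' < s + 2 ^ n" "n > 0"
  shows "2 * bump_radius n \<le> cmod (bump_point n s' - bump_point n s)"
proof -
  define k where "k = s' - s"
  have k: "1 \<le> k" "k < 2 ^ n" and s': "s' = s + k" using assms by (auto simp: k_def)
  have "bump_point n s' - bump_point n s = bump_point n s * (cis (2 * pi * real k / 2 ^ n) - 1)"
  proof -
    have "2 * pi * real s' / 2 ^ n = 2 * pi * real s / 2 ^ n + 2 * pi * real k / 2 ^ n"
      by (simp add: s' algebra_simps add_divide_distrib)
    then show ?thesis by (simp only: bump_point_cis flip: cis_mult) (simp add: right_diff_distrib)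
  qed
  then have "cmod (bump_point n s' - bump_point n s) = 1 / real n * cmod (cis (2 * pi * real k / 2 ^ n) - 1)"
    by (simp only: norm_mult norm_bump_point)
  also have "cmod (cis (2 * pi * real k / 2 ^ n) - 1) = 2 * \<bar>sin (pi * real k / 2 ^ n)\<bar>"
    using dist_exp_i_1[of "2 * pi * real k / 2 ^ n"] by (simp add: cis_conv_exp)
  finally have "cmod (bump_point n s' - bump_point n s) = 2 / real n * \<bar>sin (pi * real k / 2 ^ n)\<bar>" by simp
  moreover have "1 / 2 ^ n \<le> \<bar>sin (pi * real k / 2 ^ n)\<bar>"
    using sin_multiple_ge[OF k] by simp
  then have "2 / real n * (1 / 2 ^ n) \<le> 2 / real n * \<bar>sin (pi * real k / 2 ^ n)\<bar>"
    by (intro mult_left_mono) auto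
  ultimately show ?thesis by (simp add: bump_radius_def)
qed

text \<open>The annulus of half-width \<open>bump_radius n\<close> around the circle of radius 1/n,
  with the inequality multiplied by n. It contains every bump of ring n.\<close>

definition near_circle :: "nat \<Rightarrow> complex \<Rightarrow> bool" where
  "near_circle n z \<longleftrightarrow> \<bar>real n * cmod z - 1\<bar> \<le> (1/2) ^ n"

lemma near_circleI:
  assumes "4 \<le> n" "cmod (z - bump_point n s) \<le> bump_radius n"
  shows "near_circle n z"
proof -
  have "\<bar>cmod z - 1 / real n\<bar> \<le> bump_radius n"
    using norm_triangle_ineq3[of z "bump_point n s"] assms(2) by (simp add: norm_bump_point)
  then have "real n * \<bar>cmod z - 1 / real n\<bar> \<le> real n * bump_radius n" by (intro mult_left_mono) auto
  moreover have "real n * \<bar>cmod z - 1 / real n\<bar> = \<bar>real n * (cmod z - 1 / real n)\<bar>" by (simp add: abs_mult)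
  ultimately show ?thesis using assms(1) by (simp add: near_circle_def bump_radius_def field_simps)
qed

lemma near_circle_unique:
  assumes "4 \<le> n" "4 \<le> m" "near_circle n z" "near_circle m z"
  shows "n = m"
proof (rule circles_separated[OF assms(1,2)])
  have "1 / (4 * real n) \<le> 1 / (2 * real n)" using assms(1) by (simp add: field_simps)
  then show "\<bar>real n * cmod z - 1\<bar> \<le> 1 / (2 * real n)"
    using half_power_le_inverse[OF assms(1)] assms(3) by (simp add: near_circle_def)
  show "\<bar>real m * cmod z - 1\<bar> \<le> 1 / (4 * real m)"
    using half_power_le_inverse[OF assms(2)] assms(4) by (simp add: near_circle_def)
qed

section \<open>The bump function and its invariance under rotation\<close>

context bump_rotation
begin

lemma bump_eq_0:
  assumes "4 \<le> n" "\<not> cmod (z - bump_point n s) < bump_radius n"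
  shows "\<eta> (cmod (z - bump_point n s) / bump_radius n) = 0"
  using assms bump_radius_pos[of n] by (intro \<eta>_eq_0) (simp add: field_simps)

lemma bump_nonneg: "0 \<le> \<eta> t"
  using cutoff unfolding cutoff_def by (metis atLeastAtMost_iff rangeI subsetD)

lemma u_local_near_circle:
  assumes "4 \<le> m" "near_circle m z"
  shows "u_local \<eta> z = 1 / fact m * (\<Sum>s=1..2^m. \<eta> (cmod (z - bump_point m s) / bump_radius m))"
proof -
  let ?F = "\<lambda>n. 1 / fact n * (\<Sum>s=1..2^n. \<eta> (cmod (z - bump_point n s) / bump_radius n))"
  have "?F n = 0" if n: "n \<in> {4..} - {m}" for n
  proof -
    have "\<not> cmod (z - bump_point n s) < bump_radius n" for s
      using near_circleI[of n z s] near_circle_unique[OF _ assms(1) _ assms(2), of n] n by auto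
    then show ?thesis using bump_eq_0[of n z] n by simp
  qed
  then have "infsum ?F {4..} = infsum ?F {m}"
    using assms(1) by (intro infsum_cong_neutral) auto
  then show ?thesis by (simp add: u_local_def)
qed

lemma u_local_pos:
  assumes "4 \<le> m" "s \<in> {1..2^m}" "cmod (z - bump_point m s) < bump_radius m"
  shows "u_local \<eta> z > 0"
proof -
  have near: "near_circle m z" using near_circleI[OF assms(1), of z s] assms(3) by simp
  have "\<eta> (cmod (z - bump_point m s) / bump_radius m) > 0"
    using assms(3) bump_radius_pos[of m] assms(1) by (intro \<eta>_pos) (simp add: field_simps)
  then have "(\<Sum>s=1..2^m. \<eta> (cmod (z - bump_point m s) / bump_radius m)) > 0"
    using assms(2) by (intro sum_pos2[of _ s]) (auto simp: bump_nonneg)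
  then show ?thesis by (simp add: u_local_near_circle[OF assms(1) near])
qed

lemma u_local_nonzeroD:
  assumes "u_local \<eta> z \<noteq> 0"
  obtains m s where "4 \<le> m" "s \<in> {1..2^m}" "cmod (z - bump_point m s) < bump_radius m"
proof -
  have "\<exists>m s. 4 \<le> m \<and> s \<in> {1..2^m} \<and> cmod (z - bump_point m s) < bump_radius m"
  proof (rule ccontr)
    assume *: "\<not> ?thesis"
    have "\<eta> (cmod (z - bump_point m s) / bump_radius m) = 0" if "4 \<le> m" "s \<in> {1..2^m}" for m s
      using that * by (intro bump_eq_0) auto
    then have "u_local \<eta> z = 0" unfolding u_local_def by (intro infsum_0) auto
    then show False using assms by simp
  qed
  then show thesis using that by blast
qed

lemma u_local_nonneg: "u_local \<eta> z \<ge> 0"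
  using u_local_pos u_local_nonzeroD by (metis less_eq_real_def)

text \<open>The cutoff argument factors as 2n (n r - 1)(n r + 1), which vanishes on the circle of
  ring n. Where its modulus is below 1, |n r - 1| \<le> 1/(2n), and \<open>circles_separated\<close>
  excludes all n except \<open>m\<close>. For \<open>m\<close> itself, 16 m \<le> 2^m bounds it by
  2m * 1/(16m) * 3 = 3/8, inside the plateau where \<eta> is 1. This estimate is the source of the
  threshold 8 in \<open>angle_term\<close>.\<close>

lemma angle_near_circle:
  assumes "4 \<le> m" "near_circle m z"
  shows "angle 0 a ((cmod z)\<^sup>2) = (if m < 8 then 0 else clamp_unit (a m) * (1/2) ^ m)"
proof -
  define r where "r = cmod z"
  have r: "r \<ge> 0" by (simp add: r_def)
  have factor: "2 * real n ^ 3 * r\<^sup>2 - 2 * real n = 2 * real n * ((real n * r - 1) * (real n * r + 1))" for n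
    by (simp add: power2_eq_square power3_eq_cube algebra_simps)
  have "angle_term 0 n a (r\<^sup>2) = 0" if "n \<noteq> m" for n
  proof (cases "n < 8")
    case False
    have "\<not> \<bar>2 * real n ^ 3 * r\<^sup>2 - 2 * real n\<bar> < 1"
    proof
      assume "\<bar>2 * real n ^ 3 * r\<^sup>2 - 2 * real n\<bar> < 1"
      then have *: "2 * real n * (\<bar>real n * r - 1\<bar> * (real n * r + 1)) < 1"
        unfolding factor using r by (simp add: abs_mult)
      have "\<bar>real n * r - 1\<bar> * 1 \<le> \<bar>real n * r - 1\<bar> * (real n * r + 1)" using r by (intro mult_left_mono) auto
      then have "2 * real n * \<bar>real n * r - 1\<bar> \<le> 2 * real n * (\<bar>real n * r - 1\<bar> * (real n * r + 1))"
        by (intro mult_left_mono) auto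
      then have "\<bar>real n * r - 1\<bar> \<le> 1 / (2 * real n)" using * False by (simp add: field_simps)
      moreover have "\<bar>real m * r - 1\<bar> \<le> 1 / (4 * real m)"
        using assms half_power_le_inverse[OF assms(1)] by (simp add: near_circle_def r_def)
      ultimately show False using circles_separated[of n m r] False assms(1) that by simp
    qed
    then show ?thesis using \<eta>_eq_0 by (simp add: angle_term_def)
  qed (simp add: angle_term_def)
  then have "angle 0 a (r\<^sup>2) = angle_term 0 m a (r\<^sup>2)"
    unfolding angle_def using suminf_finite[of "{m}" "\<lambda>n. angle_term 0 n a (r\<^sup>2)"] by simp
  moreover have "angle_term 0 m a (r\<^sup>2) = clamp_unit (a m) * (1/2) ^ m" if m: "\<not> m < 8"
  proof -
    have d: "\<bar>real m * r - 1\<bar> \<le> 1 / (16 * real m)"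
      using assms half_power_le_inverse'[of m] m by (simp add: near_circle_def r_def)
    moreover have "1 / (16 * real m) \<le> 1" using m by (simp add: field_simps)
    ultimately have "real m * r + 1 \<le> 3" by linarith
    then have "2 * real m * (\<bar>real m * r - 1\<bar> * (real m * r + 1)) \<le> 2 * real m * (1 / (16 * real m) * 3)"
      using d r by (intro mult_left_mono mult_mono) auto
    also have "\<dots> \<le> 1/2" using m by simp
    finally have "\<bar>2 * real m ^ 3 * r\<^sup>2 - 2 * real m\<bar> \<le> 1/2"
      unfolding factor using r by (simp add: abs_mult)
    then show ?thesis using m \<eta>_eq_1 by (simp add: angle_term_def)
  qed
  ultimately show ?thesis by (auto simp: r_def angle_term_def)
qed

lemma rotate_near_circle:
  assumes "8 \<le> m" "near_circle m z" "a m = 0 \<or> a m = 1"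
  shows "rotate a z = (if a m = 1 then z * cis (2 * pi / 2 ^ m) else z)"
proof -
  have "angle 0 a ((cmod z)\<^sup>2) = clamp_unit (a m) * (1/2) ^ m"
    using angle_near_circle[of m z a] assms(1,2) by simp
  moreover have "clamp_unit (a m) = a m" using assms(3) by (auto simp: clamp_unit_def)
  ultimately show ?thesis using assms(3) by (auto simp: rotate_def power_one_over)
qed

text \<open>On an annulus the rotation is either trivial or one step, and one step permutes the
  bumps of the ring cyclically. Off all annuli the function vanishes, and being off them depends on
  the modulus alone.\<close>

lemma u_local_rotate:
  assumes "\<And>n. a n = 0 \<or> a n = 1"
  shows "u_local \<eta> (rotate a z) = u_local \<eta> z"
proof (cases "\<exists>m\<ge>4. near_circle m z")
  case True
  then obtain m where m: "4 \<le> m" "near_circle m z" by blast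
  show ?thesis
  proof (cases "8 \<le> m \<and> a m = 1")
    case True
    let ?h = "\<lambda>s. \<eta> (cmod (z - bump_point m s) / bump_radius m)"
    have rot: "rotate a z = z * cis (2 * pi / 2 ^ m)" using rotate_near_circle[OF _ m(2)] True by simp
    have "near_circle m (rotate a z)" using m(2) by (simp add: near_circle_def)
    then have "u_local \<eta> (rotate a z) = 1 / fact m * (\<Sum>s=1..2^m. \<eta> (cmod (rotate a z - bump_point m s) / bump_radius m))"
      using u_local_near_circle m(1) by simp
    also have "(\<Sum>s=1..2^m. \<eta> (cmod (rotate a z - bump_point m s) / bump_radius m)) = (\<Sum>s=0..<2^m. ?h s)"
    proof (rule sum.reindex_bij_witness[where i = Suc and j = "\<lambda>s. s - 1"])
      fix s :: nat assume "s \<in> {1..2^m}"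
      then obtain s' where s: "s = Suc s'" by (cases s) auto
      have "rotate a z - bump_point m s = (z - bump_point m s') * cis (2 * pi / 2 ^ m)"
        unfolding rot s bump_point_Suc by (simp add: algebra_simps)
      then have "cmod (rotate a z - bump_point m s) = cmod (z - bump_point m s')"
        by (simp only: norm_mult norm_cis mult_1_right)
      then show "?h (s - 1) = \<eta> (cmod (rotate a z - bump_point m s) / bump_radius m)" by (simp add: s)
    qed auto
    \<comment> \<open>The shift produces the index 0 in place of 2^m; both name the same
      bump.\<close>
    also have "\<dots> = ?h 0 + (\<Sum>s=1..<2^m. ?h s)" by (simp add: sum.atLeast_Suc_lessThan)
    also have "\<dots> = (\<Sum>s=1..<2^m. ?h s) + ?h (2^m)" by (simp add: bump_point_periodic)
    also have "\<dots> = (\<Sum>s=1..2^m. ?h s)" by (simp add: sum.last_plus add.commute)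
    also have "1 / fact m * \<dots> = u_local \<eta> z" using u_local_near_circle[OF m] by simp
    finally show ?thesis .
  next
    case False
    then have "rotate a z = z"
      using rotate_near_circle[OF _ m(2), of a] assms[of m] angle_near_circle[OF m, of a]
      by (cases "8 \<le> m") (auto simp: rotate_def)
    then show ?thesis by simp
  qed
next
  case False
  have "u_local \<eta> w = 0" if "cmod w = cmod z" for w
  proof (rule ccontr)
    assume "u_local \<eta> w \<noteq> 0"
    then obtain m s where "4 \<le> m" "cmod (w - bump_point m s) < bump_radius m" by (rule u_local_nonzeroD)
    then have "near_circle m w" using near_circleI[of m w s] by simp
    then show False using False \<open>4 \<le> m\<close> that by (simp add: near_circle_def)
  qed
  from this[of z] this[of "rotate a z"] show ?thesis by simp
qed

text \<open>No other bump meets the boundary of the disk around \<open>bump_point n s\<close>.\<close>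

lemma connected_subset_bump:
  assumes "4 \<le> n" "s \<in> {1..2^n}" "connected S" "\<And>z. z \<in> S \<Longrightarrow> u_local \<eta> z > 0" "bump_point n s \<in> S"
  shows "S \<subseteq> ball (bump_point n s) (bump_radius n)"
proof (rule ccontr)
  assume "\<not> S \<subseteq> ball (bump_point n s) (bump_radius n)"
  moreover have "bump_point n s \<in> S \<inter> ball (bump_point n s) (bump_radius n)"
    using assms bump_radius_pos[of n] by simp
  ultimately have "S \<inter> frontier (ball (bump_point n s) (bump_radius n)) \<noteq> {}"
    by (intro connected_Int_frontier[OF assms(3)]) auto
  then obtain z where z: "z \<in> S" "cmod (z - bump_point n s) = bump_radius n"
    using bump_radius_pos[of n] assms(1) by (auto simp: dist_norm norm_minus_commute)
  have "u_local \<eta> z \<noteq> 0" using assms(4)[OF z(1)] by simp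
  then obtain m s' where m: "4 \<le> m" "s' \<in> {1..2^m}" "cmod (z - bump_point m s') < bump_radius m"
    by (rule u_local_nonzeroD)
  have "n = m"
    using near_circle_unique[OF assms(1) m(1)] near_circleI[OF assms(1), of z s] near_circleI[OF m(1), of z s'] z m by simp
  have "s \<noteq> s'" using z(2) m(3) \<open>n = m\<close> by auto
  then have "2 * bump_radius n \<le> cmod (bump_point n s' - bump_point n s)"
    using dist_bump_point[of s s' n] dist_bump_point[of s' s n] assms(1,2) m(2) \<open>n = m\<close>
    by (cases "s < s'") (auto simp: norm_minus_commute)
  moreover have "cmod (bump_point n s' - bump_point n s) \<le> cmod (z - bump_point n s) + cmod (z - bump_point n s')"
    using norm_triangle_ineq4[of "z - bump_point n s" "z - bump_point n s'"] by simp
  ultimately show False using z(2) m(3) \<open>n = m\<close> by simp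
qed

end

section \<open>Twisting the surface\<close>

lemma smooth_family_at_cong:
  assumes "\<forall>\<^sub>F z in nhds (p, m). G (fst z) (snd z) = H (fst z) (snd z)" and "smooth_family_at A B G p m"
  shows "smooth_family_at A B H p m"
proof -
  obtain c d where c: "c \<in> max_atlas A" "d \<in> max_atlas B" "m \<in> fst c" "G p m \<in> fst d"
    and k: "\<And>k. Ck_at k (\<lambda>q. local_rep c d (G q)) p (snd c m)"
    and lim: "((\<lambda>z. G (fst z) (snd z)) \<longlongrightarrow> G p m) (nhds (p, m))"
    using assms(2) by (auto simp: smooth_family_at_def)
  have eq: "G p m = H p m" using eventually_nhds_x_imp_x[OF assms(1)] by simp
  note ch = max_atlas_is_chart[OF c(1)]
  have "((\<lambda>z. (fst z, chart_inv c (snd z))) \<longlongrightarrow> (p, m)) (nhds (p, snd c m))"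
    by (intro tendsto_Pair tendsto_fst_nhds filterlim_compose[OF tendsto_chart_inv tendsto_snd_nhds] ch c)
  from eventually_compose_filterlim[OF assms(1) this]
  have "\<forall>\<^sub>F z in nhds (p, snd c m). local_rep c d (G (fst z)) (snd z) = local_rep c d (H (fst z)) (snd z)"
    by eventually_elim (simp add: local_rep_def)
  from Ck_at_cong[OF this k] have "\<And>k. Ck_at k (\<lambda>q. local_rep c d (H q)) p (snd c m)" .
  moreover have "((\<lambda>z. H (fst z) (snd z)) \<longlongrightarrow> H p m) (nhds (p, m))"
    using lim tendsto_cong[OF assms(1)] eq by simp
  ultimately show ?thesis using c eq unfolding smooth_family_at_def by auto
qed

lemma smooth_family_at_product:
  assumes "smooth_atlas A" "smooth_atlas B" "smooth_family_at A A H p m"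
  shows "smooth_family_at (product_atlas A B) (product_atlas A B) (\<lambda>q. map_prod (H q) id) p (m, n)"
proof -
  obtain c d where c: "c \<in> max_atlas A" "d \<in> max_atlas A" "m \<in> fst c" "H p m \<in> fst d"
    and k: "\<And>k. Ck_at k (\<lambda>q. local_rep c d (H q)) p (snd c m)"
    and lim: "((\<lambda>z. H (fst z) (snd z)) \<longlongrightarrow> H p m) (nhds (p, m))"
    using assms(3) by (auto simp: smooth_family_at_def)
  obtain e where e: "e \<in> max_atlas B" "n \<in> fst e" using max_atlas_chart_exists[OF assms(2)] by metis
  note ch = max_atlas_is_chart[OF c(1)] max_atlas_is_chart[OF e(1)]
  let ?C = "prod_chart c e" and ?D = "prod_chart d e"
  have "Ck_at k (\<lambda>q. local_rep ?C ?D (map_prod (H q) id)) p (snd ?C (m, n))" for k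
  proof (rule Ck_at_cong)
    have 1: "Ck_at k (\<lambda>q y. local_rep c d (H q) (fst y)) p (snd c m, snd e n)"
      by (rule Ck_at_compose[where F = "\<lambda>_. fst" and G = "\<lambda>q. local_rep c d (H q)", OF Ck_at_linear[OF bounded_linear_fst]])
        (simp add: k)
    have 2: "Ck_at k (\<lambda>_ y. (snd e \<circ> chart_inv e) (snd y)) p (snd c m, snd e n)"
      by (rule Ck_at_compose[where F = "\<lambda>_. snd" and G = "\<lambda>_. snd e \<circ> chart_inv e", OF Ck_at_linear[OF bounded_linear_snd]])
        (use transition_smooth[OF assms(2) e(1,1,2,2)] in simp)
    show "Ck_at k (\<lambda>q y. (local_rep c d (H q) (fst y), (snd e \<circ> chart_inv e) (snd y))) p (snd ?C (m, n))"
      using Ck_at_Pair[OF 1 2] by simp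
    show "\<forall>\<^sub>F z in nhds (p, snd ?C (m, n)). (local_rep c d (H (fst z)) (fst (snd z)), (snd e \<circ> chart_inv e) (snd (snd z))) =
        local_rep ?C ?D (map_prod (H (fst z)) id) (snd z)"
      using eventually_compose_filterlim[OF eventually_chart_inv_prod[OF ch c(3) e(2)] tendsto_snd_nhds[of "(snd c m, snd e n)" p]]
      by (auto simp: local_rep_def elim!: eventually_mono)
  qed
  moreover have "((\<lambda>z. map_prod (H (fst z)) id (snd z)) \<longlongrightarrow> map_prod (H p) id (m, n)) (nhds (p, (m, n)))"
  proof -
    have 1: "((\<lambda>z. fst (snd z)) \<longlongrightarrow> m) (nhds (p, (m, n)))" and 2: "((\<lambda>z. snd (snd z)) \<longlongrightarrow> n) (nhds (p, (m, n)))"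
      by (rule filterlim_compose[OF tendsto_fst_nhds tendsto_snd_nhds], rule filterlim_compose[OF tendsto_snd_nhds tendsto_snd_nhds])
    have "((\<lambda>z. H (fst z) (fst (snd z))) \<longlongrightarrow> H p m) (nhds (p, (m, n)))"
      using filterlim_compose[OF lim tendsto_Pair[OF tendsto_fst_nhds 1]] by simp
    from tendsto_Pair[OF this 2] show ?thesis by (simp add: map_prod_def case_prod_unfold)
  qed
  ultimately show ?thesis
    using prod_chart_max_atlas[OF assms(1,2) c(1) e(1)] prod_chart_max_atlas[OF assms(1,2) c(2) e(1)] c e
    unfolding smooth_family_at_def by (intro conjI bexI[of _ ?C] bexI[of _ ?D]) auto
qed

lemma uncountable_Pow_infinite:
  fixes I :: "'i::countable set"
  assumes "infinite I"
  shows "uncountable (Pow I)"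
proof
  assume c: "countable (Pow I)"
  have "to_nat_on I ` I = UNIV"
    using to_nat_on_infinite[OF countableI_type assms] by (simp add: bij_betw_def)
  moreover have "range (from_nat_into (Pow I)) = Pow I"
    using c by (intro range_from_nat_into) auto
  ultimately have "(from_nat_into (Pow I) \<circ> to_nat_on I) ` I = Pow I" by (metis image_comp)
  then show False using Cantors_theorem[of I] by blast
qed

section \<open>Twist diffeomorphisms of the product\<close>

locale bump_surface = product_leaves \<Sigma> \<Lambda> \<nu> "f_fun \<eta> B x" \<pi> + bump_rotation \<eta>
  for \<Sigma> :: "('s::{t2_space, second_countable_topology}, complex) chart set"
    and \<Lambda> :: "('l::{t2_space, second_countable_topology}, complex) chart set"
    and \<nu> :: "('l, complex) two_form"
    and \<eta> :: "real \<Rightarrow> real" and B :: "'s set" and x :: "'s \<Rightarrow> complex"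
    and \<pi> :: "('s \<times> 'l, complex \<times> complex) bivector" +
  fixes U :: "'s set"
  assumes chart: "(U, x) \<in> max_atlas \<Sigma>" and BU: "B \<subseteq> U" and xB: "x ` B = cball 0 1"
    and compact_\<Lambda>: "compact (UNIV :: 'l set)" and connected_\<Lambda>: "connected (UNIV :: 'l set)"
begin

abbreviation "x_inv \<equiv> chart_inv (U, x)"

lemmas is_chart_x = max_atlas_is_chart[OF chart]

lemma x_inv_x [simp]: "p \<in> U \<Longrightarrow> x_inv (x p) = p"
  using chart_inv_left[OF is_chart_x] by simp

lemma B_iff: "p \<in> B \<longleftrightarrow> p \<in> U \<and> cmod (x p) \<le> 1"
proof
  assume "p \<in> U \<and> cmod (x p) \<le> 1"
  then have "x p \<in> x ` B" unfolding xB by simp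
  then obtain b where "b \<in> B" "x p = x b" by auto
  then show "p \<in> B" using \<open>p \<in> U \<and> _\<close> BU x_inv_x by (metis subsetD)
qed (use BU xB in auto)

lemma x_inv_in_B: 
  assumes "cmod z \<le> 1"
  shows "x_inv z \<in> B" "x (x_inv z) = z"
proof -
  have "z \<in> x ` B" unfolding xB using assms by simp
  then obtain b where "b \<in> B" "z = x b" by auto
  then show "x_inv z \<in> B" "x (x_inv z) = z" using BU by auto
qed

definition twist :: "(nat \<Rightarrow> real) \<Rightarrow> 's \<Rightarrow> 's" where
  "twist a p = (if p \<in> B then x_inv (rotate a (x p)) else p)"

lemma twist_in_B: "p \<in> B \<Longrightarrow> twist a p \<in> B" "p \<in> B \<Longrightarrow> x (twist a p) = rotate a (x p)"
  using x_inv_in_B[of "rotate a (x p)"] by (simp_all add: twist_def B_iff)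

lemma twist_inverse [simp]: "twist (\<lambda>n. - a n) (twist a p) = p" "twist a (twist (\<lambda>n. - a n) p) = p"
proof -
  have "twist b (twist a p) = p" if "\<And>z. rotate b (rotate a z) = z" for a b p
  proof (cases "p \<in> B")
    case True
    then show ?thesis using twist_in_B[OF True, of a] that BU by (auto simp: twist_def[of b])
  qed (simp add: twist_def)
  then show "twist (\<lambda>n. - a n) (twist a p) = p" "twist a (twist (\<lambda>n. - a n) p) = p" by simp_all
qed

text \<open>In the open unit disk of the chart the twist is the rotation. Any other point, on the
  boundary of \<open>B\<close> or even outside \<open>U\<close>, avoids \<open>?K\<close>, the
  preimage of the disk of radius 1/2. This set is compact, hence closed in the Hausdorff surface,
  and off it all twists are the identity.\<close>

lemma smooth_family_twist: "smooth_family_at \<Sigma> \<Sigma> twist a p"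
proof (cases "p \<in> U \<and> cmod (x p) < 1")
  case True
  have pB: "p \<in> B" using True by (simp add: B_iff)
  have tB: "twist a p \<in> U" using twist_in_B[OF pB] BU by auto
  have rep: "\<forall>\<^sub>F z in nhds (a, x p). rotate (fst z) (snd z) = local_rep (U, x) (U, x) (twist (fst z)) (snd z)"
  proof -
    have "\<forall>\<^sub>F z in nhds (a, x p). snd z \<in> ball 0 1"
      by (rule topological_tendstoD[OF tendsto_snd_nhds]) (use True in auto)
    then show ?thesis
      by eventually_elim (simp add: local_rep_def x_inv_in_B twist_in_B)
  qed
  have "((\<lambda>z. twist (fst z) (snd z)) \<longlongrightarrow> twist a p) (nhds (a, p))"
  proof -
    have x: "((\<lambda>z. x (snd z)) \<longlongrightarrow> x p) (nhds (a, p))"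
      using filterlim_compose[OF tendsto_chart[OF is_chart_x, of p] tendsto_snd_nhds] True by simp
    have "((\<lambda>z. rotate (fst z) (x (snd z))) \<longlongrightarrow> rotate a (x p)) (nhds (a, p))"
      using filterlim_compose[OF Ck_at_tendsto[OF Ck_at_rotate] tendsto_Pair[OF tendsto_fst_nhds x]] by simp
    moreover have "(x_inv \<longlongrightarrow> twist a p) (nhds (rotate a (x p)))"
      using tendsto_chart_inv[OF is_chart_x, of "twist a p"] tB twist_in_B(2)[OF pB] by simp
    ultimately have "((\<lambda>z. x_inv (rotate (fst z) (x (snd z)))) \<longlongrightarrow> twist a p) (nhds (a, p))"
      by (rule filterlim_compose[rotated])
    moreover have "\<forall>\<^sub>F z in nhds (a, p). x_inv (rotate (fst z) (x (snd z))) = twist (fst z) (snd z)"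
    proof -
      have "\<forall>\<^sub>F z in nhds (a, p). snd z \<in> U"
        by (rule topological_tendstoD[OF tendsto_snd_nhds]) (use True open_chart_domain[OF is_chart_x] in auto)
      moreover have "\<forall>\<^sub>F z in nhds (a, p). x (snd z) \<in> ball 0 1"
        by (rule topological_tendstoD[OF x]) (use True in auto)
      ultimately show ?thesis by eventually_elim (simp add: twist_def B_iff)
    qed
    ultimately show ?thesis by (simp add: tendsto_cong)
  qed
  moreover have "Ck_at k (\<lambda>a. local_rep (U, x) (U, x) (twist a)) a (x p)" for k
    using Ck_at_cong[OF rep Ck_at_rotate] .
  ultimately show ?thesis
    using chart True tB unfolding smooth_family_at_def
    by (intro conjI bexI[of _ "(U, x)"]) auto
next
  case False
  let ?K = "x_inv ` cball 0 (1/2)"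
  have sub: "cball 0 (1/2) \<subseteq> x ` U" proof -
    have "cball 0 (1/2) \<subseteq> cball (0 :: complex) 1" by auto
    also have "\<dots> \<subseteq> x ` U" unfolding xB[symmetric] using BU by (rule image_mono)
    finally show ?thesis .
  qed
  have "continuous_on (x ` U) x_inv" using is_chart_x by (simp add: is_chart_def homeomorphism_def)
  then have "compact ?K"
    using sub by (intro compact_continuous_image) (auto intro: continuous_on_subset)
  then have "open (- ?K)" by (simp add: compact_imp_closed open_Compl)
  have "p \<notin> ?K"
  proof
    assume "p \<in> ?K"
    then obtain z where z: "cmod z \<le> 1/2" "p = x_inv z" by auto
    then show False using False x_inv_in_B[of z] BU by auto
  qed
  have id: "twist b p' = p'" if "p' \<notin> ?K" for b p'
  proof (cases "p' \<in> B")
    case True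
    have "\<not> cmod (x p') \<le> 1/2"
    proof
      assume "cmod (x p') \<le> 1/2"
      then have "x_inv (x p') \<in> ?K" by (intro imageI) simp
      then show False using that True BU by auto
    qed
    then show ?thesis using True BU by (auto simp: twist_def rotate_outside)
  qed (simp add: twist_def)
  have "\<forall>\<^sub>F z in nhds (a, p). snd z \<in> - ?K"
    by (rule topological_tendstoD[OF tendsto_snd_nhds \<open>open (- ?K)\<close>]) (use \<open>p \<notin> ?K\<close> in simp)
  then have "\<forall>\<^sub>F z in nhds (a, p). id (snd z) = twist (fst z) (snd z)"
    by eventually_elim (simp add: id)
  from smooth_family_at_cong[where G = "\<lambda>_. id", OF this smooth_map_imp_family[OF \<Sigma> \<Sigma> smooth_map_id[OF \<Sigma>]]]
  show ?thesis .
qed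

definition \<Phi> :: "(nat \<Rightarrow> real) \<Rightarrow> 's \<times> 'l \<Rightarrow> 's \<times> 'l" where
  "\<Phi> a = map_prod (twist a) id"

lemma smooth_family_\<Phi>: "smooth_family_at M M \<Phi> a m"
  using smooth_family_at_product[OF \<Sigma> \<Lambda> smooth_family_twist] by (cases m) (simp add: \<Phi>_def[abs_def])

lemma \<Phi>_Diff: "\<Phi> a \<in> Diff M"
proof -
  have inv: "\<Phi> a (\<Phi> (\<lambda>n. - a n) m) = m" "\<Phi> (\<lambda>n. - a n) (\<Phi> a m) = m" for m
    by (cases m, simp add: \<Phi>_def)+
  then have "inv (\<Phi> a) = \<Phi> (\<lambda>n. - a n)" by (intro inv_equality)
  moreover have "bij (\<Phi> a)" using inv by (intro bijI') (metis, metis)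
  ultimately show ?thesis
    using smooth_family_imp_smooth_map[OF smooth_M smooth_M smooth_family_\<Phi>] by (simp add: Diff_def)
qed

text \<open>A whole number of steps carries each ring to itself. Intermediate parameters still give
  diffeomorphisms, which serve for continuity, but these need not preserve
  \<open>f_fun\<close>.\<close>

definition binary :: "(nat \<Rightarrow> real) \<Rightarrow> bool" where
  "binary a \<longleftrightarrow> (\<forall>n. a n = 0 \<or> a n = 1)"

lemma \<Phi>_Poiss:
  assumes "binary a"
  shows "\<Phi> a \<in> Poiss M \<pi>"
  unfolding \<Phi>_def
proof (rule product_with_id_Poisson)
  show "map_prod (twist a) id \<in> Diff M" using \<Phi>_Diff by (simp add: \<Phi>_def)
  show "f_fun \<eta> B x (twist a p) = f_fun \<eta> B x p" for p
    using assms twist_in_B[of p a] u_local_rotate[of a "x p"]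
    by (cases "p \<in> B") (auto simp: f_fun_def u_fun_def binary_def twist_def)
qed

lemma \<Phi>_0: "\<Phi> (\<lambda>_. 0) = id"
proof -
  have "twist (\<lambda>_. 0) p = p" for p using BU by (auto simp: twist_def)
  then show ?thesis by (auto simp: \<Phi>_def)
qed

section \<open>Path components near the identity\<close>

abbreviation "X \<equiv> Poiss_topology M \<pi>"

lemma topspace_X: "topspace X = Poiss M \<pi>"
  using topspace_Cinf[OF smooth_M smooth_M]
  by (auto simp: Poiss_topology_def Diff_topology_def Poiss_def Diff_def)

text \<open>The centre of one bump of ring \<open>n\<close> is followed along the path. It has to
  visit the centres of two neighbouring bumps without leaving the set where u is positive. The two
  maps need not be the endpoints, so the direction of the path is immaterial.\<close>

lemma no_path:
  assumes "binary a" "binary b" "8 \<le> n" "a n = 1" "b n = 0" and g: "pathin X g" and "\<Phi> a \<in> g ` {0..1}" "\<Phi> b \<in> g ` {0..1}"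
  shows False
proof -
  \<comment> \<open>Bumps are numbered from 1. The twist for \<open>a\<close> moves bump 1 to bump
    2, the twist for \<open>b\<close> fixes it.\<close>
  define p where "p = x_inv (bump_point n 1)"
  \<comment> \<open>An arbitrary point of \<Lambda>: a Poisson map gives all points of one leaf the
    same \<Sigma>-component.\<close>
  define q :: 'l where "q = undefined"
  let ?\<sigma> = "\<lambda>t. fst (g t (p, q))"
  have n: "4 \<le> n" "n > 0" using assms(3) by auto
  have s: "1 \<in> {1..2^n :: nat}" by simp
  have "cmod (bump_point n 1) \<le> 1" using n by (simp add: norm_bump_point)
  from x_inv_in_B[OF this] have p: "p \<in> B" "x p = bump_point n 1" by (simp_all add: p_def)
  have up: "u_local \<eta> (bump_point n 1) > 0"
    using u_local_pos[OF n(1) s] bump_radius_pos[OF n(2)] by simp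
  have gX: "g t \<in> Poiss M \<pi>" if "t \<in> {0..1}" for t
    using g that topspace_X by (auto simp: pathin_def continuous_map_def)
  \<comment> \<open>The function \<open>f_fun\<close> exceeds 1 at \<open>p\<close> and does not
    decrease under \<open>g t\<close>. Outside \<open>B\<close> it equals 1, so the moved point lies
    in \<open>B\<close> and u is positive there.\<close>
  have pos: "?\<sigma> t \<in> B \<and> u_local \<eta> (x (?\<sigma> t)) > 0" if "t \<in> {0..1}" for t
    using Poisson_leaf_volume[OF gX[OF that] compact_\<Lambda> connected_\<Lambda>, of p q] p up
    by (auto simp: f_fun_def u_fun_def split: if_splits)
  have "continuous_map (top_of_set {0..1}) (Cinf_topology M M) g"
    using g by (simp add: pathin_def Poiss_topology_def Diff_topology_def continuous_map_in_subtopology)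
  from continuous_map_compose[OF this continuous_map_eval[OF smooth_M smooth_M, of "(p, q)"]]
  have "continuous_on {0..1} (\<lambda>t. g t (p, q))" by (simp add: o_def)
  then have \<sigma>: "continuous_on {0..1} ?\<sigma>" by (rule continuous_on_fst)
  have "continuous_on B x"
    using is_chart_x BU by (auto simp: is_chart_def homeomorphism_def intro: continuous_on_subset)
  from continuous_on_compose2[OF this \<sigma>] have "continuous_on {0..1} (\<lambda>t. x (?\<sigma> t))"
    using pos by blast
  then have conn: "connected ((\<lambda>t. x (?\<sigma> t)) ` {0..1})" by (intro connected_continuous_image) auto
  have near: "near_circle n (bump_point n 1)"
    using near_circleI[OF n(1), of "bump_point n 1" 1] bump_radius_pos[OF n(2)] by simp
  have val: "x (fst (\<Phi> c (p, q))) = rotate c (bump_point n 1)" for c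
    using twist_in_B(2)[OF p(1)] p(2) by (simp add: \<Phi>_def)
  have a: "x (fst (\<Phi> a (p, q))) = bump_point n 2"
    using rotate_near_circle[OF assms(3) near, of a] assms(4) bump_point_Suc[of n 1] val[of a] by (simp add: numeral_2_eq_2)
  have b: "x (fst (\<Phi> b (p, q))) = bump_point n 1"
    using rotate_near_circle[OF assms(3) near, of b] assms(5) val[of b] by simp
  have mem: "bump_point n 1 \<in> (\<lambda>t. x (?\<sigma> t)) ` {0..1}" "bump_point n 2 \<in> (\<lambda>t. x (?\<sigma> t)) ` {0..1}"
  proof -
    obtain t t' where t: "t \<in> {0..1}" "g t = \<Phi> b" and t': "t' \<in> {0..1}" "g t' = \<Phi> a"
      using assms(7,8) by (metis image_iff)
    show "bump_point n 1 \<in> (\<lambda>t. x (?\<sigma> t)) ` {0..1}"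
      by (rule image_eqI[OF _ t(1)]) (simp add: t(2) b)
    show "bump_point n 2 \<in> (\<lambda>t. x (?\<sigma> t)) ` {0..1}"
      by (rule image_eqI[OF _ t'(1)]) (simp add: t'(2) a)
  qed
  have "(\<lambda>t. x (?\<sigma> t)) ` {0..1} \<subseteq> ball (bump_point n 1) (bump_radius n)"
    by (rule connected_subset_bump[OF n(1) s conn _ mem(1)]) (use pos in auto)
  then have "cmod (bump_point n 2 - bump_point n 1) < bump_radius n"
    using mem(2) by (auto simp: dist_norm norm_minus_commute)
  moreover have "2 * bump_radius n \<le> cmod (bump_point n 2 - bump_point n 1)"
    using dist_bump_point[of 1 2 n] one_less_power[of "2::nat" n] n by simp
  ultimately show False using bump_radius_pos[OF n(2)] by simp
qed

text \<open>A basic neighbourhood of the zero sequence leaves the coordinates in a cofinite set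
  free. Each subset \<open>T\<close> of these gives a twist in the neighbourhood, and two different
  subsets differ in some coordinate, where \<open>no_path\<close> separates them.\<close>

lemma uncountable_path_components:
  assumes V: "openin X V" "id \<in> V"
  shows "uncountable {C \<in> path_components_of X. C \<inter> V \<noteq> {}}"
proof -
  obtain W where W: "openin (Cinf_topology M M) W" "V = W \<inter> Diff M \<inter> Poiss M \<pi>"
    using V(1) by (auto simp: Poiss_topology_def Diff_topology_def openin_subtopology)
  have "\<forall>\<^sub>F a in nhds (\<lambda>_. 0). \<Phi> a \<in> W"
    using smooth_family_Cinf_open[OF smooth_M smooth_M smooth_family_\<Phi> W(1), of "\<lambda>_. 0"] V(2) W(2) \<Phi>_0 by simp
  then obtain S where S: "open S" "(\<lambda>_. 0) \<in> S" "\<And>a. a \<in> S \<Longrightarrow> \<Phi> a \<in> W" by (auto simp: eventually_nhds)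
  obtain Y where Y: "(\<lambda>_. 0) \<in> (\<Pi>\<^sub>E i\<in>UNIV. Y i)" "finite {i. Y i \<noteq> UNIV}" "(\<Pi>\<^sub>E i\<in>UNIV. Y i) \<subseteq> S"
    using product_topology_open_contains_basis[of "\<lambda>_. euclidean" UNIV S "\<lambda>_. 0"] S(1,2)
    by (auto simp: open_fun_def)
  \<comment> \<open>The unconstrained coordinates, without the rings below 8, which the rotations do
    not move.\<close>
  define I where "I = - ({i. Y i \<noteq> UNIV} \<union> {..<8::nat})"
  have "infinite I" unfolding I_def using Y(2) finite_compl[of "{i. Y i \<noteq> UNIV} \<union> {..<8::nat}"] by (simp del: Compl_Un)
  define a :: "nat set \<Rightarrow> nat \<Rightarrow> real" where "a T n = (if n \<in> T then 1 else 0)" for T n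
  have bin: "binary (a T)" for T by (simp add: binary_def a_def)
  have \<Phi>V: "\<Phi> (a T) \<in> V" if "T \<subseteq> I" for T
  proof -
    have "a T \<in> (\<Pi>\<^sub>E i\<in>UNIV. Y i)"
    proof (rule PiE_I)
      fix i
      show "a T i \<in> Y i" using Y(1) that by (cases "Y i = UNIV") (auto simp: a_def I_def PiE_iff)
    qed simp
    then show ?thesis using S(3) Y(3) W(2) \<Phi>_Diff \<Phi>_Poiss[OF bin] by auto
  qed
  define C where "C T = Collect (path_component_of X (\<Phi> (a T)))" for T
  have C: "C T \<in> {C \<in> path_components_of X. C \<inter> V \<noteq> {}}" if "T \<subseteq> I" for T
  proof -
    have "\<Phi> (a T) \<in> topspace X" using topspace_X \<Phi>_Poiss[OF bin] by simp
    then have "\<Phi> (a T) \<in> C T" "C T \<in> path_components_of X"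
      by (auto simp: C_def path_component_of_refl path_components_of_def)
    then show ?thesis using \<Phi>V[OF that] by blast
  qed
  have inj: "inj_on C (Pow I)"
  proof (rule inj_onI)
    have False if "C T = C T'" "n \<in> T" "n \<notin> T'" "T \<subseteq> I" for T T' n
    proof -
      have "path_component_of X (\<Phi> (a T')) (\<Phi> (a T'))"
        using topspace_X \<Phi>_Poiss[OF bin] by (simp add: path_component_of_refl)
      then have "path_component_of X (\<Phi> (a T)) (\<Phi> (a T'))" using that(1) by (auto simp: C_def)
      then obtain g where g: "pathin X g" "g 0 = \<Phi> (a T)" "g 1 = \<Phi> (a T')" by (auto simp: path_component_of_def)
      have "g 0 \<in> g ` {0..1}" "g 1 \<in> g ` {0..1}" by auto
      moreover have "8 \<le> n" using that by (auto simp: I_def)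
      ultimately show False
        using no_path[OF bin[of T] bin[of T'] \<open>8 \<le> n\<close> _ _ g(1)] that(2,3) unfolding g(2,3) by (simp add: a_def)
    qed
    then show "T = T'" if "T \<in> Pow I" "T' \<in> Pow I" "C T = C T'" for T T'
      using that by (metis PowD subsetI subset_antisym)
  qed
  have "uncountable (C ` Pow I)"
    using uncountable_Pow_infinite[OF \<open>infinite I\<close>] inj countable_image_inj_on by blast
  moreover have "C ` Pow I \<subseteq> {C \<in> path_components_of X. C \<inter> V \<noteq> {}}" using C by blast
  ultimately show ?thesis using countable_subset by blast
qed

text \<open>A path-connected set around the identity lies in one path component, so an open set
  inside it would meet only that one instead of uncountably many.\<close>

lemma not_locally_path_connected: "\<not> locally_path_connected_space X"
proof
  assume "locally_path_connected_space X"
  moreover have "id \<in> topspace X" using topspace_X \<Phi>_Poiss[of "\<lambda>_. 0"] \<Phi>_0 by (simp add: binary_def)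
  ultimately obtain V P where V: "openin X V" "id \<in> V" "V \<subseteq> P" "path_connectedin X P"
    unfolding locally_path_connected_space_def neighbourhood_base_of by (metis openin_topspace)
  have "{C \<in> path_components_of X. C \<inter> V \<noteq> {}} \<subseteq> {Collect (path_component_of X id)}"
  proof
    fix C assume "C \<in> {C \<in> path_components_of X. C \<inter> V \<noteq> {}}"
    then obtain y z where y: "C = Collect (path_component_of X y)" and z: "z \<in> C" "z \<in> V"
      by (auto simp: path_components_of_def)
    have "path_component_of X id z"
      using subsetD[OF path_component_of_maximal[OF V(4), of id], of z] V(2,3) z(2) by auto
    then have "path_component_of X id = path_component_of X y"
      using z(1) unfolding y by (simp add: path_component_of_equiv)
    then show "C \<in> {Collect (path_component_of X id)}" using y by simp
  qed
  then have "countable {C \<in> path_components_of X. C \<inter> V \<noteq> {}}" by (rule countable_subset) simp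
  then show False using uncountable_path_components[OF V(1,2)] by simp
qed

end

theorem mainTheorem2:
  fixes \<Sigma> :: "('s::{t2_space, second_countable_topology}, complex) chart set"
    and \<Lambda> :: "('l::{t2_space, second_countable_topology}, complex) chart set"
    and \<nu> :: "('l, complex) two_form"
    and U B :: "'s set" and x :: "'s \<Rightarrow> complex" and \<eta> :: "real \<Rightarrow> real"
    and \<pi> :: "('s \<times> 'l, complex \<times> complex) bivector"
  assumes "smooth_atlas \<Sigma>" and "compact (UNIV :: 's set)"
    and "oriented_atlas \<Lambda>" and "compact (UNIV :: 'l set)" and "connected (UNIV :: 'l set)"
    and "volume_form \<Lambda> \<nu>"
    and "(U, x) \<in> max_atlas \<Sigma>" and "B \<subseteq> U" and "x ` B = cball 0 1"
    and "cutoff \<eta>"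
    and "poisson_structure (product_atlas \<Sigma> \<Lambda>) \<pi>"
    and "regular_bivector (product_atlas \<Sigma> \<Lambda>) \<pi>"
    and "\<And>p. symplectic_leaf (product_atlas \<Sigma> \<Lambda>) \<pi> \<Lambda> (\<lambda>q. (p, q))
               (\<lambda>c q v w. f_fun \<eta> B x p * \<nu> c q v w)"
  shows "\<not> locally_path_connected_space (Poiss_topology (product_atlas \<Sigma> \<Lambda>) \<pi>) \<and>
    (\<forall>N V. openin (Poiss_topology (product_atlas \<Sigma> \<Lambda>) \<pi>) V \<and> id \<in> V \<and> V \<subseteq> N \<and>
           N \<subseteq> topspace (Poiss_topology (product_atlas \<Sigma> \<Lambda>) \<pi>) \<longrightarrow>
       uncountable {C \<in> path_components_of (Poiss_topology (product_atlas \<Sigma> \<Lambda>) \<pi>).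
                      C \<inter> N \<noteq> {}})"
proof -
  interpret bump_rotation \<eta> by standard (rule assms(10))
  have f_pos: "f_fun \<eta> B x p > 0" for p
    using u_local_nonneg[of "x p"] by (simp add: f_fun_def u_fun_def)
  interpret bump_surface \<Sigma> \<Lambda> \<nu> \<eta> B x \<pi> U
    by standard (use assms f_pos in \<open>auto simp: oriented_atlas_def poisson_structure_def\<close>)
  have "uncountable {C \<in> path_components_of X. C \<inter> N \<noteq> {}}" if "openin X V" "id \<in> V" "V \<subseteq> N" for N V
  proof
    assume c: "countable {C \<in> path_components_of X. C \<inter> N \<noteq> {}}"
    have "{C \<in> path_components_of X. C \<inter> V \<noteq> {}} \<subseteq> {C \<in> path_components_of X. C \<inter> N \<noteq> {}}" using that(3) by blast
    from countable_subset[OF this c] show False using uncountable_path_components[OF that(1,2)] by simp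
  qed
  then show ?thesis using not_locally_path_connected by blast
qed

end
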